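(* Let $d\ge 5$. For every $(\tfrac1p,\tfrac1r)\in\mathcal R(d)$ there is a constant $A=A(d,p,r)$ such that for every $f\in\ell^p(\mathbb Z^d)$ and every $\Lambda\in\{1,2,4,8,\dots\}$, $$\Big\|\sup_{\lambda\in\tilde\Lambda,\ \Lambda\le\lambda<2\Lambda}|\mathscr A_\lambda f|\Big\|_{\ell^{r'}(\mathbb Z^d)}\le A\,\Lambda^{d(1/r'-1/p)}\|f\|_{\ell^p(\mathbb Z^d)}.$$ Moreover, if $1\le p,r\le\infty$ are such that an estimate of this form holds with a constant $A$ independent of $\Lambda\in\{1,2,4,\dots\}$ and $f$, then $\max\{\tfrac1p+\tfrac2d,\ \tfrac1r+\tfrac{2}{pd}\}\le 1$.
   Context: $|x|$ denotes the Euclidean norm on $\mathbb Z^d$. $\tilde\Lambda=\{\lambda>0:\lambda^2\in\mathbb Z,\ \lambda^2\ge1\}$. For $\lambda\in\tilde\Lambda$ and $f:\mathbb Z^d\to\mathbb C$, the discrete spherical average is $\mathscr A_\lambda f(x)=\frac{1}{\#\{y\in\mathbb Z^d:|y|=\lambda\}}\sum_{y\in\mathbb Z^d:|y|=\lambda}f(x-y)$. For $1\le r\le\infty$, $r'$ denotes the conjugate exponent, $1/r+1/r'=1$. $\mathcal R(d)$ is the interior of the convex hull of the three points $(0,1)$, $(\frac{d-2}{d},\frac2d)$, $(\frac{d-2}{d},\frac{d-2}{d})$ in the plane of coordinates $(\frac1p,\frac1r)$. *)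

theory Defs
  imports "HOL-Analysis.Analysis"
begin

text \<open>Power on [0,\<infinity>] for positive real exponents.\<close>
definition enn_pow :: "ennreal \<Rightarrow> real \<Rightarrow> ennreal" where
  "enn_pow x a = (if x = top then top else ennreal (enn2real x powr a))"

text \<open>The l^p norm, parametrised by s = 1/p in [0,1] (s = 0 means p = \<infinity>),
  of a nonnegative function on a discrete set (counting measure).\<close>
definition lp_norm :: "real \<Rightarrow> ('a \<Rightarrow> ennreal) \<Rightarrow> ennreal" where
  "lp_norm s g = (if s = 0 then (SUP x. g x)
     else enn_pow (\<integral>\<^sup>+ x. enn_pow (g x) (1 / s) \<partial>count_space UNIV) s)"

definition sqnorm :: "int ^ 'n \<Rightarrow> int" where
  "sqnorm y = (\<Sum>i\<in>UNIV. (y $ i)^2)"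

definition Lambda_tilde :: "real set" where
  "Lambda_tilde = {lam. lam > 0 \<and> lam^2 \<in> \<int> \<and> lam^2 \<ge> 1}"

definition sphere_pts :: "real \<Rightarrow> (int ^ 'n) set" where
  "sphere_pts lam = {y. sqrt (real_of_int (sqnorm y)) = lam}"

definition sph_avg :: "real \<Rightarrow> (int ^ 'n \<Rightarrow> complex) \<Rightarrow> int ^ 'n \<Rightarrow> complex" where
  "sph_avg lam f x = (\<Sum>y\<in>sphere_pts lam. f (x - y)) / of_nat (card (sphere_pts lam :: (int ^ 'n) set))"

definition dyad_max :: "real \<Rightarrow> (int ^ 'n \<Rightarrow> complex) \<Rightarrow> int ^ 'n \<Rightarrow> ennreal" where
  "dyad_max \<Lambda> f x = (SUP lam\<in>{lam\<in>Lambda_tilde. \<Lambda> \<le> lam \<and> lam < 2 * \<Lambda>}. ennreal (cmod (sph_avg lam f x)))"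

text \<open>The region R(d) in coordinates (1/p, 1/r).\<close>
definition region_R :: "real \<Rightarrow> (real \<times> real) set" where
  "region_R d = interior (convex hull {(0, 1), ((d - 2) / d, 2 / d), ((d - 2) / d, (d - 2) / d)})"

end

theory Submission
  imports Defs "HOL-Complex_Analysis.Conformal_Mappings"
begin

text \<open>
  Let \<open>d\<close> be the dimension and \<open>\<Lambda> = 2 ^ k\<close>. Writing the condition \<open>|y|\<^sup>2 = n\<close> as an integral of
  \<open>e (\<alpha> (|y|\<^sup>2 - n))\<close> over \<open>\<alpha> \<in> [0, 1]\<close>, the supremum over \<open>n\<close> is dominated by the integral over \<open>\<alpha>\<close> of
  the convolution of \<open>f\<close> with the quadratic phase \<open>e (\<alpha> |y|\<^sup>2)\<close> cut off to a box of side about \<open>\<Lambda>\<close>. This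
  convolution maps \<open>\<ell>\<^sup>1\<close> to \<open>\<ell>\<^sup>\<infinity>\<close> and to \<open>\<ell>\<^sup>1\<close> trivially, and on \<open>\<ell>\<^sup>2\<close> its squared norm is at most \<open>W(\<alpha>) ^ d\<close>,
  where \<open>W(\<alpha>)\<close> is the \<open>\<ell>\<^sup>1\<close> norm of the autocorrelation of the one-dimensional phase, a sum of geometric
  sums. Riesz-Thorin interpolation bounds the norm at \<open>(1/p, 1/r)\<close> by a power of \<open>\<Lambda>\<close> times
  \<open>W(\<alpha>) powr (d (1 - 1/p))\<close>. Dirichlet approximation shows that \<open>\<integral> W(\<alpha>) powr \<sigma> \<le> C \<Lambda> powr (2 \<sigma> - 2)\<close> for
  \<open>\<sigma> > 2\<close>, that is for \<open>1/p < 1 - 2/d\<close>. The rest of the region follows from Jensen's inequality, which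
  scales estimates towards the trivial one at \<open>(0, 1)\<close>.

  The normalisation needs at least \<open>c n powr (d/2 - 1)\<close> lattice points on each sphere. For \<open>d = 5\<close> this follows
  from Jacobi's count of sums of four odd squares, obtained by comparing a recurrence for that count
  with the same recurrence for the divisor sum; the latter is proved with Zagier-type involutions on the
  solutions of \<open>a\<^sup>2 + 4 b c = N\<close>.

  Necessity is tested on a point mass and on the indicator of a sphere with few points.
\<close>

section \<open>Sums of four odd squares\<close>

text \<open>The supremum is linearised: a function \<nu> picks a maximising squared radius at each
  x. The modulations e(-\<alpha> \<nu>(x)) have modulus 1 and depend on x alone, so every bound at
  fixed \<alpha> is uniform in \<nu>; the price is to integrate an operator norm in modulus. That
  norm contains W(\<alpha>)^(d (1 - s)) with s = 1/p, so the moment condition \<sigma> = d (1 - s) >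
  2 is the vertical edge of the region. The powers of \<Lambda> then balance exactly, because a
  sphere has at least c \<Lambda>^(d - 2) points. In dimension 4 such a count is false: 4^j has 24
  representations for every j \<ge> 1. Hence induction on the dimension starts at 5, and parity has
  to be dealt with there. Four odd squares are convenient because their count and the divisor sum
  obey one recurrence for N = 5 mod 8, from which the value at N - 1 can be isolated. All estimates
  are proved for finite sums, with constants independent of the sets; norms over the lattice enter
  only at the end.\<close>

definition zagier_set :: "int \<Rightarrow> (int \<times> int \<times> int) set" where
  "zagier_set N = {(a, b, c). 0 < b \<and> 0 < c \<and> a\<^sup>2 + 4 * b * c = N}"

lemma abs_le_power2_int: "\<bar>a::int\<bar> \<le> a\<^sup>2"
proof (cases "a = 0")
  case False
  then have "\<bar>a\<bar> * 1 \<le> \<bar>a\<bar> * \<bar>a\<bar>" by (intro mult_left_mono) auto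
  then show ?thesis by (simp add: power2_eq_square)
qed simp

lemma finite_zagier_set: "finite (zagier_set N)"
proof (rule finite_subset)
  show "zagier_set N \<subseteq> {-N..N} \<times> {0..N} \<times> {0..N}"
  proof
    fix t assume "t \<in> zagier_set N"
    then obtain a b c where t: "t = (a, b, c)" and b: "0 < b" and c: "0 < c" and N: "a\<^sup>2 + 4 * b * c = N"
      by (auto simp: zagier_set_def)
    note 1 = abs_le_power2_int[of a]
    have bc: "b \<le> b * c" "c \<le> b * c" "0 < b * c" "0 \<le> a\<^sup>2"
      using b c by (auto simp: mult_le_cancel_left1 mult_le_cancel_right1)
    then show "t \<in> {-N..N} \<times> {0..N} \<times> {0..N}"
      using 1 b c unfolding t N[symmetric] mult.assoc mem_Times_iff atLeastAtMost_iff fst_conv snd_conv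
      by linarith
  qed
qed auto

lemma square_mod_8_ne_5: "(x::int)\<^sup>2 mod 8 \<noteq> 5"
proof -
  have "x mod 8 \<in> {0,1,2,3,4,5,6,7}"
    by (simp only: insert_iff empty_iff simp_thms) presburger
  moreover have "x\<^sup>2 mod 8 = (x mod 8)\<^sup>2 mod 8" by (simp add: power_mod)
  ultimately show ?thesis by auto
qed

text \<open>With \<open>e = c - a - b\<close> one has \<open>N = e\<^sup>2 + b\<^sup>2 + c\<^sup>2 + 2 e b - 2 e c + 2 b c\<close>, so exchanging \<open>c\<close> and \<open>e\<close>
  preserves \<open>N\<close>. Subtracting \<open>a b\<^sup>2\<close>, which is odd in \<open>a\<close>, makes the symmetrised summand vanish identically.\<close>
lemma zagier_set_sum_zero:
  assumes N: "N mod 8 = 5"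
  shows "(\<Sum>(a, b, c)\<in>zagier_set N. b * (b * c - a\<^sup>2)) = 0"
proof -
  let ?S = "zagier_set N"
  define Sp where "Sp = {(a, b, c) \<in> ?S. a + b < c}"
  define Sm where "Sm = {(a, b, c) \<in> ?S. c < a + b}"
  define P where "P = (\<lambda>(a::int, b::int, c::int). b * (b * c - a\<^sup>2 - a * b))"
  define Q where "Q = (\<lambda>(a::int, b::int, c::int). b * (b * c - a\<^sup>2 - a * b) + c * (b * c - a\<^sup>2 + a * c))"
  have "(\<Sum>(a, b, c)\<in>?S. a * b\<^sup>2) = (\<Sum>(a, b, c)\<in>?S. - (a * b\<^sup>2))"
    by (rule sum.reindex_bij_witness[where i="\<lambda>(a,b,c). (-a,b,c)" and j="\<lambda>(a,b,c). (-a,b,c)"])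
       (auto simp: zagier_set_def)
  then have odd: "(\<Sum>(a, b, c)\<in>?S. a * b\<^sup>2) = 0"
    by (simp add: case_prod_unfold sum_negf)
  have "(\<Sum>(a, b, c)\<in>?S. b * (b * c - a\<^sup>2)) = sum P ?S + (\<Sum>(a, b, c)\<in>?S. a * b\<^sup>2)"
    unfolding P_def sum.distrib[symmetric]
    by (rule sum.cong) (auto simp: algebra_simps power2_eq_square)
  also have "\<dots> = sum P ?S" using odd by simp
  finally have *: "(\<Sum>(a, b, c)\<in>?S. b * (b * c - a\<^sup>2)) = sum P ?S" .
  have "?S = Sp \<union> Sm"
  proof -
    have "c \<noteq> a + b" if "(a, b, c) \<in> ?S" for a b c
    proof
      assume "c = a + b"
      then have "(a + 2 * b)\<^sup>2 = N" using that
        by (auto simp: zagier_set_def power2_eq_square algebra_simps)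
      then show False using N square_mod_8_ne_5 by blast
    qed
    then show ?thesis unfolding Sp_def Sm_def by (fastforce simp: not_less order_le_less)
  qed
  then have "sum P ?S = sum P (Sp \<union> Sm)" by simp
  also have "sum P (Sp \<union> Sm) = sum P Sp + sum P Sm"
    by (rule sum.union_disjoint) (auto simp: Sp_def Sm_def intro: finite_subset[OF _ finite_zagier_set])
  \<comment> \<open>Changing the sign of \<open>a\<close> and swapping \<open>b\<close> with
    \<open>c\<close> folds the half \<open>c < a + b\<close> onto \<open>a + b < c\<close>. There
    \<open>e = c - a - b\<close> is positive, so exchanging \<open>c\<close> and \<open>e\<close>
    stays among positive solutions.\<close>
  also have "sum P Sm = (\<Sum>(a, b, c)\<in>Sp. c * (b * c - a\<^sup>2 + a * c))"
    unfolding P_def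
    by (rule sum.reindex_bij_witness[where i="\<lambda>(a,b,c). (-a,c,b)" and j="\<lambda>(a,b,c). (-a,c,b)"])
       (auto simp: zagier_set_def Sp_def Sm_def algebra_simps)
  also have "sum P Sp + \<dots> = sum Q Sp"
    unfolding P_def Q_def sum.distrib[symmetric] by (rule sum.cong) auto
  also have "sum Q Sp = 0"
  proof -
    have "sum Q Sp = (\<Sum>x\<in>Sp. - Q x)"
      by (rule sum.reindex_bij_witness[where i="\<lambda>(a,b,c). (-a-2*b,b,c-a-b)" and j="\<lambda>(a,b,c). (-a-2*b,b,c-a-b)"])
         (auto simp: zagier_set_def Sp_def Q_def algebra_simps power2_eq_square)
    then show ?thesis by (simp add: sum_negf)
  qed
  finally show ?thesis using * by simp
qed

section \<open>A common recurrence for odd representations and divisor sums\<close>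

definition odd_reps4 :: "int \<Rightarrow> (int \<times> int \<times> int \<times> int) set" where
  "odd_reps4 M = {(a, b, c, e). odd a \<and> odd b \<and> odd c \<and> odd e \<and> a\<^sup>2 + b\<^sup>2 + c\<^sup>2 + e\<^sup>2 = M}"

text \<open>The classical \<sigma>(m), indexed by factor pairs so that it is a weighted count of a
  fibre of \<open>zagier_set\<close> over \<open>a\<close>.\<close>

definition divisor_sum :: "int \<Rightarrow> int" where
  "divisor_sum m = (\<Sum>(b, c)\<in>{(b, c). 0 < b \<and> 0 < c \<and> b * c = m}. b)"

lemma finite_square_le: "finite {a::int. a\<^sup>2 \<le> N}"
proof (rule finite_subset)
  show "{a::int. a\<^sup>2 \<le> N} \<subseteq> {-N..N}"
  proof
    fix a :: int assume "a \<in> {a. a\<^sup>2 \<le> N}"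
    then show "a \<in> {-N..N}" using abs_le_power2_int[of a] by auto
  qed
qed auto

lemma finite_odd_reps4: "finite (odd_reps4 M)"
proof (rule finite_subset)
  show "odd_reps4 M \<subseteq> {-M..M} \<times> {-M..M} \<times> {-M..M} \<times> {-M..M}"
  proof (clarsimp simp: odd_reps4_def)
    fix a b c e :: int
    show "- (a\<^sup>2) - b\<^sup>2 - c\<^sup>2 - e\<^sup>2 \<le> a \<and> a \<le> a\<^sup>2 + b\<^sup>2 + c\<^sup>2 + e\<^sup>2 \<and>
        - (a\<^sup>2) - b\<^sup>2 - c\<^sup>2 - e\<^sup>2 \<le> b \<and> b \<le> a\<^sup>2 + b\<^sup>2 + c\<^sup>2 + e\<^sup>2 \<and>
        - (a\<^sup>2) - b\<^sup>2 - c\<^sup>2 - e\<^sup>2 \<le> c \<and> c \<le> a\<^sup>2 + b\<^sup>2 + c\<^sup>2 + e\<^sup>2 \<and>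
        - (a\<^sup>2) - b\<^sup>2 - c\<^sup>2 - e\<^sup>2 \<le> e \<and> e \<le> a\<^sup>2 + b\<^sup>2 + c\<^sup>2 + e\<^sup>2"
      using abs_le_power2_int[of a] abs_le_power2_int[of b] abs_le_power2_int[of c] abs_le_power2_int[of e]
        zero_le_power2[of a] zero_le_power2[of b] zero_le_power2[of c] zero_le_power2[of e]
      by linarith
  qed
qed auto

lemma odd_square_mod_8: "odd (x::int) \<Longrightarrow> x\<^sup>2 mod 8 = 1"
proof -
  assume "odd x"
  then have "x mod 8 \<in> {1,3,5,7}" by (simp only: insert_iff empty_iff simp_thms) presburger
  moreover have "x\<^sup>2 mod 8 = (x mod 8)\<^sup>2 mod 8" by (simp add: power_mod)
  ultimately show ?thesis by auto
qed

text \<open>In a sum of five odd squares equal to \<open>N\<close>, each square averages \<open>N / 5\<close> by symmetry.\<close>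
lemma odd_reps4_recurrence:
  "(\<Sum>a\<in>{a. odd a \<and> a\<^sup>2 \<le> N}. (N - 5 * a\<^sup>2) * int (card (odd_reps4 (N - a\<^sup>2)))) = 0"
proof -
  let ?A = "{a::int. odd a \<and> a\<^sup>2 \<le> N}"
  define T where "T = Sigma ?A (\<lambda>a. odd_reps4 (N - a\<^sup>2))"
  have finA: "finite ?A"
    by (rule finite_subset[OF _ finite_square_le[of N]]) auto
  have Tiff: "(a, b, c, d, e) \<in> T \<longleftrightarrow> odd a \<and> odd b \<and> odd c \<and> odd d \<and> odd e \<and> a\<^sup>2 + b\<^sup>2 + c\<^sup>2 + d\<^sup>2 + e\<^sup>2 = N" for a b c d e
    using zero_le_power2[of b] zero_le_power2[of c] zero_le_power2[of d] zero_le_power2[of e]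
    unfolding T_def odd_reps4_def by auto
  have "(\<Sum>a\<in>?A. (N - 5 * a\<^sup>2) * int (card (odd_reps4 (N - a\<^sup>2)))) = (\<Sum>a\<in>?A. \<Sum>x\<in>odd_reps4 (N - a\<^sup>2). N - 5 * a\<^sup>2)"
    by (simp add: mult.commute)
  also have "\<dots> = (\<Sum>(a, b, c, d, e)\<in>T. N - 5 * a\<^sup>2)"
    unfolding T_def by (subst sum.Sigma[OF finA]) (auto simp: finite_odd_reps4 case_prod_unfold)
  also have "\<dots> = (\<Sum>(a, b, c, d, e)\<in>T. (b\<^sup>2 - a\<^sup>2) + (c\<^sup>2 - a\<^sup>2) + (d\<^sup>2 - a\<^sup>2) + (e\<^sup>2 - a\<^sup>2))"
    by (rule sum.cong) (auto simp: Tiff)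
  also have "\<dots> = (\<Sum>(a, b, c, d, e)\<in>T. b\<^sup>2 - a\<^sup>2) + (\<Sum>(a, b, c, d, e)\<in>T. c\<^sup>2 - a\<^sup>2)
      + (\<Sum>(a, b, c, d, e)\<in>T. d\<^sup>2 - a\<^sup>2) + (\<Sum>(a, b, c, d, e)\<in>T. e\<^sup>2 - a\<^sup>2)"
    unfolding sum.distrib[symmetric] by (rule sum.cong) auto
  also have "(\<Sum>(a, b, c, d, e)\<in>T. b\<^sup>2 - a\<^sup>2) = 0"
  proof -
    have "(\<Sum>(a, b, c, d, e)\<in>T. b\<^sup>2) = (\<Sum>(a, b, c, d, e)\<in>T. a\<^sup>2)"
      by (rule sum.reindex_bij_witness[where i="\<lambda>(a,b,c,d,e). (b,a,c,d,e)" and j="\<lambda>(a,b,c,d,e). (b,a,c,d,e)"]) (auto simp: Tiff)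
    then show ?thesis by (simp add: case_prod_unfold sum_subtractf)
  qed
  also have "(\<Sum>(a, b, c, d, e)\<in>T. c\<^sup>2 - a\<^sup>2) = 0"
  proof -
    have "(\<Sum>(a, b, c, d, e)\<in>T. c\<^sup>2) = (\<Sum>(a, b, c, d, e)\<in>T. a\<^sup>2)"
      by (rule sum.reindex_bij_witness[where i="\<lambda>(a,b,c,d,e). (c,b,a,d,e)" and j="\<lambda>(a,b,c,d,e). (c,b,a,d,e)"]) (auto simp: Tiff)
    then show ?thesis by (simp add: case_prod_unfold sum_subtractf)
  qed
  also have "(\<Sum>(a, b, c, d, e)\<in>T. d\<^sup>2 - a\<^sup>2) = 0"
  proof -
    have "(\<Sum>(a, b, c, d, e)\<in>T. d\<^sup>2) = (\<Sum>(a, b, c, d, e)\<in>T. a\<^sup>2)"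
      by (rule sum.reindex_bij_witness[where i="\<lambda>(a,b,c,d,e). (d,b,c,a,e)" and j="\<lambda>(a,b,c,d,e). (d,b,c,a,e)"]) (auto simp: Tiff)
    then show ?thesis by (simp add: case_prod_unfold sum_subtractf)
  qed
  also have "(\<Sum>(a, b, c, d, e)\<in>T. e\<^sup>2 - a\<^sup>2) = 0"
  proof -
    have "(\<Sum>(a, b, c, d, e)\<in>T. e\<^sup>2) = (\<Sum>(a, b, c, d, e)\<in>T. a\<^sup>2)"
      by (rule sum.reindex_bij_witness[where i="\<lambda>(a,b,c,d,e). (e,b,c,d,a)" and j="\<lambda>(a,b,c,d,e). (e,b,c,d,a)"]) (auto simp: Tiff)
    then show ?thesis by (simp add: case_prod_unfold sum_subtractf)
  qed
  finally show ?thesis by simp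
qed

lemma finite_factor_pairs: "finite {(b::int, c). 0 < b \<and> 0 < c \<and> b * c = m}"
proof (rule finite_subset)
  show "{(b::int, c). 0 < b \<and> 0 < c \<and> b * c = m} \<subseteq> {0..m} \<times> {0..m}"
    by (auto simp: mult_le_cancel_left1 mult_le_cancel_right1)
qed auto

text \<open>On a solution of \<open>a\<^sup>2 + 4 * b * c = N\<close> the weight N - 5 a^2 equals 4
  (b c - a^2), and N = 5 mod 8 forces \<open>a\<close> to be odd. Fibring
  \<open>zagier_set N\<close> over \<open>a\<close> turns its vanishing sum into this
  recurrence.\<close>

lemma divisor_sum_recurrence:
  assumes N: "N mod 8 = 5"
  shows "(\<Sum>a\<in>{a. odd a \<and> a\<^sup>2 \<le> N}. (N - 5 * a\<^sup>2) * divisor_sum ((N - a\<^sup>2) div 4)) = 0"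
proof -
  let ?A = "{a::int. odd a \<and> a\<^sup>2 \<le> N}"
  define B where "B m = {(b::int, c). 0 < b \<and> 0 < c \<and> b * c = m}" for m
  have finA: "finite ?A"
    by (rule finite_subset[OF _ finite_square_le[of N]]) auto
  have eq: "zagier_set N = Sigma ?A (\<lambda>a. B ((N - a\<^sup>2) div 4))"
  proof (intro set_eqI, clarify)
    fix a b c
    have "odd a" if "a\<^sup>2 + 4 * b * c = N"
    proof (rule ccontr)
      assume "\<not> odd a"
      then obtain j where "a = 2 * j" by (auto elim: evenE)
      then have "N = 4 * (j\<^sup>2 + b * c)" using that by (simp add: power2_eq_square)
      then show False using N by presburger
    qed
    moreover have "a\<^sup>2 \<le> N" if "a\<^sup>2 + 4 * b * c = N" "0 < b" "0 < c"
    proof -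
      have "0 < b * c" using that by simp
      then show ?thesis using that by linarith
    qed
    moreover have "a\<^sup>2 + 4 * b * c = N \<longleftrightarrow> b * c = (N - a\<^sup>2) div 4" if "odd a"
    proof -
      have "4 dvd N - a\<^sup>2" using odd_square_mod_8[OF that] N by presburger
      then show ?thesis by auto
    qed
    ultimately show "((a, b, c) \<in> zagier_set N) = ((a, b, c) \<in> Sigma ?A (\<lambda>a. B ((N - a\<^sup>2) div 4)))"
      unfolding zagier_set_def B_def by auto
  qed
  have "(\<Sum>a\<in>?A. (N - 5 * a\<^sup>2) * divisor_sum ((N - a\<^sup>2) div 4))
      = (\<Sum>a\<in>?A. \<Sum>(b, c)\<in>B ((N - a\<^sup>2) div 4). (N - 5 * a\<^sup>2) * b)"
    by (simp add: divisor_sum_def B_def sum_distrib_left case_prod_unfold)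
  also have "\<dots> = (\<Sum>(a, b, c)\<in>zagier_set N. (N - 5 * a\<^sup>2) * b)"
    unfolding eq using finite_factor_pairs by (subst sum.Sigma[OF finA]) (auto simp: B_def intro!: sum.cong)
  also have "\<dots> = (\<Sum>(a, b, c)\<in>zagier_set N. 4 * (b * (b * c - a\<^sup>2)))"
    by (rule sum.cong) (auto simp: zagier_set_def algebra_simps)
  also have "\<dots> = 4 * (\<Sum>(a, b, c)\<in>zagier_set N. b * (b * c - a\<^sup>2))"
    by (simp add: sum_distrib_left case_prod_unfold)
  finally show ?thesis using zagier_set_sum_zero[OF N] by simp
qed

lemma odd_square_gt_1:
  assumes "odd (a::int)" "a \<noteq> 1" "a \<noteq> -1" shows "9 \<le> a\<^sup>2"
proof -
  have "3 \<le> \<bar>a\<bar>" using assms by presburger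
  then have "3\<^sup>2 \<le> \<bar>a\<bar>\<^sup>2" by (intro power_mono) auto
  then show ?thesis by simp
qed

text \<open>Jacobi's formula, by strong induction. Both counts obey the same recurrence at N = M +
  1. By induction their difference vanishes at every N - a^2 except for a = 1 and a = -1, where the
  argument is M itself. The coefficient there is N - 5 = M - 4, so M = 4 is computed directly and
  every larger M follows.\<close>

lemma card_odd_reps4:
  assumes "M mod 8 = 4" "M \<ge> 0"
  shows "int (card (odd_reps4 M)) = 16 * divisor_sum (M div 4)"
  using assms
proof (induction "nat M" arbitrary: M rule: less_induct)
  case less
  show ?case
  proof (cases "M = 4")
    case True
    have "odd_reps4 4 = {1,-1} \<times> {1,-1} \<times> {1,-1} \<times> {1,-1}"
    proof -
      have "a \<in> {1,-1} \<and> b \<in> {1,-1} \<and> c \<in> {1,-1} \<and> e \<in> {1,-1}"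
        if "odd a" "odd b" "odd c" "odd e" "a\<^sup>2 + b\<^sup>2 + c\<^sup>2 + e\<^sup>2 = 4" for a b c e :: int
        using that odd_square_gt_1[of a] odd_square_gt_1[of b] odd_square_gt_1[of c] odd_square_gt_1[of e]
          zero_le_power2[of a] zero_le_power2[of b] zero_le_power2[of c] zero_le_power2[of e]
        by (smt (verit) insert_iff)
      then have "odd_reps4 4 \<subseteq> {1,-1} \<times> {1,-1} \<times> {1,-1} \<times> {1,-1}"
        unfolding odd_reps4_def by (intro subsetI) (clarify, metis SigmaI)
      moreover have "{1,-1} \<times> {1,-1} \<times> {1,-1} \<times> {1,-1} \<subseteq> odd_reps4 4"
        unfolding odd_reps4_def by auto
      ultimately show ?thesis by blast
    qed
    moreover have "{(b::int, c). 0 < b \<and> 0 < c \<and> b * c = 1} = {(1,1)}"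
      by (auto simp: zmult_eq_1_iff)
    ultimately show ?thesis using True by (simp add: divisor_sum_def)
  next
    case False
    then have M: "M > 4" using less.prems by presburger
    define N where "N = M + 1"
    let ?A = "{a::int. odd a \<and> a\<^sup>2 \<le> N}"
    define D where "D a = int (card (odd_reps4 (N - a\<^sup>2))) - 16 * divisor_sum ((N - a\<^sup>2) div 4)" for a
    have N: "N mod 8 = 5" using less.prems unfolding N_def by presburger
    have "(\<Sum>a\<in>?A. (N - 5 * a\<^sup>2) * D a) = (\<Sum>a\<in>?A. (N - 5 * a\<^sup>2) * int (card (odd_reps4 (N - a\<^sup>2)))
        - 16 * ((N - 5 * a\<^sup>2) * divisor_sum ((N - a\<^sup>2) div 4)))"
      unfolding D_def by (rule sum.cong) (auto simp: right_diff_distrib)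
    also have "\<dots> = 0"
      using odd_reps4_recurrence[of N] divisor_sum_recurrence[OF N]
      by (simp add: sum_subtractf sum_distrib_left[symmetric])
    finally have 0: "(\<Sum>a\<in>?A. (N - 5 * a\<^sup>2) * D a) = 0" .
    have finA: "finite ?A"
      by (rule finite_subset[OF _ finite_square_le[of N]]) auto
    have D0: "D a = 0" if a: "a \<in> ?A - {1, -1}" for a
    proof -
      have "9 \<le> a\<^sup>2" using a odd_square_gt_1 by auto
      moreover have "(N - a\<^sup>2) mod 8 = 4" using odd_square_mod_8[of a] a N by (simp, presburger)
      ultimately show ?thesis unfolding D_def using less.hyps[of "N - a\<^sup>2"] a M by (auto simp: N_def)
    qed
    have sub: "{1, -1} \<subseteq> ?A" using M by (auto simp: N_def)
    have "(\<Sum>a\<in>?A. (N - 5 * a\<^sup>2) * D a) = (\<Sum>a\<in>{1,-1}. (N - 5 * a\<^sup>2) * D a)"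
      by (rule sum.mono_neutral_right[OF finA sub]) (use D0 in auto)
    also have "\<dots> = 2 * ((N - 5) * D 1)" by (simp add: D_def)
    finally have "D 1 = 0" using 0 M by (simp add: N_def)
    then show ?thesis by (simp add: D_def N_def)
  qed
qed

section \<open>Lattice points on spheres: lower bound\<close>

lemma divisor_sum_ge: "m \<ge> 1 \<Longrightarrow> m \<le> divisor_sum m"
proof -
  assume "m \<ge> 1"
  then show ?thesis
    using finite_factor_pairs[of m] member_le_sum[of "(m, 1)" "{(b::int, c). 0 < b \<and> 0 < c \<and> b * c = m}" "\<lambda>(b, c). b"]
    by (auto simp: divisor_sum_def)
qed

text \<open>Lists, because the dimension is an induction variable below and cannot vary inside a
  vector type.\<close>

definition sq_reps :: "nat \<Rightarrow> int \<Rightarrow> int list set" where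
  "sq_reps d n = {xs. length xs = d \<and> (\<Sum>x\<leftarrow>xs. x\<^sup>2) = n}"

lemma finite_sq_reps: "finite (sq_reps d n)"
proof (rule finite_subset)
  have "\<bar>x\<bar> \<le> (\<Sum>x\<leftarrow>xs. x\<^sup>2)" if "x \<in> set xs" for x :: int and xs
    using abs_le_power2_int[of x] member_le_sum_list[of "x\<^sup>2" "map (\<lambda>x. x\<^sup>2) xs"] that by force
  then show "sq_reps d n \<subseteq> {xs. set xs \<subseteq> {-n..n} \<and> length xs = d}"
    unfolding sq_reps_def by (fastforce simp: abs_le_iff)
qed (auto intro: finite_lists_length_eq)

text \<open>Negating one odd entry changes the coordinate sum by 2 mod 4, so exactly half of the odd
  representations of 4 m have a sum divisible by 4. On these a 4 by 4 Hadamard matrix divided by 4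
  is integral and injective, and it divides the sum of squares by 4. Hence the lower bound 16 m
  becomes 8 m.\<close>

lemma card_sq_reps_4_ge:
  assumes m: "odd m" "m \<ge> 1"
  shows "8 * m \<le> int (card (sq_reps 4 m))"
proof -
  let ?O = "odd_reps4 (4 * m)"
  define E where "E = {(a, b, c, e) \<in> ?O. 4 dvd a + b + c + e}"
  define F where "F = {(a, b, c, e) \<in> ?O. \<not> 4 dvd a + b + c + e}"
  have fin: "finite E" "finite F"
    unfolding E_def F_def by (rule finite_subset[OF _ finite_odd_reps4[of "4*m"]], auto)+
  have "card ?O = card E + card F"
    by (subst card_Un_disjoint[symmetric]) (use fin in \<open>auto simp: E_def F_def intro: arg_cong[where f=card]\<close>)
  moreover have "card F = card E"
  proof (rule bij_betw_same_card[of "\<lambda>(a,b,c,e). (-a,b,c,e)"], rule bij_betw_byWitness[where f'="\<lambda>(a,b,c,e). (-a,b,c,e)"])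
    have *: "4 dvd -a + b + c + e \<longleftrightarrow> \<not> 4 dvd a + b + c + e" if "odd a" "odd b" "odd c" "odd e" for a b c e :: int
      using that by presburger
    show "(\<lambda>(a,b,c,e). (-a,b,c,e)) ` F \<subseteq> E" "(\<lambda>(a,b,c,e). (-a,b,c,e)) ` E \<subseteq> F"
      unfolding E_def F_def odd_reps4_def using * by auto
  qed auto
  moreover have "16 * m \<le> int (card ?O)"
    using card_odd_reps4[of "4 * m"] divisor_sum_ge[of m] m by (auto simp: elim!: oddE)
  ultimately have E: "8 * m \<le> int (card E)" by simp
  define h where "h = (\<lambda>(a::int, b::int, c::int, e::int). [(a+b+c+e) div 4, (a+b-c-e) div 4, (a-b+c-e) div 4, (a-b-c+e) div 4])"
  have key: "\<exists>w x y z. a = w + x + y + z \<and> b = w + x - y - z \<and> c = w - x + y - z \<and> e = w - x - y + z"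
    if "(a, b, c, e) \<in> E" for a b c e
  proof -
    have o: "odd a" "odd b" "odd c" "odd e" and d: "4 dvd a + b + c + e" using that by (auto simp: E_def odd_reps4_def)
    have "4 dvd a + b - c - e" "4 dvd a - b + c - e" "4 dvd a - b - c + e" using o d by presburger+
    then obtain w x y z where "a + b + c + e = 4 * w" "a + b - c - e = 4 * x" "a - b + c - e = 4 * y" "a - b - c + e = 4 * z"
      using d by (auto elim!: dvdE)
    then show ?thesis by (intro exI[of _ w] exI[of _ x] exI[of _ y] exI[of _ z]) auto
  qed
  have hval: "h (w + x + y + z, w + x - y - z, w - x + y - z, w - x - y + z) = [w, x, y, z]" for w x y z
    unfolding h_def by (simp add: algebra_simps)
  have "inj_on h E"
  proof (rule inj_onI)
    fix u v assume "u \<in> E" "v \<in> E" "h u = h v"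
    then show "u = v" using key hval by (cases u; cases v) (smt (verit) list.inject)
  qed
  moreover have "h ` E \<subseteq> sq_reps 4 m"
  proof clarify
    fix a b c e assume abc: "(a, b, c, e) \<in> E"
    then obtain w x y z where *: "a = w + x + y + z" "b = w + x - y - z" "c = w - x + y - z" "e = w - x - y + z"
      using key by blast
    have "a\<^sup>2 + b\<^sup>2 + c\<^sup>2 + e\<^sup>2 = 4 * m" using abc by (auto simp: E_def odd_reps4_def)
    then have "w\<^sup>2 + x\<^sup>2 + y\<^sup>2 + z\<^sup>2 = m" unfolding * by (simp add: power2_eq_square algebra_simps)
    then show "h (a, b, c, e) \<in> sq_reps 4 m" using hval * by (simp add: sq_reps_def)
  qed
  ultimately have "card E \<le> card (sq_reps 4 m)"
    using card_inj_on_le finite_sq_reps by blast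
  then show ?thesis using E by linarith
qed

lemma card_sq_reps_Suc_ge:
  assumes "finite A"
  shows "(\<Sum>k\<in>A. card (sq_reps d (n - k\<^sup>2))) \<le> card (sq_reps (Suc d) n)"
proof -
  have "(\<Sum>k\<in>A. card (sq_reps d (n - k\<^sup>2))) = card (Sigma A (\<lambda>k. sq_reps d (n - k\<^sup>2)))"
    using assms finite_sq_reps by (simp add: card_SigmaI)
  also have "\<dots> \<le> card (sq_reps (Suc d) n)"
    by (rule card_inj_on_le[where f="\<lambda>(k, xs). k # xs"])
       (auto simp: inj_on_def sq_reps_def finite_sq_reps[unfolded sq_reps_def])
  finally show ?thesis .
qed

text \<open>The bound for four squares covers odd numbers only, so the extra coordinate
  \<open>k\<close> takes the parity opposite to that of \<open>n\<close>. With k at most sqrt (n /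
  2) the remainder is at least n / 2. Each such k contributes at least 4 n points, and there are at
  least sqrt n / 5 of them.\<close>

lemma card_sq_reps_5_ge:
  assumes n: "n \<ge> 1"
  shows "real_of_int n powr (3/2) / 2 \<le> card (sq_reps 5 n)"
proof -
  define p :: int where "p = (if even n then 1 else 0)"
  define y where "y = sqrt (n / 2)"
  define J where "J = nat \<lfloor>(y - p) / 2\<rfloor>"
  define A where "A = (\<lambda>j. 2 * int j + p) ` {0..J}"
  have inj: "inj_on (\<lambda>j. 2 * int j + p) {0..J}" by (auto simp: inj_on_def)
  \<comment> \<open>So the smallest candidate \<open>k = p\<close> is admissible and the floor in
    \<open>J\<close> is nonnegative.\<close>
  have p1: "y \<ge> p"
  proof (cases "even n")
    case True
    then have "n \<ge> 2" using n by presburger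
    then show ?thesis by (simp add: y_def p_def real_le_rsqrt)
  next
    case False then show ?thesis using n by (simp add: y_def p_def)
  qed
  have y0: "y > 0" using n by (simp add: y_def)
  have y2: "y\<^sup>2 = n / 2" using n by (simp add: y_def)
  have kA: "8 * (n / 2) \<le> real (card (sq_reps 4 (n - k\<^sup>2)))" if "k \<in> A" for k
  proof -
    obtain j where j: "j \<le> J" "k = 2 * int j + p" using \<open>k \<in> A\<close> by (auto simp: A_def)
    have "real j \<le> (y - p) / 2" using j p1 unfolding J_def by (simp add: le_nat_iff le_floor_iff)
    then have "real_of_int k \<le> y" using j by simp
    moreover have "k \<ge> 0" using j by (simp add: p_def)
    ultimately have "real_of_int k ^ 2 \<le> y\<^sup>2" by (intro power_mono) auto
    then have k2: "real_of_int (k\<^sup>2) \<le> n / 2" using y2 by simp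
    then have k2': "real_of_int n / 2 \<le> real_of_int (n - k\<^sup>2)" by simp
    then have "0 < real_of_int (n - k\<^sup>2)" using n by linarith
    then have pos: "n - k\<^sup>2 \<ge> 1" by linarith
    have "odd (n - k\<^sup>2)" using j by (auto simp: p_def)
    then have "real_of_int (8 * (n - k\<^sup>2)) \<le> card (sq_reps 4 (n - k\<^sup>2))"
      using card_sq_reps_4_ge[of "n - k\<^sup>2"] pos by linarith
    then show ?thesis using k2' by simp
  qed
  have "real (J + 1) * (4 * n) = (\<Sum>k\<in>A. 8 * (n / 2))"
    using card_image[OF inj] by (simp add: A_def)
  also have "\<dots> \<le> (\<Sum>k\<in>A. real (card (sq_reps 4 (n - k\<^sup>2))))"
    by (intro sum_mono kA)
  also have "\<dots> \<le> card (sq_reps 5 n)"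
    using card_sq_reps_Suc_ge[of A 4 n] by (simp add: A_def flip: of_nat_sum)
  finally have main: "real (J + 1) * (4 * n) \<le> card (sq_reps 5 n)" .
  have "(y - p) / 2 \<le> real (J + 1)" using p1 unfolding J_def by linarith
  moreover have "p \<le> 1" by (simp add: p_def)
  then have "real_of_int p \<le> 1" by simp
  ultimately have "y \<le> 3 * real (J + 1)" by (auto simp: field_simps)
  then have "y\<^sup>2 \<le> (3 * real (J + 1))\<^sup>2" using y0 by (intro power_mono) auto
  then have "real_of_int n \<le> 2 * (3 * real (J + 1))\<^sup>2" using y2 by simp
  also have "\<dots> \<le> (5 * real (J + 1))\<^sup>2" by (simp only: power_mult_distrib) simp
  finally have "real_of_int n \<le> (5 * real (J + 1))\<^sup>2" .
  then have "sqrt n \<le> sqrt ((5 * real (J + 1))\<^sup>2)" by (rule real_sqrt_le_mono)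
  then have "sqrt n \<le> 5 * real (J + 1)" by simp
  then have "sqrt n / 5 * (4 * n) \<le> real (J + 1) * (4 * n)" using n by (intro mult_right_mono) auto
  moreover have "real_of_int n powr (3/2) = n * sqrt n"
    using n powr_add[of n 1 "1/2"] by (simp add: powr_half_sqrt)
  moreover have "0 \<le> n * sqrt n" using n by simp
  ultimately show ?thesis using main by (simp add: algebra_simps)
qed

text \<open>Above dimension 5 parity no longer matters. Restricting the new coordinate to
  [0, sqrt (n / 2)] at worst halves the remainder and leaves about sqrt n choices, which is the gain
  of 1/2 in the exponent.\<close>

lemma card_sq_reps_ge:
  assumes "d \<ge> 5"
  shows "\<exists>c>0. \<forall>n\<ge>1. c * real_of_int n powr (d/2 - 1) \<le> card (sq_reps d n)"
  using assms
proof (induction d rule: nat_induct_at_least)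
  case base
  show ?case using card_sq_reps_5_ge by (intro exI[of _ "1/2"]) auto
next
  case (Suc d)
  then obtain c where c: "c > 0" "\<And>n. n \<ge> 1 \<Longrightarrow> c * real_of_int n powr (d/2 - 1) \<le> card (sq_reps d n)" by blast
  define e where "e = real d / 2 - 1"
  have e: "e > 0" using Suc by (simp add: e_def)
  define c' where "c' = c * (1/2) powr e * sqrt (1/2)"
  have "c' * real_of_int n powr (Suc d/2 - 1) \<le> card (sq_reps (Suc d) n)" if n: "n \<ge> 1" for n
  proof -
    define y where "y = sqrt (n / 2)"
    have y0: "y > 0" using n by (simp add: y_def)
    have y2: "y\<^sup>2 = n / 2" using n by (simp add: y_def)
    define A where "A = {0..\<lfloor>y\<rfloor>}"
    have kA: "c * (real_of_int n / 2) powr e \<le> real (card (sq_reps d (n - k\<^sup>2)))" if "k \<in> A" for k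
    proof -
      have "real_of_int k \<le> y" "k \<ge> 0" using that by (auto simp: A_def le_floor_iff)
      then have "real_of_int k ^ 2 \<le> y\<^sup>2" by (intro power_mono) auto
      then have k2: "real_of_int (k\<^sup>2) \<le> n / 2" using y2 by simp
      then have k2': "real_of_int n / 2 \<le> real_of_int (n - k\<^sup>2)" by simp
      then have "0 < real_of_int (n - k\<^sup>2)" using n by linarith
      then have pos: "n - k\<^sup>2 \<ge> 1" by linarith
      have "c * (real_of_int n / 2) powr e \<le> c * real_of_int (n - k\<^sup>2) powr e"
        using c(1) e n k2' by (intro mult_left_mono powr_mono2) auto
      also have "\<dots> \<le> card (sq_reps d (n - k\<^sup>2))" using c(2)[OF pos] by (simp add: e_def)
      finally show ?thesis .
    qed
    have "real_of_int n powr (Suc d/2 - 1) = n powr e * sqrt n"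
    proof -
      have "real (Suc d) / 2 - 1 = e + 1/2" by (simp add: e_def field_simps)
      then show ?thesis using n by (simp only: powr_add) (simp add: powr_half_sqrt)
    qed
    then have "c' * real_of_int n powr (Suc d/2 - 1) = y * (c * (real_of_int n / 2) powr e)"
      using n by (simp add: c'_def y_def powr_divide real_sqrt_divide mult_ac)
    also have "\<dots> \<le> real (card A) * (c * (real_of_int n / 2) powr e)"
    proof (intro mult_right_mono)
      show "y \<le> real (card A)" using y0 unfolding A_def by simp
    qed (use c in auto)
    also have "\<dots> = (\<Sum>k\<in>A. c * (real_of_int n / 2) powr e)" by simp
    also have "\<dots> \<le> (\<Sum>k\<in>A. real (card (sq_reps d (n - k\<^sup>2))))" by (intro sum_mono kA)
    also have "\<dots> \<le> card (sq_reps (Suc d) n)"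
      using card_sq_reps_Suc_ge[of A d n] by (simp add: A_def flip: of_nat_sum)
    finally show ?thesis .
  qed
  moreover have "c' > 0" using c by (simp add: c'_def)
  ultimately show ?case by blast
qed

section \<open>Sums of reciprocal distances to the integers\<close>

definition int_dist :: "real \<Rightarrow> real" where "int_dist x = \<bar>x - of_int (round x)\<bar>"

text \<open>This is \<open>min H (1 / x)\<close> for \<open>x > 0\<close>; the value at \<open>x = 0\<close> is \<open>H\<close>, although \<open>1 / 0 = 0\<close>.\<close>
definition cap :: "real \<Rightarrow> real \<Rightarrow> real" where "cap H x = (if x * H \<le> 1 then H else 1 / x)"

lemma cap_le: "H > 0 \<Longrightarrow> cap H x \<le> H"
  by (cases "x > 0") (auto simp: cap_def divide_simps not_le mult.commute mult_nonneg_nonpos order_trans[of _ 0 1])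

lemma cap_le_inverse:
  assumes "H > 0" "0 < y" "y \<le> x"
  shows "cap H x \<le> 1 / y"
proof -
  have "cap H x \<le> 1 / x" using assms by (auto simp: cap_def field_simps)
  also have "\<dots> \<le> 1 / y" using assms by (simp add: frac_le)
  finally show ?thesis .
qed

text \<open>Weighted geometric mean of the bounds H and 1 / y. A positive \<open>e\<close> replaces
  the logarithm of a harmonic sum by a small power and a factor 1 / e.\<close>

lemma cap_le_powr:
  assumes H: "H > 0" and y: "0 < y" "y \<le> x" and e: "0 \<le> e" "e \<le> 1"
  shows "cap H x \<le> H powr e * y powr (e - 1)"
proof -
  have c0: "cap H x > 0" using assms by (auto simp: cap_def)
  have "cap H x = cap H x powr e * cap H x powr (1 - e)"
    using c0 by (simp flip: powr_add)
  also have "\<dots> \<le> H powr e * (1 / y) powr (1 - e)"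
    using c0 e cap_le[OF H] cap_le_inverse[OF H y] by (intro mult_mono powr_mono2) auto
  also have "(1 / y) powr (1 - e) = y powr (e - 1)"
    using y powr_minus_divide[of y "1 - e"] by (simp add: powr_divide)
  finally show ?thesis .
qed

lemma sum_powr_le:
  assumes e: "0 < e" "e \<le> 1"
  shows "(\<Sum>b=1..n. real b powr (e - 1)) \<le> real n powr e / e"
proof (induction n)
  case (Suc n)
  have "e * real (Suc n) powr (e - 1) \<le> real (Suc n) powr e - real n powr e"
  proof (cases "n = 0")
    case True then show ?thesis using e by simp
  next
    case False
    have "\<exists>z>real n. z < real (Suc n) \<and> real (Suc n) powr e - real n powr e = (real (Suc n) - real n) * (e * z powr (e - 1))"
      using False by (intro MVT2) (auto intro!: derivative_eq_intros)
    then obtain z where z: "z > real n" "z < real (Suc n)" "real (Suc n) powr e - real n powr e = e * z powr (e - 1)" by auto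
    then show ?thesis using e False by (auto intro!: mult_left_mono powr_mono2')
  qed
  then show ?case using Suc e by (simp add: field_simps)
qed simp

lemma sum_mod_permuted:
  fixes F :: "nat \<Rightarrow> real" and a :: int
  assumes q: "q > 0" and cop: "coprime a (int q)"
  shows "(\<Sum>h<m * q. F (nat ((int h * a) mod int q))) = real m * (\<Sum>b<q. F b)"
proof -
  define \<pi> where "\<pi> r = nat ((int r * a) mod int q)" for r
  have inj: "inj_on \<pi> {..<q}"
  proof (rule inj_onI)
    fix r r' assume r: "r \<in> {..<q}" "r' \<in> {..<q}" "\<pi> r = \<pi> r'"
    then have "(int r * a) mod int q = (int r' * a) mod int q" using q by (simp add: \<pi>_def nat_eq_iff)
    then have "int q dvd (int r - int r') * a" by (simp add: mod_eq_dvd_iff left_diff_distrib)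
    then have "int q dvd int r - int r'" using cop by (simp add: coprime_dvd_mult_left_iff coprime_commute)
    moreover have "\<bar>int r - int r'\<bar> < int q" using r by auto
    ultimately show "r = r'" by (metis abs_of_nat dvd_imp_le_int eq_iff_diff_eq_0 not_le of_nat_eq_iff)
  qed
  have im: "\<pi> ` {..<q} = {..<q}"
    using inj q by (intro endo_inj_surj) (auto simp: \<pi>_def nat_less_iff)
  have per: "\<pi> (r + j * q) = \<pi> r" for r j by (simp add: \<pi>_def algebra_simps) (metis mod_mult_self1 mult.assoc mult.commute)
  have "(\<Sum>h<m * q. F (\<pi> h)) = (\<Sum>j<m. \<Sum>h=j*q..<j*q+q. F (\<pi> h))" by (simp add: sum.nat_group)
  also have "\<dots> = (\<Sum>j<m. \<Sum>b<q. F b)"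
  proof (rule sum.cong[OF refl])
    fix j
    have "(\<Sum>h=j*q..<j*q+q. F (\<pi> h)) = (\<Sum>r=0..<q. F (\<pi> (r + j * q)))"
      using sum.shift_bounds_nat_ivl[of "\<lambda>h. F (\<pi> h)" 0 "j*q" q] by (simp add: add.commute)
    also have "\<dots> = (\<Sum>r<q. F (\<pi> r))" by (simp add: per atLeast0LessThan)
    also have "\<dots> = (\<Sum>b\<in>\<pi> ` {..<q}. F b)" using inj by (simp add: sum.reindex)
    finally show "(\<Sum>h=j*q..<j*q+q. F (\<pi> h)) = (\<Sum>b<q. F b)" by (simp add: im)
  qed
  finally show ?thesis by (simp add: \<pi>_def)
qed

text \<open>Away from the multiples of \<open>q\<close>, the residues \<open>h a mod q\<close> run evenly through \<open>1, \<dots>, q - 1\<close>.\<close>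
lemma sum_cap_nonmultiples:
  fixes a :: int and \<alpha> :: real
  assumes q: "q > 0" "q \<le> 2 * H" and cop: "coprime a (int q)" and H: "H > 0"
    and \<alpha>: "\<bar>real q * \<alpha> - of_int a\<bar> < 1 / real (2 * H)" and e: "0 < e" "e \<le> 1"
  shows "(\<Sum>h\<in>{h\<in>{1..H}. \<not> q dvd h}. cap H (int_dist (real h * \<alpha>))) \<le> 12 / e * real H * real q powr e"
proof -
  \<comment> \<open>A representative \<open>u\<close> of the residue b of h a modulo q satisfies |u|
    \<ge> b or |u| \<ge> q - b; adding both reciprocals covers either case. The value 0 at residue 0
    allows the sum to be extended to full periods.\<close>
  define \<phi> where "\<phi> b = (if b = 0 then 0 else 2 * real q * (1 / real b + 1 / real (q - b)))" for b
  have \<phi>0: "\<phi> b \<ge> 0" for b by (simp add: \<phi>_def)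
  define \<pi> where "\<pi> h = nat ((int h * a) mod int q)" for h
  have pt: "cap H (int_dist (real h * \<alpha>)) \<le> \<phi> (\<pi> h)" if h: "h \<in> {1..H}" "\<not> q dvd h" for h
  proof -
    define b where "b = (int h * a) mod int q"
    have b: "0 \<le> b" "b < int q" using q by (auto simp: b_def)
    have "\<not> int q dvd int h * a" using h cop by (simp add: coprime_dvd_mult_left_iff coprime_commute)
    then have b1: "1 \<le> b" using b by (simp add: b_def dvd_eq_mod_eq_0 order_neq_le_trans)
    define z where "z = round (real h * \<alpha>)"
    define u where "u = int h * a - z * int q"
    have "u mod int q = b" unfolding b_def by (rule mod_eq_dvd_iff[THEN iffD2]) (simp add: u_def)
    then have "u = b + int q * (u div int q)" by (metis mod_mult_div_eq)
    then obtain t where t: "u = b + int q * t" by blast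
    have ub: "\<bar>u\<bar> \<ge> b \<or> \<bar>u\<bar> \<ge> int q - b"
    proof (cases "t \<ge> 0")
      case True
      then have "int q * t \<ge> 0" by simp
      then show ?thesis using t b by linarith
    next
      case False
      then have "int q * t \<le> int q * (-1)" by (intro mult_left_mono) auto
      then show ?thesis using t b by linarith
    qed
    have u1: "\<bar>u\<bar> \<ge> 1" using ub b b1 by linarith
    \<comment> \<open>The error of the approximation contributes at most 1/2, which is why
      Dirichlet's theorem is applied with 2 H instead of H. As |u| \<ge> 1, at least half of |u|
      survives.\<close>
    have "real q * (real h * \<alpha> - of_int z) = of_int u + real h * (real q * \<alpha> - of_int a)"
      by (simp add: u_def algebra_simps)
    moreover have "\<bar>real h * (real q * \<alpha> - of_int a)\<bar> \<le> 1 / 2"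
    proof -
      have "\<bar>real h * (real q * \<alpha> - of_int a)\<bar> \<le> real H * (1 / real (2 * H))"
        unfolding abs_mult using \<alpha> h by (intro mult_mono) auto
      then show ?thesis using H by simp
    qed
    ultimately have "real_of_int \<bar>u\<bar> - 1/2 \<le> \<bar>real q * (real h * \<alpha> - of_int z)\<bar>" by linarith
    also have "\<dots> = real q * int_dist (real h * \<alpha>)" by (simp add: abs_mult int_dist_def z_def)
    finally have "real_of_int \<bar>u\<bar> / 2 \<le> real q * int_dist (real h * \<alpha>)" using u1 by linarith
    then have "real_of_int \<bar>u\<bar> / (2 * real q) \<le> int_dist (real h * \<alpha>)" using q by (simp add: field_simps)
    then have "cap H (int_dist (real h * \<alpha>)) \<le> 1 / (real_of_int \<bar>u\<bar> / (2 * real q))"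
      using H u1 q by (intro cap_le_inverse) auto
    also have "\<dots> = 2 * real q * (1 / real_of_int \<bar>u\<bar>)" by simp
    also have "\<dots> \<le> 2 * real q * (1 / real_of_int b + 1 / real_of_int (int q - b))"
    proof (intro mult_left_mono)
      from ub show "1 / real_of_int \<bar>u\<bar> \<le> 1 / real_of_int b + 1 / real_of_int (int q - b)"
      proof
        assume "b \<le> \<bar>u\<bar>"
        then have "1 / real_of_int \<bar>u\<bar> \<le> 1 / real_of_int b" using b1 by (intro divide_left_mono) auto
        moreover have "0 \<le> 1 / real_of_int (int q - b)" using b by simp
        ultimately show ?thesis by linarith
      next
        assume "int q - b \<le> \<bar>u\<bar>"
        then have "1 / real_of_int \<bar>u\<bar> \<le> 1 / real_of_int (int q - b)" using b u1 by (intro divide_left_mono) auto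
        moreover have "0 \<le> 1 / real_of_int b" using b by simp
        ultimately show ?thesis by linarith
      qed
    qed auto
    also have "\<dots> = \<phi> (\<pi> h)" using b b1
      by (simp add: \<phi>_def \<pi>_def b_def[symmetric] of_nat_diff nat_le_iff)
    finally show ?thesis .
  qed
  \<comment> \<open>\<open>m\<close> periods of length \<open>q\<close> cover 1, ..., H, and m q
    \<le> H + q \<le> 3 H because q \<le> 2 H. The constant 12 is 4 times this 3.\<close>
  define m where "m = H div q + 1"
  have Hm: "H < m * q" using q by (simp add: m_def dividend_less_div_times)
  have hb: "(\<Sum>b=1..<q. 1 / real b) \<le> real q powr e / e"
  proof -
    have "(\<Sum>b=1..<q. 1 / real b) \<le> (\<Sum>b=1..q. real b powr (e - 1))"
    proof (rule sum_mono2[THEN order_trans[rotated]])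
      show "(\<Sum>b=1..<q. 1 / real b) \<le> (\<Sum>b=1..<q. real b powr (e - 1))"
      proof (rule sum_mono)
        fix b assume "b \<in> {1..<q}"
        then have "real b powr (-1) \<le> real b powr (e - 1)" using e by (intro powr_mono) auto
        then show "1 / real b \<le> real b powr (e - 1)" using \<open>b \<in> _\<close> by (simp add: powr_minus_divide)
      qed
    qed auto
    also have "\<dots> \<le> real q powr e / e" by (rule sum_powr_le[OF e])
    finally show ?thesis .
  qed
  have "(\<Sum>h\<in>{h\<in>{1..H}. \<not> q dvd h}. cap H (int_dist (real h * \<alpha>))) \<le> (\<Sum>h\<in>{h\<in>{1..H}. \<not> q dvd h}. \<phi> (\<pi> h))"
    by (intro sum_mono pt) auto
  also have "\<dots> \<le> (\<Sum>h<m * q. \<phi> (\<pi> h))"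
    using Hm by (intro sum_mono2) (auto simp: \<phi>0)
  also have "\<dots> = real m * (\<Sum>b<q. \<phi> b)"
    unfolding \<pi>_def using q cop by (intro sum_mod_permuted) auto
  also have "(\<Sum>b<q. \<phi> b) = (\<Sum>b=1..<q. 2 * real q * (1 / real b + 1 / real (q - b)))"
    unfolding \<phi>_def by (rule sum.mono_neutral_cong_right) auto
  also have "\<dots> = 2 * real q * ((\<Sum>b=1..<q. 1 / real b) + (\<Sum>b=1..<q. 1 / real (q - b)))"
    by (simp only: sum_distrib_left[symmetric] sum.distrib)
  also have "(\<Sum>b=1..<q. 1 / real (q - b)) = (\<Sum>b=1..<q. 1 / real b)"
    by (rule sum.reindex_bij_witness[where i="\<lambda>b. q - b" and j="\<lambda>b. q - b"]) auto
  also have "real m * (2 * real q * ((\<Sum>b=1..<q. 1 / real b) + (\<Sum>b=1..<q. 1 / real b))) = 4 * (real m * real q) * (\<Sum>b=1..<q. 1 / real b)"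
    by simp
  also have "\<dots> \<le> 4 * (3 * real H) * (real q powr e / e)"
  proof (rule mult_mono[OF mult_left_mono hb])
    have "m * q \<le> H + q" by (simp add: m_def)
    then show "real m * real q \<le> 3 * real H" using q by (simp flip: of_nat_mult)
  qed (auto intro: sum_nonneg)
  finally show ?thesis by (simp add: field_simps)
qed

text \<open>For h = q j the deviation of h \<alpha> from the integer j a is j |q \<alpha> - a| \<le>
  1/2, so its distance to the integers is at least q j \<beta> with \<beta> = |\<alpha> - a/q|. If
  H^2 \<beta> \<le> 1, each of the at most H / q terms is simply bounded by H; otherwise
  \<open>cap_le_powr\<close> yields a power of H^2 \<beta>.\<close>

lemma sum_cap_multiples:
  fixes a :: int and \<alpha> :: real
  assumes q: "q > 0" and H: "H > 0"
    and \<alpha>: "\<bar>real q * \<alpha> - of_int a\<bar> < 1 / real (2 * H)" and e: "0 < e" "e \<le> 1"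
  shows "(\<Sum>h\<in>{h\<in>{1..H}. q dvd h}. cap H (int_dist (real h * \<alpha>)))
      \<le> 2 / e * (real H)\<^sup>2 / real q * (1 + (real H)\<^sup>2 * \<bar>\<alpha> - of_int a / real q\<bar>) powr (e - 1)"
proof -
  define \<beta> where "\<beta> = \<bar>\<alpha> - of_int a / real q\<bar>"
  have qb: "real q * \<beta> = \<bar>real q * \<alpha> - of_int a\<bar>"
    using q by (simp add: \<beta>_def abs_mult_pos' right_diff_distrib flip: abs_of_pos)
  define n where "n = H div q"
  have nH: "real n \<le> real H / real q" unfolding n_def by (rule of_nat_div_le_of_nat)
  have "{h\<in>{1..H}. q dvd h} = (\<lambda>j. q * j) ` {1..n}"
    using q by (auto simp: n_def less_eq_div_iff_mult_less_eq mult.commute elim!: dvdE)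
  then have S: "(\<Sum>h\<in>{h\<in>{1..H}. q dvd h}. cap H (int_dist (real h * \<alpha>))) = (\<Sum>j=1..n. cap H (int_dist (real (q * j) * \<alpha>)))"
    using q by (simp add: sum.reindex inj_on_def)
  have dist: "real q * real j * \<beta> \<le> int_dist (real (q * j) * \<alpha>)" if j: "j \<in> {1..n}" for j
  proof -
    have "q * j \<le> H" using j q by (simp add: n_def less_eq_div_iff_mult_less_eq mult.commute)
    then have jH: "j \<le> H" using q by (metis le_trans le_square mult_le_mono1 mult_1 Suc_leI One_nat_def)
    define z where "z = round (real (q * j) * \<alpha>)"
    have eq: "real (q * j) * \<alpha> - of_int z = real j * (real q * \<alpha> - of_int a) + of_int (int j * a - z)" by (simp add: algebra_simps)
    have lt: "\<bar>real j * (real q * \<alpha> - of_int a)\<bar> \<le> 1/2"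
    proof -
      have "\<bar>real j * (real q * \<alpha> - of_int a)\<bar> \<le> real H * (1 / real (2 * H))"
        unfolding abs_mult using \<alpha> jH by (intro mult_mono) auto
      then show ?thesis using H by simp
    qed
    have "\<bar>real j * (real q * \<alpha> - of_int a)\<bar> \<le> \<bar>real (q * j) * \<alpha> - of_int z\<bar>"
    proof (cases "int j * a - z = 0")
      case True then show ?thesis using eq by simp
    next
      case False
      then have "\<bar>real_of_int (int j * a - z)\<bar> \<ge> 1" by linarith
      then show ?thesis using eq lt by linarith
    qed
    then show ?thesis using qb by (simp add: int_dist_def z_def abs_mult) (metis mult.assoc mult.commute)
  qed
  have e1: "(1::real) \<le> 1 / e" using e by simp
  define X where "X = (real H)\<^sup>2 * \<beta>"
  have X0: "X \<ge> 0" by (simp add: X_def \<beta>_def)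
  have "(\<Sum>j=1..n. cap H (int_dist (real (q * j) * \<alpha>))) \<le> 2 / e * ((real H)\<^sup>2 / real q) * (1 + X) powr (e - 1)"
  proof (cases "X \<le> 1")
    case True
    have "(\<Sum>j=1..n. cap H (int_dist (real (q * j) * \<alpha>))) \<le> (\<Sum>j=1..n. real H)"
      using H by (intro sum_mono cap_le) auto
    also have "\<dots> = real n * real H" by simp
    also have "\<dots> \<le> real H / real q * real H" by (intro mult_right_mono nH) auto
    also have "\<dots> = ((real H)\<^sup>2 / real q) * 1" by (simp add: power2_eq_square)
    also have "\<dots> \<le> ((real H)\<^sup>2 / real q) * (2 / e * (1 + X) powr (e - 1))"
    proof (intro mult_left_mono)
      have "(1 + X) powr (1 - e) \<le> (1 + X) powr 1" using X0 e by (intro powr_mono) auto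
      then have "(1 + X) powr (1 - e) \<le> 2" using True X0 by simp
      then have "(1 + X) powr (1 - e) * (1 + X) powr (e - 1) \<le> 2 * (1 + X) powr (e - 1)" by (rule mult_right_mono) simp
      then have "1 \<le> 2 * (1 + X) powr (e - 1)" using X0 by (simp flip: powr_add)
      also have "\<dots> \<le> 2 * (1 + X) powr (e - 1) * (1 / e)" using mult_left_mono[OF e1, of "2 * (1 + X) powr (e - 1)"] by simp
      finally show "1 \<le> 2 / e * (1 + X) powr (e - 1)" by simp
    qed auto
    finally show ?thesis by (simp add: mult_ac)
  next
    case False
    then have b0: "\<beta> > 0" using X0 by (auto simp: X_def zero_less_mult_iff not_le \<beta>_def)
    have "(\<Sum>j=1..n. cap H (int_dist (real (q * j) * \<alpha>))) \<le> (\<Sum>j=1..n. real H powr e * (real q * real j * \<beta>) powr (e - 1))"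
      using H q b0 dist e by (intro sum_mono cap_le_powr) auto
    also have "\<dots> = real H powr e * (real q * \<beta>) powr (e - 1) * (\<Sum>j=1..n. real j powr (e - 1))"
      using b0 by (simp add: sum_distrib_left powr_mult mult_ac)
    also have "\<dots> \<le> real H powr e * (real q * \<beta>) powr (e - 1) * ((real H / real q) powr e / e)"
    proof (intro mult_left_mono)
      have "(\<Sum>j=1..n. real j powr (e - 1)) \<le> real n powr e / e" by (rule sum_powr_le[OF e])
      also have "\<dots> \<le> (real H / real q) powr e / e" using nH e by (intro divide_right_mono powr_mono2) auto
      finally show "(\<Sum>j=1..n. real j powr (e - 1)) \<le> (real H / real q) powr e / e" .
    qed auto
    also have "\<dots> = 1 / e * ((real H)\<^sup>2 / real q) * X powr (e - 1)"
    proof -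
      have "real H powr e * real H powr e = (real H)\<^sup>2 * ((real H)\<^sup>2) powr (e - 1)"
      proof -
        have "real H powr e * real H powr e = ((real H)\<^sup>2) powr e" by (simp add: power2_eq_square powr_mult)
        also have "\<dots> = ((real H)\<^sup>2) powr (1 + (e - 1))" by simp
        also have "\<dots> = (real H)\<^sup>2 * ((real H)\<^sup>2) powr (e - 1)" using H unfolding powr_add by simp
        finally show ?thesis .
      qed
      moreover have "real q powr (e - 1) / real q powr e = 1 / real q" using q by (simp add: powr_diff)
      ultimately show ?thesis using b0 q H
        by (simp add: X_def powr_mult powr_divide) (simp add: field_simps)
    qed
    also have "\<dots> \<le> 1 / e * ((real H)\<^sup>2 / real q) * (2 * (1 + X) powr (e - 1))"
    proof (intro mult_left_mono)
      have "X powr (e - 1) = 2 powr (1 - e) * (2 * X) powr (e - 1)"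
        using False powr_minus[of 2 "1 - e"] by (simp add: powr_mult)
      also have "\<dots> \<le> 2 * (1 + X) powr (e - 1)"
      proof (intro mult_mono)
        show "(2::real) powr (1 - e) \<le> 2" using e powr_mono[of "1 - e" 1 2] by simp
        show "(2 * X) powr (e - 1) \<le> (1 + X) powr (e - 1)" using False e by (intro powr_mono2') auto
      qed auto
      finally show "X powr (e - 1) \<le> 2 * (1 + X) powr (e - 1)" .
    qed (use e in auto)
    finally show ?thesis by (simp add: mult_ac)
  qed
  then show ?thesis unfolding S by (simp add: X_def \<beta>_def)
qed

text \<open>The single quantity Q = q (1 + H^2 \<beta>) records both the denominator and the error
  \<beta>. Dirichlet's theorem gives Q \<le> 3 H, which brings the nonmultiples, of size H q^e, and
  the extra term H to the form H^2 Q^(e - 1) of the multiples. The extra \<open>real H\<close> will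
  account for h = 0, and the bound 1 on the error confines \<open>a\<close> to finitely many values
  for each \<open>q\<close>.\<close>

lemma sum_cap_le:
  assumes H: "H > 0" and e: "0 < e" "e \<le> 1"
  obtains q a where "q \<ge> 1" "q \<le> 2 * H" "\<bar>\<alpha> - of_int a / real q\<bar> \<le> 1"
    "(\<Sum>h=1..H. cap H (int_dist (real h * \<alpha>))) + real H
      \<le> 50 / e * (real H)\<^sup>2 * (real q * (1 + (real H)\<^sup>2 * \<bar>\<alpha> - of_int a / real q\<bar>)) powr (e - 1)"
proof -
  obtain a k where cop: "coprime a k" and k: "0 < k" "k \<le> int (2 * H)"
    and ap: "\<bar>of_int k * \<alpha> - of_int a\<bar> < 1 / real (2 * H)"
    using Dirichlet_approx_coprime[of "2 * H" \<alpha>] H by auto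
  define q where "q = nat k"
  have q: "q > 0" "q \<le> 2 * H" "coprime a (int q)" "\<bar>real q * \<alpha> - of_int a\<bar> < 1 / real (2 * H)"
    using cop k ap by (auto simp: q_def)
  define \<beta> where "\<beta> = \<bar>\<alpha> - of_int a / real q\<bar>"
  have qb: "real q * \<beta> < 1 / real (2 * H)"
    using q by (simp add: \<beta>_def abs_mult_pos' right_diff_distrib flip: abs_of_pos)
  have "\<beta> \<le> real q * \<beta>" using q by (simp add: \<beta>_def mult_le_cancel_right1)
  also have "\<dots> \<le> 1 / real (2 * H)" using qb by simp
  also have "\<dots> \<le> 1" using H by simp
  finally have b1: "\<beta> \<le> 1" .
  define Q where "Q = real q * (1 + (real H)\<^sup>2 * \<beta>)"
  have Q1: "1 \<le> 1 + (real H)\<^sup>2 * \<beta>" by (simp add: \<beta>_def)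
  have Qq: "real q \<le> Q" using Q1 unfolding Q_def by (simp add: mult_le_cancel_left1)
  have Q0: "Q > 0" using Qq q by linarith
  have "Q \<le> 3 * real H"
  proof -
    have "Q = real q + (real H)\<^sup>2 * (real q * \<beta>)" by (simp add: Q_def algebra_simps)
    also have "\<dots> \<le> 2 * real H + (real H)\<^sup>2 * (1 / real (2 * H))" using q qb by (intro add_mono mult_left_mono) auto
    also have "\<dots> \<le> 3 * real H" using H by (simp add: power2_eq_square)
    finally show ?thesis .
  qed
  then have HQ: "real H \<le> 3 * (real H)\<^sup>2 / Q" using Q0 H by (simp add: field_simps power2_eq_square)
  have HQe: "real H * real q powr e \<le> 3 * (real H)\<^sup>2 * Q powr (e - 1)"
  proof -
    have "real H * real q powr e \<le> 3 * (real H)\<^sup>2 / Q * Q powr e"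
      using HQ Qq q e Q0 by (intro mult_mono powr_mono2) auto
    also have "\<dots> = 3 * (real H)\<^sup>2 * Q powr (e - 1)" using Q0 by (simp add: powr_diff)
    finally show ?thesis .
  qed
  have e1: "(1::real) \<le> 1 / e" using e by simp
  have "real H \<le> real H * real q powr e" using q e by (simp add: mult_le_cancel_left1 ge_one_powr_ge_zero)
  also note HQe
  finally have t3: "real H \<le> 3 * (real H)\<^sup>2 * Q powr (e - 1)" .
  have t3': "real H \<le> 3 / e * (real H)\<^sup>2 * Q powr (e - 1)"
  proof -
    have "1 * (3 * (real H)\<^sup>2 * Q powr (e - 1)) \<le> 1 / e * (3 * (real H)\<^sup>2 * Q powr (e - 1))" using e1 by (intro mult_right_mono) auto
    then show ?thesis using t3 by simp
  qed
  have t1: "12 / e * real H * real q powr e \<le> 36 / e * (real H)\<^sup>2 * Q powr (e - 1)"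
    using mult_left_mono[OF HQe, of "12 / e"] e by (simp add: mult_ac)
  have t2: "2 / e * (real H)\<^sup>2 / real q * (1 + (real H)\<^sup>2 * \<beta>) powr (e - 1) \<le> 2 / e * (real H)\<^sup>2 * Q powr (e - 1)"
  proof -
    have "Q powr (e - 1) = real q powr (e - 1) * (1 + (real H)\<^sup>2 * \<beta>) powr (e - 1)"
      using Q1 by (simp add: Q_def powr_mult)
    moreover have "1 / real q \<le> real q powr (e - 1)"
      using q powr_mono[of "-1" "e - 1" "real q"] e by (simp add: powr_minus_divide)
    then have "2 / e * (real H)\<^sup>2 * (1 + (real H)\<^sup>2 * \<beta>) powr (e - 1) * (1 / real q) \<le> 2 / e * (real H)\<^sup>2 * (1 + (real H)\<^sup>2 * \<beta>) powr (e - 1) * real q powr (e - 1)"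
      using e by (intro mult_left_mono) auto
    ultimately show ?thesis by (simp add: mult_ac)
  qed
  have "(\<Sum>h=1..H. cap H (int_dist (real h * \<alpha>))) = (\<Sum>h\<in>{h\<in>{1..H}. \<not> q dvd h}. cap H (int_dist (real h * \<alpha>)))
      + (\<Sum>h\<in>{h\<in>{1..H}. q dvd h}. cap H (int_dist (real h * \<alpha>)))"
    by (subst sum.union_disjoint[symmetric]) (auto intro: sum.cong)
  also have "\<dots> \<le> 36 / e * (real H)\<^sup>2 * Q powr (e - 1) + 2 / e * (real H)\<^sup>2 * Q powr (e - 1)"
    using sum_cap_nonmultiples[OF q(1,2,3) H q(4) e] sum_cap_multiples[OF q(1) H q(4) e] t1 t2
    unfolding \<beta>_def by linarith
  finally have "(\<Sum>h=1..H. cap H (int_dist (real h * \<alpha>))) + real H \<le> (36 / e + 2 / e + 3 / e) * (real H)\<^sup>2 * Q powr (e - 1)"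
    using t3' unfolding distrib_right by linarith
  \<comment> \<open>36 + 2 + 3 = 41, rounded up.\<close>
  also have "\<dots> \<le> 50 / e * (real H)\<^sup>2 * Q powr (e - 1)"
    using e by (intro mult_right_mono) (auto simp: field_simps)
  finally show ?thesis using that[of q a] q b1 by (simp add: Q_def \<beta>_def)
qed

section \<open>Moments of Weyl sums\<close>

text \<open>Jordan's inequality with constant 1. Up to d = 1/3 the derivative of sin on [0, pi d] is
  at least 1/2, and pi / 2 \<ge> 1; from there to d = 1/2 the sine is at least sin (pi / 6) = 1/2.
  Periodicity does the rest.\<close>

lemma abs_sin_pi_ge: "int_dist x \<le> \<bar>sin (pi * x)\<bar>"
proof -
  have base: "d \<le> sin (pi * d)" if d: "0 \<le> d" "d \<le> 1/2" for d :: real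
  proof (cases "d \<le> 1/3")
    case True
    have "sin 0 - 0 / 2 \<le> sin (pi * d) - pi * d / 2"
    proof (rule DERIV_nonneg_imp_nondecreasing[where f="\<lambda>y. sin y - y / 2"])
      fix y assume y: "0 \<le> y" "y \<le> pi * d"
      have "pi * d \<le> pi * (1/3)" using True by (intro mult_left_mono) auto
      then have "y \<le> pi / 3" using y by linarith
      then have "cos (pi/3) \<le> cos y" using y by (intro cos_monotone_0_pi_le) auto
      then have "0 \<le> cos y - 1/2" by (simp add: cos_60)
      moreover have "((\<lambda>y. sin y - y / 2) has_real_derivative (cos y - 1/2)) (at y)"
        by (auto intro!: derivative_eq_intros)
      ultimately show "\<exists>z. ((\<lambda>y. sin y - y / 2) has_real_derivative z) (at y) \<and> 0 \<le> z" by blast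
    qed (use d in auto)
    moreover have "2 * d \<le> pi * d" using d pi_ge_two by (intro mult_right_mono) auto
    ultimately show ?thesis by simp
  next
    case False
    have "sin (pi / 6) \<le> sin (pi * d)"
    proof (rule sin_monotone_2pi_le)
      have "pi * d \<le> pi * (1/2)" "pi * (1/6) \<le> pi * d" using d False by (intro mult_left_mono; simp)+
      then show "pi * d \<le> pi / 2" "pi / 6 \<le> pi * d" by auto
      have "0 < pi" by simp
      then show "- (pi / 2) \<le> pi / 6" by linarith
    qed
    then show ?thesis using d by (simp add: sin_30)
  qed
  define z where "z = round x"
  define d where "d = x - of_int z"
  have d: "\<bar>d\<bar> \<le> 1/2" using of_int_round_abs_le[of x] by (simp add: d_def z_def abs_minus_commute)
  have "sin (pi * x) = sin (pi * d + of_int z * pi)" by (simp add: d_def algebra_simps)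
  moreover have s0: "sin (of_int z * pi) = 0" using sin_zero_iff_int2 by blast
  moreover have "\<bar>cos (of_int z * pi)\<bar> = 1"
    using sin_cos_squared_add[of "of_int z * pi"] s0 by (auto simp: power2_eq_1_iff)
  ultimately have "\<bar>sin (pi * x)\<bar> = \<bar>sin (pi * d)\<bar>" by (simp add: sin_add abs_mult)
  also have "\<dots> = \<bar>sin (pi * \<bar>d\<bar>)\<bar>" by (simp add: abs_if)
  also have "\<dots> \<ge> \<bar>d\<bar>" using base[of "\<bar>d\<bar>"] d by auto
  finally show ?thesis by (simp add: int_dist_def d_def z_def)
qed

lemma norm_one_minus_cis: "cmod (1 - cis (2 * u)) = 2 * \<bar>sin u\<bar>"
proof -
  have "1 - cis (2 * u) = cis u * (cis (- u) - cis u)"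
    by (simp add: right_diff_distrib cis_mult)
  moreover have "cis (- u) - cis u = - 2 * \<i> * of_real (sin u)" by (simp add: complex_eq_iff)
  ultimately show ?thesis by (simp add: norm_mult)
qed

text \<open>In product form because \<theta> may be an integer: the distance is then 0 and a bound
  by the quotient, with 1 / 0 = 0, would be false.\<close>

lemma geometric_cis_sum_bound:
  fixes A B :: int
  shows "cmod (\<Sum>v=A..B. cis (2 * pi * \<theta> * of_int v)) * int_dist \<theta> \<le> 1"
proof -
  define \<omega> where "\<omega> = cis (2 * (pi * \<theta>))"
  define n where "n = nat (B - A + 1)"
  have "(\<Sum>v=A..B. cis (2 * pi * \<theta> * of_int v)) = (\<Sum>j<n. cis (2 * pi * \<theta> * of_int (A + int j)))"
    by (rule sum.reindex_bij_witness[where i="\<lambda>j. A + int j" and j="\<lambda>v. nat (v - A)"])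
       (auto simp: n_def)
  also have "\<dots> = (\<Sum>j<n. cis (2 * pi * \<theta> * of_int A) * \<omega> ^ j)"
    by (rule sum.cong[OF refl]) (simp only: \<omega>_def cis_mult Complex.DeMoivre, simp add: distrib_left mult_ac)
  also have "\<dots> = cis (2 * pi * \<theta> * of_int A) * (\<Sum>j<n. \<omega> ^ j)" by (simp add: sum_distrib_left)
  finally have "cmod (\<Sum>v=A..B. cis (2 * pi * \<theta> * of_int v)) = cmod (\<Sum>j<n. \<omega> ^ j)" by (simp add: norm_mult)
  moreover have "cmod (1 - \<omega>) * cmod (\<Sum>j<n. \<omega> ^ j) \<le> 2"
  proof -
    have "cmod (1 - \<omega>) * cmod (\<Sum>j<n. \<omega> ^ j) = cmod (1 - \<omega> ^ n)" by (simp add: one_diff_power_eq norm_mult)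
    also have "\<dots> \<le> cmod 1 + cmod (\<omega> ^ n)" by (rule norm_triangle_ineq4)
    also have "\<dots> = 2" by (simp add: norm_power \<omega>_def)
    finally show ?thesis .
  qed
  moreover have "cmod (1 - \<omega>) \<ge> 2 * int_dist \<theta>"
    unfolding \<omega>_def norm_one_minus_cis using abs_sin_pi_ge[of \<theta>] by simp
  ultimately show ?thesis
    using mult_right_mono[of "2 * int_dist \<theta>" "cmod (1 - \<omega>)" "cmod (\<Sum>j<n. \<omega> ^ j)"] by (simp add: mult.commute)
qed

section \<open>Autocorrelation of the quadratic phase and its moments\<close>

definition quad_kernel :: "nat \<Rightarrow> real \<Rightarrow> int \<Rightarrow> complex" where
  "quad_kernel R \<alpha> v = (if \<bar>v\<bar> \<le> int R then cis (2 * pi * \<alpha> * of_int (v\<^sup>2)) else 0)"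

definition quad_corr :: "nat \<Rightarrow> real \<Rightarrow> int \<Rightarrow> complex" where
  "quad_corr R \<alpha> h = (\<Sum>v=-int R..int R. quad_kernel R \<alpha> v * cnj (quad_kernel R \<alpha> (v - h)))"

definition weyl_weight :: "nat \<Rightarrow> real \<Rightarrow> real" where
  "weyl_weight R \<alpha> = (\<Sum>h=-2 * int R..2 * int R. cmod (quad_corr R \<alpha> h))"

lemma norm_quad_kernel_le: "cmod (quad_kernel R \<alpha> v) \<le> 1"
  by (simp add: quad_kernel_def)

lemma continuous_weyl_weight: "continuous_on S (weyl_weight R)"
proof -
  have 1: "continuous_on S (\<lambda>\<alpha>. quad_kernel R \<alpha> v)" for v
    unfolding quad_kernel_def by (cases "\<bar>v\<bar> \<le> int R") (auto intro!: continuous_intros)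
  show ?thesis unfolding weyl_weight_def quad_corr_def by (intro continuous_intros 1)
qed

text \<open>The term h = 0 alone is 2 R + 1. Keeping the weight away from 0 supplies the side
  condition for continuity of its real powers and a positive constant for interpolation.\<close>

lemma weyl_weight_ge_1: "weyl_weight R \<alpha> \<ge> 1"
proof -
  have "quad_corr R \<alpha> 0 = (\<Sum>v=-int R..int R. 1)"
    unfolding quad_corr_def by (rule sum.cong) (auto simp: quad_kernel_def cis_cnj cis_mult)
  then have "quad_corr R \<alpha> 0 = of_real (2 * real R + 1)" by simp
  then have "cmod (quad_corr R \<alpha> 0) = 2 * real R + 1" by (simp only: norm_of_real)
  moreover have "cmod (quad_corr R \<alpha> 0) \<le> weyl_weight R \<alpha>"
    unfolding weyl_weight_def by (rule member_le_sum) auto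
  ultimately show ?thesis by simp
qed

text \<open>Weyl differencing: v^2 - (v - h)^2 = 2 h v - h^2 is linear in v, so the correlation is a
  unimodular factor times a geometric sum of frequency 2 h \<alpha> over an interval. Negative h are
  reflected to positive ones. The factor 2 absorbs the trivial bound 2 R + 1 \<le> 2 (2 R).\<close>

lemma norm_quad_corr_le_cap:
  assumes R: "R \<ge> 1"
  shows "cmod (quad_corr R \<alpha> h) \<le> 2 * cap (real (2 * R)) (int_dist (real (nat \<bar>h\<bar>) * (2 * \<alpha>)))"
proof -
  have triv: "cmod (quad_corr R \<alpha> h) \<le> 2 * real (2 * R)"
  proof -
    have "cmod (quad_corr R \<alpha> h) \<le> (\<Sum>v=-int R..int R. 1)"
      unfolding quad_corr_def
      by (rule sum_norm_le) (auto simp: norm_mult intro!: mult_le_one norm_quad_kernel_le)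
    then show ?thesis using R by simp
  qed
  define \<theta> where "\<theta> = real (nat \<bar>h\<bar>) * (2 * \<alpha>)"
  define s where "s = (if h \<ge> 0 then 1 else -1 :: int)"
  have hs: "h = s * int (nat \<bar>h\<bar>)" by (simp add: s_def)
  let ?A = "max (- int R) (h - int R)" and ?B = "min (int R) (h + int R)"
  have eq: "quad_corr R \<alpha> h = cis (- (2 * pi * \<alpha> * of_int (h\<^sup>2))) * (\<Sum>v=?A..?B. cis (2 * pi * \<theta> * of_int (s * v)))"
  proof -
    have "quad_corr R \<alpha> h = (\<Sum>v=?A..?B. quad_kernel R \<alpha> v * cnj (quad_kernel R \<alpha> (v - h)))"
      unfolding quad_corr_def by (rule sum.mono_neutral_right) (auto simp: quad_kernel_def abs_le_iff)
    also have "\<dots> = (\<Sum>v=?A..?B. cis (- (2 * pi * \<alpha> * of_int (h\<^sup>2))) * cis (2 * pi * \<theta> * of_int (s * v)))"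
    proof (rule sum.cong[OF refl])
      fix v assume v: "v \<in> {?A..?B}"
      have "real_of_int h = real_of_int s * real (nat \<bar>h\<bar>)" by (simp add: s_def)
      moreover have "\<theta> * of_int (s * v) = 2 * \<alpha> * (real_of_int s * real (nat \<bar>h\<bar>)) * of_int v" by (simp add: \<theta>_def mult_ac)
      ultimately have "\<theta> * of_int (s * v) = 2 * \<alpha> * of_int h * of_int v" by presburger
      then have eq: "2 * pi * \<theta> * of_int (s * v) = 2 * pi * (2 * \<alpha> * of_int h * of_int v)" by (simp only: mult.assoc)
      show "quad_kernel R \<alpha> v * cnj (quad_kernel R \<alpha> (v - h)) = cis (- (2 * pi * \<alpha> * of_int (h\<^sup>2))) * cis (2 * pi * \<theta> * of_int (s * v))"
        unfolding eq using v by (simp add: quad_kernel_def cis_cnj cis_mult abs_le_iff)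
          (simp add: power2_eq_square algebra_simps)
    qed
    finally show ?thesis by (simp add: sum_distrib_left)
  qed
  have "cmod (quad_corr R \<alpha> h) * int_dist \<theta> \<le> 1"
  proof (cases "h \<ge> 0")
    case True
    then show ?thesis unfolding eq using geometric_cis_sum_bound[of \<theta> ?A ?B] by (simp add: s_def norm_mult)
  next
    case False
    have "(\<Sum>v=?A..?B. cis (2 * pi * \<theta> * of_int (s * v))) = (\<Sum>v=-?B..-?A. cis (2 * pi * \<theta> * of_int v))"
      by (rule sum.reindex_bij_witness[where i="\<lambda>v. -v" and j="\<lambda>v. -v"]) (use False in \<open>auto simp: s_def\<close>)
    then show ?thesis unfolding eq using geometric_cis_sum_bound[of \<theta> "-?B" "-?A"] by (simp add: norm_mult)
  qed
  then have "cmod (quad_corr R \<alpha> h) \<le> 2 * cap (real (2 * R)) (int_dist \<theta>)"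
  proof (cases "int_dist \<theta> * real (2 * R) \<le> 1")
    case True then show ?thesis using triv by (simp add: cap_def)
  next
    case False
    then have "int_dist \<theta> > 0" by (metis abs_ge_zero int_dist_def less_eq_real_def mult_zero_left zero_le_one)
    moreover assume "cmod (quad_corr R \<alpha> h) * int_dist \<theta> \<le> 1"
    ultimately have "cmod (quad_corr R \<alpha> h) \<le> 1 / int_dist \<theta>" "0 \<le> 1 / int_dist \<theta>" by (auto simp: field_simps)
    then show ?thesis unfolding cap_def if_not_P[OF False] by linarith
  qed
  then show ?thesis by (simp add: \<theta>_def)
qed

lemma weyl_weight_le:
  assumes R: "R \<ge> 1" and H: "H = 2 * R"
  shows "weyl_weight R \<alpha> \<le> 4 * ((\<Sum>h=1..H. cap H (int_dist (real h * (2 * \<alpha>)))) + real H)"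
proof -
  define c where "c h = 2 * cap (real H) (int_dist (real h * (2 * \<alpha>)))" for h :: nat
  have "weyl_weight R \<alpha> = (\<Sum>h=-int H..int H. cmod (quad_corr R \<alpha> h))"
    by (simp add: weyl_weight_def H)
  also have "\<dots> \<le> (\<Sum>h=-int H..int H. c (nat \<bar>h\<bar>))"
    unfolding c_def H by (intro sum_mono norm_quad_corr_le_cap[OF R])
  also have "{-int H..int H} = {-int H..-1} \<union> ({0} \<union> {1..int H})" by auto
  also have "(\<Sum>h\<in>{-int H..-1} \<union> ({0} \<union> {1..int H}). c (nat \<bar>h\<bar>))
      = (\<Sum>h=-int H..-1. c (nat \<bar>h\<bar>)) + (c 0 + (\<Sum>h=1..int H. c (nat \<bar>h\<bar>)))"
    by (subst sum.union_disjoint, auto)+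
  also have "(\<Sum>h=-int H..-1. c (nat \<bar>h\<bar>)) = (\<Sum>h=1..H. c h)"
    by (rule sum.reindex_bij_witness[where i="\<lambda>h. - int h" and j="\<lambda>h. nat (-h)"]) auto
  also have "(\<Sum>h=1..int H. c (nat \<bar>h\<bar>)) = (\<Sum>h=1..H. c h)"
    by (rule sum.reindex_bij_witness[where i="\<lambda>h. int h" and j="\<lambda>h. nat h"]) auto
  also have "c 0 = 2 * real H" by (simp add: c_def cap_def int_dist_def)
  also have "(\<Sum>h=1..H. c h) = 2 * (\<Sum>h=1..H. cap H (int_dist (real h * (2 * \<alpha>))))"
    by (simp add: c_def sum_distrib_left)
  finally show ?thesis by simp
qed

lemma integral_inverse_quadratic_le:
  assumes K: "K > 0"
  shows "integral {0..1} (\<lambda>\<alpha>. 1 / (1 + (K * (2 * \<alpha> - c))\<^sup>2)) \<le> pi / (2 * K)"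
proof -
  define F where "F \<alpha> = arctan (K * (2 * \<alpha> - c)) / (2 * K)" for \<alpha>
  have "((\<lambda>\<alpha>. 1 / (1 + (K * (2 * \<alpha> - c))\<^sup>2)) has_integral (F 1 - F 0)) {0..1}"
  proof (rule fundamental_theorem_of_calculus)
    fix x :: real assume "x \<in> {0..1}"
    have "(F has_real_derivative (inverse (1 + (K * (2 * x - c))\<^sup>2) * (K * 2) / (2 * K))) (at x within {0..1})"
      unfolding F_def using K by (auto intro!: derivative_eq_intros)
    moreover have "inverse (1 + (K * (2 * x - c))\<^sup>2) * (K * 2) / (2 * K) = 1 / (1 + (K * (2 * x - c))\<^sup>2)"
      using K by simp (simp add: inverse_eq_divide)
    ultimately have "(F has_real_derivative (1 / (1 + (K * (2 * x - c))\<^sup>2))) (at x within {0..1})" by simp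
    then show "(F has_vector_derivative (1 / (1 + (K * (2 * x - c))\<^sup>2))) (at x within {0..1})"
      by (simp add: has_real_derivative_iff_has_vector_derivative)
  qed simp
  then have "integral {0..1} (\<lambda>\<alpha>. 1 / (1 + (K * (2 * \<alpha> - c))\<^sup>2)) = F 1 - F 0" by (rule integral_unique)
  also have "\<dots> = (arctan (K * (2 - c)) - arctan (K * (0 - c))) / (2 * K)" by (simp add: F_def diff_divide_distrib)
  also have "\<dots> \<le> pi / (2 * K)"
    using arctan_ubound[of "K * (2 - c)"] arctan_lbound[of "K * (0 - c)"] K
    by (intro divide_right_mono) linarith+
  finally show ?thesis .
qed

text \<open>Every \<open>\<alpha>\<close> is charged to one Dirichlet approximation \<open>a / q\<close>; summing the resulting bumps over all pairs
  leaves the series of \<open>q powr (1 - s')\<close>, which converges precisely because \<open>\<sigma> > 2\<close>.\<close>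
lemma weyl_weight_moment:
  assumes \<sigma>: "\<sigma> > 2"
  shows "\<exists>C>0. \<forall>R\<ge>1. integral {0..1} (\<lambda>\<alpha>. weyl_weight R \<alpha> powr \<sigma>) \<le> C * real R powr (2 * \<sigma> - 2)"
proof -
  \<comment> \<open>Chosen so that (1 - e) \<sigma> = (\<sigma> + 2) / 2 = \<open>s'\<close>,
    halfway between 2 and \<sigma>: half of the excess over 2 pays for the logarithm, the other half
    makes the sum over q converge.\<close>
  define e where "e = (\<sigma> - 2) / (2 * \<sigma>)"
  have e: "0 < e" "e \<le> 1" using \<sigma> by (auto simp: e_def field_simps)
  define s' where "s' = (\<sigma> + 2) / 2"
  have s': "s' > 2" using \<sigma> by (simp add: s'_def)
  have es: "(e - 1) * \<sigma> = - s'" using \<sigma> by (simp add: e_def s'_def field_simps)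
  define D where "D = (200 / e) powr \<sigma>"
  define Z where "Z = (\<Sum>n. real n powr (1 - s'))"
  have sm: "summable (\<lambda>n. real n powr (1 - s'))" using s' by (simp add: summable_real_powr_iff)
  define C where "C = D * (5 * Z * pi) * 2 powr (2 * \<sigma> - 2) + 1"
  have "integral {0..1} (\<lambda>\<alpha>. weyl_weight R \<alpha> powr \<sigma>) \<le> C * real R powr (2 * \<sigma> - 2)" if R: "R \<ge> 1" for R
  proof -
    define H where "H = 2 * R"
    have H: "H > 0" using R by (simp add: H_def)
    define K where "K = (real H)\<^sup>2"
    have K: "K > 0" using H by (simp add: K_def)
    define \<psi> where "\<psi> c \<alpha> = 1 / (1 + (K * (2 * \<alpha> - c))\<^sup>2)" for c \<alpha> :: real
    have \<psi>0: "\<psi> c \<alpha> \<ge> 0" for c \<alpha> by (simp add: \<psi>_def add_nonneg_nonneg)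
    have \<psi>c: "continuous_on {0..1} (\<psi> c)" for c
      unfolding \<psi>_def by (intro continuous_intros) (smt (verit) zero_le_power2)+
    \<comment> \<open>As 2 \<alpha> lies in [0, 2] and a / q is within 1 of it, numerators from -q
      to 3 q suffice. Summing over all pairs avoids an \<alpha>-dependent choice under the
      integral.\<close>
    define \<Phi> where "\<Phi> \<alpha> = (\<Sum>q=1..2 * H. \<Sum>a=-int q..3 * int q. D * K powr \<sigma> * real q powr (- s') * \<psi> (of_int a / real q) \<alpha>)" for \<alpha>
    have pt: "weyl_weight R \<alpha> powr \<sigma> \<le> \<Phi> \<alpha>" if \<alpha>: "\<alpha> \<in> {0..1}" for \<alpha>
    proof -
      obtain q a where q: "q \<ge> 1" "q \<le> 2 * H" and a: "\<bar>2 * \<alpha> - of_int a / real q\<bar> \<le> 1"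
        and le: "(\<Sum>h=1..H. cap H (int_dist (real h * (2 * \<alpha>)))) + real H
          \<le> 50 / e * (real H)\<^sup>2 * (real q * (1 + (real H)\<^sup>2 * \<bar>2 * \<alpha> - of_int a / real q\<bar>)) powr (e - 1)"
        using sum_cap_le[OF H e, of "2 * \<alpha>"] by metis
      define X where "X = K * \<bar>2 * \<alpha> - of_int a / real q\<bar>"
      have X0: "X \<ge> 0" using K by (simp add: X_def)
      have "weyl_weight R \<alpha> \<le> 200 / e * K * (real q * (1 + X)) powr (e - 1)"
        using weyl_weight_le[OF R H_def, of \<alpha>] le by (simp add: K_def X_def)
      then have "weyl_weight R \<alpha> powr \<sigma> \<le> (200 / e * K * (real q * (1 + X)) powr (e - 1)) powr \<sigma>"
        using weyl_weight_ge_1[of R \<alpha>] \<sigma> by (intro powr_mono2) auto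
      also have "\<dots> = D * K powr \<sigma> * (real q * (1 + X)) powr (- s')"
      proof -
        define y where "y = real q * (1 + X)"
        have "(200 / e * K * y powr (e - 1)) powr \<sigma> = D * K powr \<sigma> * (y powr (e - 1)) powr \<sigma>"
          unfolding D_def by (simp only: powr_mult)
        then show ?thesis by (simp add: powr_powr es y_def)
      qed
      also have "\<dots> = D * K powr \<sigma> * real q powr (- s') * (1 + X) powr (- s')"
        using X0 by (simp add: powr_mult)
      also have "\<dots> \<le> D * K powr \<sigma> * real q powr (- s') * \<psi> (of_int a / real q) \<alpha>"
      proof (rule mult_left_mono)
        \<comment> \<open>Since s' > 2, the bump may be replaced by 1 / (1 + X^2), whose primitive
          is an arctangent and whose integral is of size 1 / K uniformly in the centre.\<close>
        have "(1 + X) powr (- s') \<le> (1 + X) powr (- 2)" using X0 s' by (intro powr_mono) auto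
        also have "\<dots> = 1 / (1 + X)\<^sup>2" using X0 by (simp add: powr_minus_divide)
        also have "\<dots> \<le> 1 / (1 + X\<^sup>2)" using X0
          by (intro divide_left_mono mult_pos_pos) (auto simp: power2_eq_square algebra_simps add_pos_nonneg)
        also have "\<dots> = \<psi> (of_int a / real q) \<alpha>" by (simp add: \<psi>_def X_def power_mult_distrib)
        finally show "(1 + X) powr (- s') \<le> \<psi> (of_int a / real q) \<alpha>" .
      qed (simp add: D_def)
      also have "\<dots> \<le> (\<Sum>a=-int q..3 * int q. D * K powr \<sigma> * real q powr (- s') * \<psi> (of_int a / real q) \<alpha>)"
      proof (rule member_le_sum[where f="\<lambda>a. D * K powr \<sigma> * real q powr (- s') * \<psi> (of_int a / real q) \<alpha>"])
        have "-1 \<le> of_int a / real q" "of_int a / real q \<le> 3" using a \<alpha> by (auto simp: abs_le_iff)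
        then have "- real q \<le> of_int a" "of_int a \<le> 3 * real q" using q by (auto simp: field_simps)
        then have "-int q \<le> a" "a \<le> 3 * int q" by linarith+
        then show "a \<in> {-int q..3 * int q}" by simp
      qed (auto simp: D_def \<psi>0)
      also have "\<dots> \<le> \<Phi> \<alpha>" unfolding \<Phi>_def
        by (rule member_le_sum[where f="\<lambda>q. (\<Sum>a=-int q..3 * int q. D * K powr \<sigma> * real q powr (- s') * \<psi> (of_int a / real q) \<alpha>)"])
           (use q in \<open>auto simp: D_def \<psi>0 intro!: sum_nonneg\<close>)
      finally show ?thesis .
    qed
    have "integral {0..1} (\<lambda>\<alpha>. weyl_weight R \<alpha> powr \<sigma>) \<le> integral {0..1} \<Phi>"
    proof (rule integral_le)
      show "(\<lambda>\<alpha>. weyl_weight R \<alpha> powr \<sigma>) integrable_on {0..1}"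
        by (intro integrable_continuous_interval continuous_on_powr continuous_weyl_weight continuous_on_const)
           (use weyl_weight_ge_1 in \<open>smt (verit)\<close>)
      show "\<Phi> integrable_on {0..1}" unfolding \<Phi>_def
        by (intro integrable_continuous_interval continuous_intros \<psi>c)
    qed (use pt in auto)
    also have "integral {0..1} \<Phi> = (\<Sum>q=1..2 * H. \<Sum>a=-int q..3 * int q. D * K powr \<sigma> * real q powr (- s') * integral {0..1} (\<psi> (of_int a / real q)))"
      unfolding \<Phi>_def
      by (intro integral_unique has_integral_sum has_integral_mult_right integrable_integral integrable_continuous_interval \<psi>c) auto
    also have "\<dots> \<le> (\<Sum>q=1..2 * H. \<Sum>a=-int q..3 * int q. D * K powr \<sigma> * real q powr (- s') * (pi / (2 * K)))"
      unfolding \<psi>_def using K by (intro sum_mono mult_left_mono integral_inverse_quadratic_le) (auto simp: D_def)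
    also have "\<dots> = (\<Sum>q=1..2 * H. (4 * real q + 1) * (D * K powr \<sigma> * real q powr (- s') * (pi / (2 * K))))"
      by simp
    also have "\<dots> \<le> (\<Sum>q=1..2 * H. (5 * real q) * (D * K powr \<sigma> * real q powr (- s') * (pi / (2 * K))))"
      using K by (intro sum_mono mult_right_mono) (auto simp: D_def)
    also have "\<dots> = (D * K powr \<sigma> * (5 * pi / (2 * K))) * (\<Sum>q=1..2 * H. real q powr (1 - s'))"
    proof -
      have "real q powr (1 - s') = real q * real q powr (- s')" if "q \<in> {1..2 * H}" for q
        using that by (simp add: powr_diff powr_minus field_simps)
      then show ?thesis unfolding sum_distrib_left by (intro sum.cong) auto
    qed
    also have "\<dots> \<le> (D * K powr \<sigma> * (5 * pi / (2 * K))) * Z"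
    proof (rule mult_left_mono)
      show "(\<Sum>q=1..2 * H. real q powr (1 - s')) \<le> Z" unfolding Z_def by (rule sum_le_suminf[OF sm]) auto
    qed (use K in \<open>auto simp: D_def\<close>)
    also have "\<dots> = D * (5 * Z * pi / 2) * K powr (\<sigma> - 1)" using K by (simp add: powr_diff field_simps)
    also have "K powr (\<sigma> - 1) = 2 powr (2 * \<sigma> - 2) * real R powr (2 * \<sigma> - 2)"
    proof -
      have "K powr (\<sigma> - 1) = (real H powr 2) powr (\<sigma> - 1)" using H by (simp add: K_def)
      also have "\<dots> = real H powr (2 * \<sigma> - 2)" by (simp only: powr_powr) (simp add: algebra_simps)
      finally show ?thesis by (simp add: H_def powr_mult)
    qed
    also have "D * (5 * Z * pi / 2) * (2 powr (2 * \<sigma> - 2) * real R powr (2 * \<sigma> - 2)) \<le> C * real R powr (2 * \<sigma> - 2)"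
    proof -
      have Z0: "Z \<ge> 0" unfolding Z_def by (rule suminf_nonneg[OF sm]) simp
      have "D * (5 * Z * pi / 2) * 2 powr (2 * \<sigma> - 2) \<le> C"
        using Z0 unfolding C_def by (simp add: D_def add_increasing2)
      then have "D * (5 * Z * pi / 2) * 2 powr (2 * \<sigma> - 2) * real R powr (2 * \<sigma> - 2) \<le> C * real R powr (2 * \<sigma> - 2)"
        by (rule mult_right_mono) simp
      then show ?thesis by (simp add: mult.assoc)
    qed
    finally show ?thesis .
  qed
  moreover have "C > 0"
  proof -
    have Z0: "Z \<ge> 0" unfolding Z_def by (rule suminf_nonneg[OF sm]) simp
    then show ?thesis unfolding C_def by (intro add_nonneg_pos) (auto simp: D_def)
  qed
  ultimately show ?thesis by blast
qed

section \<open>Interpolation\<close>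

text \<open>Hadamard's three lines theorem. Exponential sums are the right class because
  interpolation runs over finite sets; they are entire and bounded on the strip.\<close>

lemma three_lines_exp_sum:
  fixes c :: "'i \<Rightarrow> complex" and l :: "'i \<Rightarrow> real" and I :: "'i set"
  defines "F \<equiv> \<lambda>z. \<Sum>i\<in>I. c i * exp (z * of_real (l i))"
  assumes M: "M0 > 0" "M1 > 0"
    and F0: "\<And>y. cmod (F (Complex 0 y)) \<le> M0"
    and F1: "\<And>y. cmod (F (Complex 1 y)) \<le> M1"
    and w: "0 \<le> w" "w \<le> 1"
  shows "cmod (F (of_real w)) \<le> M0 powr (1 - w) * M1 powr w"
proof -
  \<comment> \<open>The exponential factor normalises both edge bounds to 1.\<close>
  define G where "G z = F z * exp (of_real (- ln M0) + z * of_real (ln M0 - ln M1))" for z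
  define K where "K = (\<Sum>i\<in>I. cmod (c i) * exp \<bar>l i\<bar>) * exp (\<bar>ln M0\<bar> + \<bar>ln M0 - ln M1\<bar>) + 1"
  have Kpos: "K > 0" unfolding K_def by (intro add_nonneg_pos mult_nonneg_nonneg sum_nonneg) auto
  have GK: "cmod (G z) \<le> K" if z: "0 \<le> Re z" "Re z \<le> 1" for z
  proof -
    have ab: "Re z * x \<le> \<bar>x\<bar>" for x
    proof -
      have "\<bar>Re z * x\<bar> \<le> 1 * \<bar>x\<bar>" unfolding abs_mult using z by (intro mult_right_mono) auto
      then show ?thesis by simp
    qed
    have "cmod (F z) \<le> (\<Sum>i\<in>I. cmod (c i) * exp \<bar>l i\<bar>)"
      unfolding F_def by (rule sum_norm_le) (auto simp: norm_mult intro!: mult_left_mono ab)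
    moreover have "cmod (exp (of_real (- ln M0) + z * of_real (ln M0 - ln M1))) \<le> exp (\<bar>ln M0\<bar> + \<bar>ln M0 - ln M1\<bar>)"
      using ab[of "ln M0 - ln M1"] by simp
    ultimately have "cmod (G z) \<le> (\<Sum>i\<in>I. cmod (c i) * exp \<bar>l i\<bar>) * exp (\<bar>ln M0\<bar> + \<bar>ln M0 - ln M1\<bar>)"
      unfolding G_def norm_mult by (intro mult_mono) (auto intro: sum_nonneg)
    then show ?thesis unfolding K_def by simp
  qed
  have G0: "cmod (G (Complex 0 y)) \<le> 1" for y
    using F0[of y] M by (simp add: G_def norm_mult exp_minus field_simps)
  have G1: "cmod (G (Complex 1 y)) \<le> 1" for y
    using F1[of y] M by (simp add: G_def norm_mult exp_minus field_simps)
  have eps: "cmod (G (of_real w)) \<le> exp (e * (1 - w\<^sup>2))" if e: "e > 0" for e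
  proof -
    \<comment> \<open>A height at which the Gaussian factor defeats the crude bound K, that is e T^2
      \<ge> ln K; the horizontal sides of the rectangle are then harmless. Letting e tend to 0
      removes the factor.\<close>
    define T where "T = sqrt (\<bar>ln K\<bar> / e) + 1"
    have T: "T > 0" unfolding T_def by (simp add: add_nonneg_pos e less_imp_le)
    have "\<bar>ln K\<bar> / e \<le> T\<^sup>2"
    proof -
      have "(sqrt (\<bar>ln K\<bar> / e))\<^sup>2 \<le> T\<^sup>2" unfolding T_def using e by (intro power_mono) auto
      then show ?thesis using e by simp
    qed
    then have T2: "ln K \<le> e * T\<^sup>2" using e by (simp add: field_simps)
    define H where "H z = G z * exp (of_real e * (z\<^sup>2 - 1))" for z
    define S where "S = cbox (Complex 0 (-T)) (Complex 1 T)"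
    have nH: "cmod (H z) = cmod (G z) * exp (e * ((Re z)\<^sup>2 - (Im z)\<^sup>2 - 1))" for z
      by (simp add: H_def norm_mult power2_eq_square)
    have "cmod (H (of_real w)) \<le> 1"
    proof (rule maximum_modulus_frontier[where f=H and S=S])
      show "H holomorphic_on interior S" unfolding H_def G_def F_def by (intro holomorphic_intros)
      show "continuous_on (closure S) H" unfolding H_def G_def F_def by (intro continuous_intros)
      show "bounded S" by (simp add: S_def)
      show "of_real w \<in> S" using w T by (simp add: S_def in_cbox_complex_iff)
      fix z assume "z \<in> frontier S"
      then have z: "z \<in> S" "z \<notin> box (Complex 0 (-T)) (Complex 1 T)"
        by (auto simp: S_def frontier_def interior_cbox)
      then have b: "0 \<le> Re z" "Re z \<le> 1" "-T \<le> Im z" "Im z \<le> T" by (auto simp: S_def in_cbox_complex_iff)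
      have x2: "(Re z)\<^sup>2 \<le> 1" using b by (simp add: power_le_one)
      from z b consider "Re z = 0" | "Re z = 1" | "\<bar>Im z\<bar> = T" by (auto simp: in_box_complex_iff)
      then show "cmod (H z) \<le> 1"
      proof cases
        case 1
        have "cmod (G z) \<le> 1" using G0[of "Im z"] 1 by (metis complex_surj)
        moreover have "e * ((Re z)\<^sup>2 - (Im z)\<^sup>2 - 1) \<le> 0" using x2 e zero_le_power2[of "Im z"] by (intro mult_nonneg_nonpos) linarith+
        ultimately show ?thesis unfolding nH by (intro mult_le_one) auto
      next
        case 2
        have "cmod (G z) \<le> 1" using G1[of "Im z"] 2 by (metis complex_surj)
        moreover have "e * ((Re z)\<^sup>2 - (Im z)\<^sup>2 - 1) \<le> 0" using x2 e zero_le_power2[of "Im z"] by (intro mult_nonneg_nonpos) linarith+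
        ultimately show ?thesis unfolding nH by (intro mult_le_one) auto
      next
        case 3
        then have "(Im z)\<^sup>2 = T\<^sup>2" by (metis power2_abs)
        then have "e * ((Re z)\<^sup>2 - (Im z)\<^sup>2 - 1) \<le> e * (- (T\<^sup>2))" using x2 e by (intro mult_left_mono) auto
        also have "\<dots> \<le> - ln K" using T2 by simp
        finally have "exp (e * ((Re z)\<^sup>2 - (Im z)\<^sup>2 - 1)) \<le> exp (- ln K)" by simp
        also have "\<dots> = 1 / K" using Kpos by (simp add: exp_minus inverse_eq_divide)
        finally have "exp (e * ((Re z)\<^sup>2 - (Im z)\<^sup>2 - 1)) \<le> 1 / K" .
        then have "cmod (H z) \<le> K * (1 / K)" unfolding nH using GK[OF b(1,2)] Kpos by (intro mult_mono) auto
        then show ?thesis using Kpos by simp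
      qed
    qed
    then have "cmod (G (of_real w)) * exp (- (e * (1 - w\<^sup>2))) \<le> 1" unfolding nH by (simp add: algebra_simps)
    then have "cmod (G (of_real w)) * exp (- (e * (1 - w\<^sup>2))) * exp (e * (1 - w\<^sup>2)) \<le> 1 * exp (e * (1 - w\<^sup>2))"
      by (rule mult_right_mono) simp
    then show ?thesis by (simp add: mult.assoc flip: exp_add)
  qed
  have "cmod (G (of_real w)) \<le> 1"
  proof (rule tendsto_lowerbound)
    show "((\<lambda>e. exp (e * (1 - w\<^sup>2))) \<longlongrightarrow> 1) (at_right 0)" by (auto intro!: tendsto_eq_intros)
    show "\<forall>\<^sub>F e in at_right 0. cmod (G (of_real w)) \<le> exp (e * (1 - w\<^sup>2))"
      by (rule eventually_mono[OF eventually_at_right_less]) (use eps in auto)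
  qed simp
  then have "cmod (F (of_real w)) * exp (- ln M0 + w * (ln M0 - ln M1)) \<le> 1"
    by (simp add: G_def norm_mult)
  then have "cmod (F (of_real w)) \<le> exp (- (- ln M0 + w * (ln M0 - ln M1)))"
    unfolding exp_minus[of "- ln M0 + w * (ln M0 - ln M1)"] by (simp add: field_simps)
  also have "\<dots> = M0 powr (1 - w) * M1 powr w"
    using M by (simp add: powr_def algebra_simps flip: exp_add)
  finally show ?thesis .
qed

text \<open>Interpolates between the exponent pairs (1, \<tau>) and (1/2, 1/2). The analytic
  families are the powers f^((1 - z/2) / s) and g^(((1 - z) \<tau> + z/2) / t). They return f and g
  at z = w, and on both edges their norms are powers of the same two sums \<open>S\<close> and
  \<open>G\<close>.\<close>

lemma riesz_thorin_bilinear: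
  fixes k :: "'x \<Rightarrow> 'y \<Rightarrow> complex" and f :: "'y \<Rightarrow> real" and g :: "'x \<Rightarrow> real"
  assumes fin: "finite X" "finite Y"
    and f0: "\<And>y. y \<in> Y \<Longrightarrow> f y \<ge> 0" and g0: "\<And>x. x \<in> X \<Longrightarrow> g x \<ge> 0"
    and \<tau>: "0 < \<tau>" and w: "0 \<le> w" "w \<le> 1"
    and s: "s = 1 - w / 2" and t: "t = (1 - w) * \<tau> + w / 2"
    and A: "A > 0" and B: "B > 0"
    and H1: "\<And>a b. cmod (\<Sum>x\<in>X. \<Sum>y\<in>Y. b x * k x y * a y)
        \<le> A * (\<Sum>y\<in>Y. cmod (a y)) * (\<Sum>x\<in>X. cmod (b x) powr (1 / \<tau>)) powr \<tau>"
    and H2: "\<And>a b. cmod (\<Sum>x\<in>X. \<Sum>y\<in>Y. b x * k x y * a y)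
        \<le> B * sqrt (\<Sum>y\<in>Y. (cmod (a y))\<^sup>2) * sqrt (\<Sum>x\<in>X. (cmod (b x))\<^sup>2)"
  shows "cmod (\<Sum>x\<in>X. \<Sum>y\<in>Y. of_real (g x) * k x y * of_real (f y))
      \<le> A powr (1 - w) * B powr w * (\<Sum>y\<in>Y. f y powr (1 / s)) powr s * (\<Sum>x\<in>X. g x powr (1 / t)) powr t"
proof -
  have s0: "s > 0" using w s by simp
  have t0: "t > 0" using w t \<tau> by (cases "w = 1") (auto intro: add_pos_nonneg)
  \<comment> \<open>Zeros of f and g are removed, because the exponential of a logarithm never
    vanishes.\<close>
  define X' where "X' = {x\<in>X. g x \<noteq> 0}"
  define Y' where "Y' = {y\<in>Y. f y \<noteq> 0}"
  have fin': "finite X'" "finite Y'" using fin by (auto simp: X'_def Y'_def)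
  define S where "S = (\<Sum>y\<in>Y. f y powr (1 / s))"
  define G where "G = (\<Sum>x\<in>X. g x powr (1 / t))"
  define a where "a z y = (if y \<in> Y' then exp ((1 - z / 2) / of_real s * of_real (ln (f y))) else 0)" for z :: complex and y
  define b where "b z x = (if x \<in> X' then exp (((1 - z) * of_real \<tau> + z / 2) / of_real t * of_real (ln (g x))) else 0)" for z :: complex and x
  \<comment> \<open>Splitting the exponent into its constant part and its coefficient of z exhibits
    \<open>F\<close> as a sum to which \<open>three_lines_exp_sum\<close> applies.\<close>
  define c where "c = (\<lambda>(x, y). k x y * of_real (exp (\<tau> / t * ln (g x) + 1 / s * ln (f y))))"
  define l where "l = (\<lambda>(x, y). (1/2 - \<tau>) / t * ln (g x) - 1 / (2 * s) * ln (f y))"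
  define F where "F z = (\<Sum>i\<in>X' \<times> Y'. c i * exp (z * of_real (l i)))" for z
  have Fab: "F z = (\<Sum>x\<in>X. \<Sum>y\<in>Y. b z x * k x y * a z y)" for z
  proof -
    have "(\<Sum>x\<in>X. \<Sum>y\<in>Y. b z x * k x y * a z y) = (\<Sum>x\<in>X'. \<Sum>y\<in>Y. b z x * k x y * a z y)"
      by (rule sum.mono_neutral_right) (use fin in \<open>auto simp: b_def X'_def\<close>)
    also have "\<dots> = (\<Sum>x\<in>X'. \<Sum>y\<in>Y'. b z x * k x y * a z y)"
      by (intro sum.cong refl sum.mono_neutral_right) (use fin in \<open>auto simp: a_def Y'_def\<close>)
    also have "\<dots> = (\<Sum>x\<in>X'. \<Sum>y\<in>Y'. c (x, y) * exp (z * of_real (l (x, y))))"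
    proof (intro sum.cong refl)
      fix x y assume xy: "x \<in> X'" "y \<in> Y'"
      have "b z x * k x y * a z y = k x y * exp (((1 - z) * of_real \<tau> + z / 2) / of_real t * of_real (ln (g x)) + (1 - z / 2) / of_real s * of_real (ln (f y)))"
        using xy by (simp add: a_def b_def exp_add)
      also have "\<dots> = k x y * exp (of_real (\<tau> / t * ln (g x) + 1 / s * ln (f y)) + z * of_real (l (x, y)))"
        using s0 t0 by (intro arg_cong2[where f="(*)"] arg_cong[where f=exp] refl) (simp add: l_def field_simps)
      also have "\<dots> = c (x, y) * exp (z * of_real (l (x, y)))"
        by (simp only: exp_add[of "of_real _"] c_def prod.case exp_of_real mult.assoc)
      finally show "b z x * k x y * a z y = c (x, y) * exp (z * of_real (l (x, y)))" .
    qed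
    finally show ?thesis by (simp add: F_def sum.cartesian_product)
  qed
  have na: "cmod (a (Complex u v) y) = f y powr ((1 - u / 2) / s)" if "y \<in> Y" for u v y
    using that f0[OF that] s0 by (auto simp: a_def Y'_def powr_def field_simps Re_divide_of_real)
  have nb: "cmod (b (Complex u v) x) = g x powr (((1 - u) * \<tau> + u / 2) / t)" if "x \<in> X" for u v x
    using that g0[OF that] t0 by (auto simp: b_def X'_def powr_def field_simps)
  have Fw: "F (of_real w) = (\<Sum>x\<in>X. \<Sum>y\<in>Y. of_real (g x) * k x y * of_real (f y))"
    unfolding Fab
  proof (intro sum.cong refl)
    fix x y assume "x \<in> X" "y \<in> Y"
    have "a (of_real w) y = of_real (f y)"
    proof (cases "f y = 0")
      case False
      have "(1 - of_real w / 2) / of_real s = (1::complex)" using s s0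
        by (metis divide_self of_real_1 of_real_diff of_real_divide of_real_numeral order_less_irrefl)
      then show ?thesis using False f0[OF \<open>y \<in> Y\<close>] \<open>y \<in> Y\<close> by (simp add: a_def Y'_def exp_of_real)
    qed (simp add: a_def Y'_def)
    moreover have "b (of_real w) x = of_real (g x)"
    proof (cases "g x = 0")
      case False
      have "((1 - of_real w) * of_real \<tau> + of_real w / 2) / of_real t = (of_real (((1 - w) * \<tau> + w / 2) / t) :: complex)" by simp
      also have "\<dots> = 1" using t t0 by simp
      finally show ?thesis using False g0[OF \<open>x \<in> X\<close>] \<open>x \<in> X\<close> by (simp add: b_def X'_def exp_of_real)
    qed (simp add: b_def X'_def)
    ultimately show "b (of_real w) x * k x y * a (of_real w) y = of_real (g x) * k x y * of_real (f y)" by simp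
  qed
  show ?thesis
  proof (cases "X' = {} \<or> Y' = {}")
    case True
    then have "F (of_real w) = 0" by (auto simp: F_def)
    then show ?thesis unfolding Fw using A B by simp
  next
    case False
    then obtain x0 y0 where xy0: "x0 \<in> X'" "y0 \<in> Y'" by auto
    have S0: "S > 0" unfolding S_def
      by (rule sum_pos2[of _ y0]) (use fin xy0 in \<open>auto simp: Y'_def\<close>)
    have G0: "G > 0" unfolding G_def
      by (rule sum_pos2[of _ x0]) (use fin xy0 in \<open>auto simp: X'_def\<close>)
    have "cmod (F (of_real w)) \<le> (A * S * G powr \<tau>) powr (1 - w) * (B * sqrt S * sqrt G) powr w"
      unfolding F_def
    proof (rule three_lines_exp_sum[where I="X' \<times> Y'"], fold F_def)
      fix v
      have "cmod (F (Complex 0 v)) \<le> A * (\<Sum>y\<in>Y. f y powr (1 / s)) * (\<Sum>x\<in>X. (g x powr (\<tau> / t)) powr (1 / \<tau>)) powr \<tau>"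
        unfolding Fab using H1[of "b (Complex 0 v)" "a (Complex 0 v)"] by (simp add: na nb cong: sum.cong)
      also have "\<dots> = A * S * G powr \<tau>" using \<tau> by (simp add: S_def G_def powr_powr)
      finally show "cmod (F (Complex 0 v)) \<le> A * S * G powr \<tau>" .
      have pq: "(x powr (1 / 2 / r))\<^sup>2 = x powr (1 / r)" for x r :: real
        by (simp add: power2_eq_square flip: powr_add)
      have "cmod (F (Complex 1 v)) \<le> B * sqrt (\<Sum>y\<in>Y. (f y powr (1 / 2 / s))\<^sup>2) * sqrt (\<Sum>x\<in>X. (g x powr (1 / 2 / t))\<^sup>2)"
        unfolding Fab using H2[of "b (Complex 1 v)" "a (Complex 1 v)"] by (simp add: na nb cong: sum.cong)
      also have "\<dots> = B * sqrt S * sqrt G" unfolding pq by (simp add: S_def G_def)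
      finally show "cmod (F (Complex 1 v)) \<le> B * sqrt S * sqrt G" .
    qed (use A B S0 G0 w in auto)
    also have "\<dots> = A powr (1 - w) * B powr w * (S powr (1 - w) * S powr (w / 2)) * (G powr (\<tau> * (1 - w)) * G powr (w / 2))"
      using A B S0 G0 by (simp add: powr_mult powr_powr flip: powr_half_sqrt)
    also have "\<dots> = A powr (1 - w) * B powr w * S powr s * G powr t"
      unfolding powr_add[symmetric] s t by (simp add: algebra_simps)
    finally show ?thesis unfolding Fw S_def G_def .
  qed
qed

section \<open>Convolution with a quadratic phase\<close>

text \<open>A box rather than a ball, so that sums of products over it factor over the
  coordinates.\<close>

definition lattice_box :: "nat \<Rightarrow> (int ^ 'n) set" where
  "lattice_box R = {y. \<forall>i. \<bar>y $ i\<bar> \<le> int R}"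

lemma sum_vec_prod:
  fixes \<phi> :: "'n::finite \<Rightarrow> 'b \<Rightarrow> 'c::comm_semiring_1"
  assumes "finite B"
  shows "(\<Sum>u\<in>{u::'b^'n. \<forall>i. u $ i \<in> B}. \<Prod>i\<in>UNIV. \<phi> i (u $ i)) = (\<Prod>i\<in>UNIV. \<Sum>v\<in>B. \<phi> i v)"
proof -
  have "(\<Prod>i\<in>UNIV. \<Sum>v\<in>B. \<phi> i v) = (\<Sum>g\<in>PiE UNIV (\<lambda>_. B). \<Prod>i\<in>UNIV. \<phi> i (g i))"
    using assms by (intro prod_sum_PiE) auto
  also have "\<dots> = (\<Sum>u\<in>{u::'b^'n. \<forall>i. u $ i \<in> B}. \<Prod>i\<in>UNIV. \<phi> i (u $ i))"
    by (rule sum.reindex_bij_witness[where i=vec_nth and j="vec_lambda"]) auto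
  finally show ?thesis by simp
qed

lemma lattice_box_eq: "lattice_box R = {u::int^'n::finite. \<forall>i. u $ i \<in> {-int R..int R}}"
  by (auto simp: lattice_box_def abs_le_iff) (metis minus_le_iff)+

lemma card_lattice_box: "card (lattice_box R :: (int^'n::finite) set) = (2 * R + 1) ^ CARD('n)"
proof -
  have "card (lattice_box R :: (int^'n) set) = (\<Sum>u\<in>(lattice_box R :: (int^'n) set). \<Prod>i\<in>(UNIV::'n set). 1)" by simp
  also have "\<dots> = (\<Prod>i\<in>(UNIV::'n set). \<Sum>v\<in>{-int R..int R}. 1)"
    unfolding lattice_box_eq by (rule sum_vec_prod) simp
  also have "\<dots> = (2 * R + 1) ^ CARD('n)" by (simp add: nat_add_distrib nat_mult_distrib)
  finally show ?thesis .
qed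

lemma finite_lattice_box [simp]: "finite (lattice_box R :: (int^'n::finite) set)"
  using card_lattice_box[of R, where 'n='n] card.infinite by force

lemma component_sq_le_sqnorm: "(y $ i)\<^sup>2 \<le> sqnorm (y :: int^'n::finite)"
  unfolding sqnorm_def by (rule member_le_sum) auto

lemma sqnorm_in_lattice_box:
  assumes "sqnorm (y :: int^'n::finite) \<le> (int R)\<^sup>2"
  shows "y \<in> lattice_box R"
  unfolding lattice_box_def using order_trans[OF component_sq_le_sqnorm assms]
  by (auto simp: abs_le_square_iff[symmetric])

lemma finite_sqnorm: "finite {y :: int^'n::finite. sqnorm y = n}"
proof (rule finite_subset)
  show "{y :: int^'n. sqnorm y = n} \<subseteq> lattice_box (nat \<bar>n\<bar>)"
  proof
    fix y :: "int^'n" assume "y \<in> {y. sqnorm y = n}"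
    then have "sqnorm y \<le> (int (nat \<bar>n\<bar>))\<^sup>2" using abs_le_power2_int[of n] by simp
    then show "y \<in> lattice_box (nat \<bar>n\<bar>)" by (rule sqnorm_in_lattice_box)
  qed
qed simp

lemma card_sq_reps_le_sqnorm: "card (sq_reps CARD('n) n) \<le> card {y :: int^'n::finite. sqnorm y = n}"
proof -
  obtain b where b: "bij_betw b (UNIV :: 'n set) {0..<CARD('n)}"
    using ex_bij_betw_finite_nat[OF finite_class.finite_UNIV] by blast
  define h where "h l = (\<chi> i. l ! b i)" for l :: "int list"
  have "inj_on h (sq_reps CARD('n) n)"
  proof (rule inj_onI)
    fix l l' assume l: "l \<in> sq_reps CARD('n) n" "l' \<in> sq_reps CARD('n) n" "h l = h l'"
    have "l ! j = l' ! j" if "j < CARD('n)" for j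
    proof -
      have "j \<in> b ` UNIV" using b that by (simp add: bij_betw_def)
      then obtain i where "j = b i" by blast
      then show ?thesis using l(3) by (simp add: h_def vec_eq_iff)
    qed
    then show "l = l'" using l by (intro nth_equalityI) (auto simp: sq_reps_def)
  qed
  moreover have "h ` sq_reps CARD('n) n \<subseteq> {y. sqnorm y = n}"
  proof clarify
    fix l assume l: "l \<in> sq_reps CARD('n) n"
    have "sqnorm (h l) = (\<Sum>i\<in>UNIV. (l ! b i)\<^sup>2)" by (simp add: sqnorm_def h_def)
    also have "\<dots> = (\<Sum>j\<in>{0..<CARD('n)}. (l ! j)\<^sup>2)" using b by (rule sum.reindex_bij_betw)
    also have "\<dots> = n" using l by (auto simp: sq_reps_def sum_list_sum_nth)
    finally show "sqnorm (h l) = n" .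
  qed
  ultimately show ?thesis by (rule card_inj_on_le[OF _ _ finite_sqnorm])
qed

lemma card_sqnorm_ge:
  assumes "CARD('n::finite) \<ge> 5"
  obtains c where "c > 0"
    "\<And>n. n \<ge> 1 \<Longrightarrow> c * real_of_int n powr (real CARD('n) / 2 - 1) \<le> card {y :: int^'n. sqnorm y = n}"
proof -
  obtain c where c: "c > 0" "\<forall>n\<ge>1. c * real_of_int n powr (real CARD('n) / 2 - 1) \<le> card (sq_reps CARD('n) n)"
    using card_sq_reps_ge[OF assms] by blast
  show ?thesis
  proof (rule that[OF c(1)])
    fix n :: int assume "n \<ge> 1"
    then have "c * real_of_int n powr (real CARD('n) / 2 - 1) \<le> card (sq_reps CARD('n) n)" using c by blast
    also have "\<dots> \<le> card {y :: int^'n. sqnorm y = n}" using card_sq_reps_le_sqnorm[where 'n='n] by simp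
    finally show "c * real_of_int n powr (real CARD('n) / 2 - 1) \<le> card {y :: int^'n. sqnorm y = n}" .
  qed
qed

section \<open>The product kernel and its autocorrelation\<close>

definition sq_kernel :: "nat \<Rightarrow> real \<Rightarrow> int^'n \<Rightarrow> complex" where
  "sq_kernel R \<alpha> y = (\<Prod>i\<in>UNIV. quad_kernel R \<alpha> (y $ i))"

lemma sq_kernel_eq:
  "sq_kernel R \<alpha> (y :: int^'n::finite) = (if y \<in> lattice_box R then cis (2 * pi * \<alpha> * of_int (sqnorm y)) else 0)"
proof (cases "y \<in> lattice_box R")
  case True
  have cp: "(\<Prod>i\<in>I. cis (f i)) = cis (\<Sum>i\<in>I. f i)" if "finite I" for I :: "'n set" and f
    using that by (induction) (auto simp: cis_mult)
  have "sq_kernel R \<alpha> y = (\<Prod>i\<in>UNIV. cis (2 * pi * \<alpha> * of_int ((y $ i)\<^sup>2)))"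
    unfolding sq_kernel_def using True by (intro prod.cong) (auto simp: quad_kernel_def lattice_box_def)
  also have "\<dots> = cis (2 * pi * \<alpha> * of_int (sqnorm y))"
    by (subst cp) (auto simp: sqnorm_def sum_distrib_left)
  finally show ?thesis using True by simp
next
  case False
  then obtain i where "\<not> \<bar>y $ i\<bar> \<le> int R" by (auto simp: lattice_box_def)
  then have "quad_kernel R \<alpha> (y $ i) = 0" by (simp add: quad_kernel_def)
  then show ?thesis unfolding sq_kernel_def using False by (auto intro!: prod_zero)
qed

definition sq_corr :: "nat \<Rightarrow> real \<Rightarrow> int^'n \<Rightarrow> complex" where
  "sq_corr R \<alpha> h = (\<Prod>i\<in>UNIV. quad_corr R \<alpha> (h $ i))"

lemma sq_corr_eq:
  fixes y y' :: "int^'n::finite"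
  assumes Z: "finite Z" "\<And>x. x - y \<in> lattice_box R \<Longrightarrow> x \<in> Z"
  shows "(\<Sum>x\<in>Z. sq_kernel R \<alpha> (x - y) * cnj (sq_kernel R \<alpha> (x - y'))) = sq_corr R \<alpha> (y' - y)"
proof -
  have "(\<Sum>x\<in>Z. sq_kernel R \<alpha> (x - y) * cnj (sq_kernel R \<alpha> (x - y')))
      = (\<Sum>x\<in>{x\<in>Z. x - y \<in> lattice_box R}. sq_kernel R \<alpha> (x - y) * cnj (sq_kernel R \<alpha> (x - y')))"
    by (rule sum.mono_neutral_right) (use Z in \<open>auto simp: sq_kernel_eq\<close>)
  also have "\<dots> = (\<Sum>u\<in>lattice_box R. sq_kernel R \<alpha> u * cnj (sq_kernel R \<alpha> (u - (y' - y))))"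
    by (rule sum.reindex_bij_witness[where i="\<lambda>u. u + y" and j="\<lambda>x. x - y"]) (use Z in \<open>auto simp: algebra_simps\<close>)
  also have "\<dots> = (\<Sum>u\<in>lattice_box R. \<Prod>i\<in>UNIV. quad_kernel R \<alpha> (u $ i) * cnj (quad_kernel R \<alpha> (u $ i - (y' - y) $ i)))"
    by (simp add: sq_kernel_def prod.distrib)
  also have "\<dots> = sq_corr R \<alpha> (y' - y)"
    unfolding lattice_box_eq sq_corr_def quad_corr_def by (rule sum_vec_prod) simp
  finally show ?thesis .
qed

lemma quad_corr_eq_0: "\<bar>h\<bar> > 2 * int R \<Longrightarrow> quad_corr R \<alpha> h = 0"
  unfolding quad_corr_def by (rule sum.neutral) (auto simp: quad_kernel_def abs_le_iff)

lemma sq_corr_eq_0: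
  assumes "h \<notin> lattice_box (2 * R)"
  shows "sq_corr R \<alpha> (h :: int^'n::finite) = 0"
proof -
  obtain i where "\<not> \<bar>h $ i\<bar> \<le> int (2 * R)" using assms by (auto simp: lattice_box_def)
  then have "quad_corr R \<alpha> (h $ i) = 0" by (intro quad_corr_eq_0) simp
  then show ?thesis unfolding sq_corr_def by (auto intro!: prod_zero)
qed

lemma sum_norm_sq_corr_le:
  fixes g :: "'a \<Rightarrow> int^'n::finite"
  assumes "finite Y" "inj_on g Y"
  shows "(\<Sum>y\<in>Y. cmod (sq_corr R \<alpha> (g y))) \<le> weyl_weight R \<alpha> ^ CARD('n)"
proof -
  have "(\<Sum>y\<in>Y. cmod (sq_corr R \<alpha> (g y))) = (\<Sum>h\<in>g ` Y. cmod (sq_corr R \<alpha> h))"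
    using assms by (simp add: sum.reindex)
  also have "\<dots> = (\<Sum>h\<in>g ` Y \<inter> lattice_box (2 * R). cmod (sq_corr R \<alpha> h))"
    by (rule sum.mono_neutral_right) (use assms sq_corr_eq_0 in auto)
  also have "\<dots> \<le> (\<Sum>h\<in>(lattice_box (2 * R) :: (int^'n) set). cmod (sq_corr R \<alpha> h))" by (rule sum_mono2) auto
  also have "\<dots> = (\<Sum>h\<in>(lattice_box (2 * R) :: (int^'n) set). \<Prod>i\<in>UNIV. cmod (quad_corr R \<alpha> (h $ i)))"
    by (simp add: sq_corr_def prod_norm)
  also have "\<dots> = weyl_weight R \<alpha> ^ CARD('n)"
    unfolding lattice_box_eq by (subst sum_vec_prod) (auto simp: weyl_weight_def)
  finally show ?thesis .
qed

text \<open>The operator norm is controlled by the absolute row sums of \<open>T\<^sup>* T\<close>, which needs no Fourier transform.\<close>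
lemma sq_kernel_l2_bound:
  fixes a :: "int^'n::finite \<Rightarrow> complex"
  assumes fin: "finite X" "finite Y"
  shows "(\<Sum>x\<in>X. (cmod (\<Sum>y\<in>Y. sq_kernel R \<alpha> (x - y) * a y))\<^sup>2) \<le> weyl_weight R \<alpha> ^ CARD('n) * (\<Sum>y\<in>Y. (cmod (a y))\<^sup>2)"
proof -
  define K where "K = (sq_kernel R \<alpha> :: int^'n \<Rightarrow> complex)"
  define \<rho> where "\<rho> = (sq_corr R \<alpha> :: int^'n \<Rightarrow> complex)"
  define W where "W = weyl_weight R \<alpha> ^ CARD('n)"
  \<comment> \<open>Enlarging \<open>X\<close> to contain the box around every point of
    \<open>Y\<close> makes each sum over x a complete correlation, which depends on y' - y
    alone.\<close>
  define Z where "Z = X \<union> (\<lambda>(u, y). u + y) ` (lattice_box R \<times> Y)"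
  have Z: "finite Z" using fin by (simp add: Z_def)
  have ZY: "x \<in> Z" if "y \<in> Y" "x - y \<in> lattice_box R" for x y
    unfolding Z_def using that by (auto intro!: image_eqI[of _ _ "(x - y, y)"])
  have "(\<Sum>x\<in>X. (cmod (\<Sum>y\<in>Y. K (x - y) * a y))\<^sup>2) \<le> (\<Sum>x\<in>Z. (cmod (\<Sum>y\<in>Y. K (x - y) * a y))\<^sup>2)"
    by (rule sum_mono2) (use Z in \<open>auto simp: Z_def\<close>)
  also have "\<dots> = cmod (\<Sum>y\<in>Y. \<Sum>y'\<in>Y. a y * cnj (a y') * \<rho> (y' - y))"
  proof -
    have "complex_of_real (\<Sum>x\<in>Z. (cmod (\<Sum>y\<in>Y. K (x - y) * a y))\<^sup>2)
        = (\<Sum>x\<in>Z. (\<Sum>y\<in>Y. K (x - y) * a y) * cnj (\<Sum>y\<in>Y. K (x - y) * a y))"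
      by (simp only: of_real_sum complex_norm_square)
    also have "\<dots> = (\<Sum>x\<in>Z. \<Sum>y\<in>Y. \<Sum>y'\<in>Y. a y * cnj (a y') * (K (x - y) * cnj (K (x - y'))))"
      by (simp add: sum_product mult_ac)
    also have "\<dots> = (\<Sum>y\<in>Y. \<Sum>x\<in>Z. \<Sum>y'\<in>Y. a y * cnj (a y') * (K (x - y) * cnj (K (x - y'))))" by (rule sum.swap)
    also have "\<dots> = (\<Sum>y\<in>Y. \<Sum>y'\<in>Y. \<Sum>x\<in>Z. a y * cnj (a y') * (K (x - y) * cnj (K (x - y'))))"
      by (intro sum.cong refl sum.swap)
    also have "\<dots> = (\<Sum>y\<in>Y. \<Sum>y'\<in>Y. a y * cnj (a y') * (\<Sum>x\<in>Z. K (x - y) * cnj (K (x - y'))))"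
      by (simp add: sum_distrib_left)
    also have "\<dots> = (\<Sum>y\<in>Y. \<Sum>y'\<in>Y. a y * cnj (a y') * \<rho> (y' - y))"
      unfolding K_def \<rho>_def by (intro sum.cong refl arg_cong2[where f="(*)"] sq_corr_eq Z ZY)
    finally have "cmod (complex_of_real (\<Sum>x\<in>Z. (cmod (\<Sum>y\<in>Y. K (x - y) * a y))\<^sup>2))
        = cmod (\<Sum>y\<in>Y. \<Sum>y'\<in>Y. a y * cnj (a y') * \<rho> (y' - y))" by (rule arg_cong)
    then show ?thesis by (simp only: norm_of_real) (simp add: sum_nonneg)
  qed
  also have "\<dots> \<le> (\<Sum>y\<in>Y. \<Sum>y'\<in>Y. cmod (a y) * cmod (a y') * cmod (\<rho> (y' - y)))"
    by (intro sum_norm_le) (simp add: norm_mult)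
  \<comment> \<open>Schur's test: the arithmetic-geometric mean separates \<open>a y\<close> from
    \<open>a y'\<close>, and each half then contains a full row or column sum of
    correlations.\<close>
  also have "\<dots> \<le> (\<Sum>y\<in>Y. \<Sum>y'\<in>Y. (cmod (a y))\<^sup>2 / 2 * cmod (\<rho> (y' - y)) + (cmod (a y'))\<^sup>2 / 2 * cmod (\<rho> (y' - y)))"
  proof (intro sum_mono)
    fix y y'
    have "cmod (a y) * cmod (a y') \<le> (cmod (a y))\<^sup>2 / 2 + (cmod (a y'))\<^sup>2 / 2"
      using sum_squares_bound[of "cmod (a y)" "cmod (a y')"] by simp
    then have "cmod (a y) * cmod (a y') * cmod (\<rho> (y' - y)) \<le> ((cmod (a y))\<^sup>2 / 2 + (cmod (a y'))\<^sup>2 / 2) * cmod (\<rho> (y' - y))"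
      by (rule mult_right_mono) simp
    then show "cmod (a y) * cmod (a y') * cmod (\<rho> (y' - y)) \<le> (cmod (a y))\<^sup>2 / 2 * cmod (\<rho> (y' - y)) + (cmod (a y'))\<^sup>2 / 2 * cmod (\<rho> (y' - y))"
      by (simp only: distrib_right)
  qed
  also have "\<dots> = (\<Sum>y\<in>Y. \<Sum>y'\<in>Y. (cmod (a y))\<^sup>2 / 2 * cmod (\<rho> (y' - y))) + (\<Sum>y\<in>Y. \<Sum>y'\<in>Y. (cmod (a y'))\<^sup>2 / 2 * cmod (\<rho> (y' - y)))"
    by (simp only: sum.distrib)
  also have "(\<Sum>y\<in>Y. \<Sum>y'\<in>Y. (cmod (a y'))\<^sup>2 / 2 * cmod (\<rho> (y' - y))) = (\<Sum>y'\<in>Y. \<Sum>y\<in>Y. (cmod (a y'))\<^sup>2 / 2 * cmod (\<rho> (y' - y)))"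
    by (rule sum.swap)
  also have "(\<Sum>y\<in>Y. \<Sum>y'\<in>Y. (cmod (a y))\<^sup>2 / 2 * cmod (\<rho> (y' - y))) \<le> (\<Sum>y\<in>Y. (cmod (a y))\<^sup>2 / 2 * W)"
    unfolding sum_distrib_left[symmetric] \<rho>_def W_def
    by (intro sum_mono mult_left_mono sum_norm_sq_corr_le fin) (auto simp: inj_on_def)
  also have "(\<Sum>y'\<in>Y. \<Sum>y\<in>Y. (cmod (a y'))\<^sup>2 / 2 * cmod (\<rho> (y' - y))) \<le> (\<Sum>y\<in>Y. (cmod (a y))\<^sup>2 / 2 * W)"
    unfolding sum_distrib_left[symmetric] \<rho>_def W_def
    by (intro sum_mono mult_left_mono sum_norm_sq_corr_le fin) (auto simp: inj_on_def)
  finally show ?thesis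
    by (simp add: K_def W_def sum_distrib_left[symmetric] sum_distrib_right[symmetric] sum_divide_distrib[symmetric])
qed

text \<open>Hoelder's inequality against the constant 1, obtained from convexity of x powr (1 /
  \<tau>). Convexity is applied on the positive reals, so zero terms are split off first.\<close>

lemma sum_le_card_powr:
  fixes b :: "'a \<Rightarrow> real"
  assumes \<tau>: "0 < \<tau>" "\<tau> \<le> 1" and fin: "finite S" and b0: "\<And>x. x \<in> S \<Longrightarrow> b x \<ge> 0"
    and M: "real (card S) \<le> M"
  shows "(\<Sum>x\<in>S. b x) \<le> M powr (1 - \<tau>) * (\<Sum>x\<in>S. b x powr (1 / \<tau>)) powr \<tau>"
proof -
  define S' where "S' = {x\<in>S. b x \<noteq> 0}"
  have fin': "finite S'" using fin by (simp add: S'_def)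
  have e1: "(\<Sum>x\<in>S. b x) = (\<Sum>x\<in>S'. b x)"
    by (rule sum.mono_neutral_right) (use fin in \<open>auto simp: S'_def\<close>)
  have e2: "(\<Sum>x\<in>S. b x powr (1 / \<tau>)) = (\<Sum>x\<in>S'. b x powr (1 / \<tau>))"
    by (rule sum.mono_neutral_right) (use fin in \<open>auto simp: S'_def\<close>)
  show ?thesis
  proof (cases "S' = {}")
    case True then show ?thesis unfolding e1 by simp
  next
    case False
    define n where "n = real (card S')"
    have n: "n > 0" using False fin' by (simp add: n_def card_gt_0_iff)
    have nM: "n \<le> M"
      using M card_mono[OF fin, of S'] by (auto simp: n_def S'_def)
    have "(\<Sum>x\<in>S'. (1 / n) *\<^sub>R b x) powr (1 / \<tau>) \<le> (\<Sum>x\<in>S'. (1 / n) * b x powr (1 / \<tau>))"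
    proof (rule convex_on_sum[OF fin' False powr_convex])
      show "1 \<le> 1 / \<tau>" using \<tau> by simp
      show "(\<Sum>x\<in>S'. 1 / n) = 1" using n by (simp add: n_def)
      show "b x \<in> {0<..}" if "x \<in> S'" for x using that b0[of x] by (auto simp: S'_def)
    qed (use n in auto)
    then have "((\<Sum>x\<in>S'. b x) / n) powr (1 / \<tau>) \<le> (\<Sum>x\<in>S'. b x powr (1 / \<tau>)) / n"
      by (simp add: sum_divide_distrib)
    then have "(((\<Sum>x\<in>S'. b x) / n) powr (1 / \<tau>)) powr \<tau> \<le> ((\<Sum>x\<in>S'. b x powr (1 / \<tau>)) / n) powr \<tau>"
      using \<tau> by (intro powr_mono2) auto
    moreover have "(\<Sum>x\<in>S'. b x) \<ge> 0" by (intro sum_nonneg) (auto simp: S'_def b0)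
    ultimately have "(\<Sum>x\<in>S'. b x) / n \<le> ((\<Sum>x\<in>S'. b x powr (1 / \<tau>)) / n) powr \<tau>"
      using \<tau> n by (simp add: powr_powr)
    also have "\<dots> = (\<Sum>x\<in>S'. b x powr (1 / \<tau>)) powr \<tau> / n powr \<tau>" by (simp add: powr_divide)
    finally have "(\<Sum>x\<in>S'. b x) \<le> n * ((\<Sum>x\<in>S'. b x powr (1 / \<tau>)) powr \<tau> / n powr \<tau>)"
      using n by (simp add: field_simps)
    also have "\<dots> = n powr (1 - \<tau>) * (\<Sum>x\<in>S'. b x powr (1 / \<tau>)) powr \<tau>" using n by (simp add: powr_diff)
    also have "\<dots> \<le> M powr (1 - \<tau>) * (\<Sum>x\<in>S'. b x powr (1 / \<tau>)) powr \<tau>"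
      using n nM \<tau> by (intro mult_right_mono powr_mono2) auto
    finally show ?thesis unfolding e1 e2 .
  qed
qed

section \<open>Orthogonality and the bilinear estimates\<close>

lemma integral_cis_int:
  "((\<lambda>\<alpha>. cis (2 * pi * \<alpha> * of_int m)) has_integral (if m = 0 then 1 else 0)) {0..1}"
proof (cases "m = 0")
  case True
  then show ?thesis using has_integral_const_real[of "1::complex" 0 1] by simp
next
  case False
  define c where "c = 2 * pi * of_int m * \<i>"
  have c0: "c \<noteq> 0" using False by (simp add: c_def)
  define F where "F z = exp (c * z) / c" for z
  have "((\<lambda>\<alpha>. exp (c * of_real \<alpha>)) has_integral (F (of_real 1) - F (of_real 0))) {0..1}"
  proof (rule fundamental_theorem_of_calculus)
    fix x :: real
    have "(F has_field_derivative (exp (c * of_real x))) (at (of_real x))"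
      unfolding F_def using c0 by (auto intro!: derivative_eq_intros)
    then show "((\<lambda>x. F (of_real x)) has_vector_derivative exp (c * of_real x)) (at x within {0..1})"
      by (rule has_vector_derivative_real_field)
  qed simp
  moreover have "exp c = 1"
    unfolding c_def exp_eq_1 by (auto simp: intro!: exI[of _ m])
  ultimately have "((\<lambda>\<alpha>. exp (c * of_real \<alpha>)) has_integral 0) {0..1}" by (simp add: F_def)
  moreover have "exp (c * of_real \<alpha>) = cis (2 * pi * \<alpha> * of_int m)" for \<alpha>
    by (simp add: cis_conv_exp c_def mult_ac)
  ultimately show ?thesis using False by simp
qed

text \<open>The factor \<open>c\<close> stands for the modulation by the radius chosen at x.
  Cauchy-Schwarz in x reduces the form to the operator bound, and W^(d/2) is the root of its
  constant W^d.\<close>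

lemma sq_kernel_bilinear_l2:
  fixes a b :: "int^'n::finite \<Rightarrow> complex"
  assumes fin: "finite X" "finite Y" and c: "\<And>x. cmod (c x) = 1"
  shows "cmod (\<Sum>x\<in>X. \<Sum>y\<in>Y. b x * (c x * sq_kernel R \<alpha> (x - y)) * a y)
    \<le> weyl_weight R \<alpha> powr (real CARD('n) / 2) * sqrt (\<Sum>y\<in>Y. (cmod (a y))\<^sup>2) * sqrt (\<Sum>x\<in>X. (cmod (b x))\<^sup>2)"
proof -
  define T where "T x = (\<Sum>y\<in>Y. sq_kernel R \<alpha> (x - y) * a y)" for x
  have W1: "weyl_weight R \<alpha> \<ge> 1" by (rule weyl_weight_ge_1)
  have "(\<Sum>x\<in>X. \<Sum>y\<in>Y. b x * (c x * sq_kernel R \<alpha> (x - y)) * a y) = (\<Sum>x\<in>X. b x * c x * T x)"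
    by (simp add: T_def sum_distrib_left mult_ac)
  also have "cmod \<dots> \<le> (\<Sum>x\<in>X. \<bar>cmod (b x)\<bar> * \<bar>cmod (T x)\<bar>)"
    by (rule sum_norm_le) (simp add: norm_mult c)
  also have "\<dots> \<le> L2_set (\<lambda>x. cmod (b x)) X * L2_set (\<lambda>x. cmod (T x)) X" by (rule L2_set_mult_ineq)
  also have "\<dots> = sqrt (\<Sum>x\<in>X. (cmod (T x))\<^sup>2) * sqrt (\<Sum>x\<in>X. (cmod (b x))\<^sup>2)" by (simp add: L2_set_def mult.commute)
  also have "\<dots> \<le> weyl_weight R \<alpha> powr (real CARD('n) / 2) * sqrt (\<Sum>y\<in>Y. (cmod (a y))\<^sup>2) * sqrt (\<Sum>x\<in>X. (cmod (b x))\<^sup>2)"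
  proof (rule mult_right_mono)
    have "sqrt (\<Sum>x\<in>X. (cmod (T x))\<^sup>2) \<le> sqrt (weyl_weight R \<alpha> ^ CARD('n) * (\<Sum>y\<in>Y. (cmod (a y))\<^sup>2))"
      unfolding T_def by (intro real_sqrt_le_mono sq_kernel_l2_bound fin)
    also have "\<dots> = weyl_weight R \<alpha> powr (real CARD('n) / 2) * sqrt (\<Sum>y\<in>Y. (cmod (a y))\<^sup>2)"
    proof -
      have "sqrt (weyl_weight R \<alpha> ^ CARD('n)) = (weyl_weight R \<alpha> powr real CARD('n)) powr (1/2)"
        using W1 by (simp add: powr_realpow powr_half_sqrt)
      also have "\<dots> = weyl_weight R \<alpha> powr (real CARD('n) / 2)" by (simp add: powr_powr)
      finally show ?thesis by (simp add: real_sqrt_mult)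
    qed
    finally show "sqrt (\<Sum>x\<in>X. (cmod (T x))\<^sup>2) \<le> weyl_weight R \<alpha> powr (real CARD('n) / 2) * sqrt (\<Sum>y\<in>Y. (cmod (a y))\<^sup>2)" .
  qed (simp add: sum_nonneg)
  finally show ?thesis .
qed

text \<open>For fixed y only the x in one translate of the box contribute, so Hoelder on that many
  points suffices. \<tau> = 1 is the bound from l^1 to l^\<infinity>, while \<tau> near 0 approaches
  the one from l^1 to l^1.\<close>

lemma sq_kernel_bilinear_l1:
  fixes a b :: "int^'n::finite \<Rightarrow> complex"
  assumes fin: "finite X" "finite Y" and c: "\<And>x. cmod (c x) = 1" and \<tau>: "0 < \<tau>" "\<tau> \<le> 1"
  shows "cmod (\<Sum>x\<in>X. \<Sum>y\<in>Y. b x * (c x * sq_kernel R \<alpha> (x - y)) * a y)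
    \<le> real (card (lattice_box R :: (int^'n) set)) powr (1 - \<tau>) * (\<Sum>y\<in>Y. cmod (a y)) * (\<Sum>x\<in>X. cmod (b x) powr (1 / \<tau>)) powr \<tau>"
proof -
  let ?M = "real (card (lattice_box R :: (int^'n) set))"
  let ?G = "(\<Sum>x\<in>X. cmod (b x) powr (1 / \<tau>)) powr \<tau>"
  have row: "(\<Sum>x\<in>X. cmod (b x) * cmod (sq_kernel R \<alpha> (x - y))) \<le> ?M powr (1 - \<tau>) * ?G" for y :: "int^'n"
  proof -
    define S where "S = {x\<in>X. x - y \<in> lattice_box R}"
    have "(\<Sum>x\<in>X. cmod (b x) * cmod (sq_kernel R \<alpha> (x - y))) = (\<Sum>x\<in>S. cmod (b x))"
      by (rule sum.mono_neutral_cong_right) (use fin in \<open>auto simp: S_def sq_kernel_eq\<close>)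
    also have "\<dots> \<le> ?M powr (1 - \<tau>) * (\<Sum>x\<in>S. cmod (b x) powr (1 / \<tau>)) powr \<tau>"
    proof (rule sum_le_card_powr[OF \<tau>])
      have "card S \<le> card (lattice_box R :: (int^'n) set)"
        by (rule card_inj_on_le[where f="\<lambda>x. x - y"]) (auto simp: S_def inj_on_def)
      then show "real (card S) \<le> ?M" by simp
    qed (use fin in \<open>auto simp: S_def\<close>)
    also have "\<dots> \<le> ?M powr (1 - \<tau>) * ?G"
      using \<tau> fin by (intro mult_left_mono powr_mono2 sum_mono2) (auto simp: S_def intro: sum_nonneg)
    finally show ?thesis .
  qed
  have "cmod (\<Sum>x\<in>X. \<Sum>y\<in>Y. b x * (c x * sq_kernel R \<alpha> (x - y)) * a y)
      \<le> (\<Sum>x\<in>X. \<Sum>y\<in>Y. cmod (b x) * cmod (sq_kernel R \<alpha> (x - y)) * cmod (a y))"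
    by (intro sum_norm_le) (simp add: norm_mult c)
  also have "\<dots> = (\<Sum>y\<in>Y. \<Sum>x\<in>X. cmod (b x) * cmod (sq_kernel R \<alpha> (x - y)) * cmod (a y))" by (rule sum.swap)
  also have "\<dots> = (\<Sum>y\<in>Y. (\<Sum>x\<in>X. cmod (b x) * cmod (sq_kernel R \<alpha> (x - y))) * cmod (a y))"
    by (simp add: sum_distrib_right)
  also have "\<dots> \<le> (\<Sum>y\<in>Y. (?M powr (1 - \<tau>) * ?G) * cmod (a y))"
    by (intro sum_mono mult_right_mono row) auto
  also have "\<dots> = ?M powr (1 - \<tau>) * (\<Sum>y\<in>Y. cmod (a y)) * ?G"
    by (simp add: sum_distrib_left[symmetric])
  finally show ?thesis .
qed

text \<open>Here \<open>g\<close> is a dual weight and \<nu> the choice of radii. With w = 2 (1 - s)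
  the conditions 1 - s < t and t \<le> s say exactly that 0 < \<tau> \<le> 1, and W enters with the
  power (d/2) w = d (1 - s) = \<sigma>, which exceeds 2 by the upper bound on s.\<close>

lemma linearized_estimate:
  fixes s t :: real
  assumes d: "CARD('n::finite) \<ge> 5"
    and s: "1/2 < s" "s < 1 - 2 / real CARD('n)" and t: "1 - s < t" "t \<le> s"
  obtains C where "C > 0" "\<And>k (X :: (int^'n) set) Y f g \<nu>.
     \<lbrakk>finite X; finite Y; \<And>y. f y \<ge> 0; \<And>x. g x \<ge> 0;
      \<And>x. x \<in> X \<Longrightarrow> 4 ^ k \<le> \<nu> x \<and> \<nu> x < 4 * 4 ^ k\<rbrakk> \<Longrightarrow>
     (\<Sum>x\<in>X. g x * ((\<Sum>y\<in>{y\<in>Y. sqnorm (x - y) = \<nu> x}. f y) / real (card {y :: int^'n. sqnorm y = \<nu> x})))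
       \<le> C * (2 ^ k) powr (real CARD('n) * ((1 - t) - s))
           * (\<Sum>y\<in>Y. f y powr (1 / s)) powr s * (\<Sum>x\<in>X. g x powr (1 / t)) powr t"
proof -
  define D where "D = real CARD('n)"
  have D5: "D \<ge> 5" using d by (simp add: D_def)
  define w where "w = 2 * (1 - s)"
  have "2 / real CARD('n) > 0" using d by simp
  then have "s < 1" using s by linarith
  then have w: "0 < w" "w < 1" using s by (auto simp: w_def)
  have t0: "t > 0" using \<open>s < 1\<close> t by linarith
  define \<tau> where "\<tau> = (t - w / 2) / (1 - w)"
  have \<tau>: "0 < \<tau>" "\<tau> \<le> 1" using t w by (auto simp: \<tau>_def w_def field_simps)
  have sw: "s = 1 - w / 2" by (simp add: w_def field_simps)
  have tw: "t = (1 - w) * \<tau> + w / 2" using w by (simp add: \<tau>_def)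
  define \<sigma> where "\<sigma> = D * w / 2"
  have \<sigma>: "\<sigma> > 2" using s D5 by (simp add: \<sigma>_def w_def D_def field_simps)
  obtain C1 where C1: "C1 > 0" "\<And>R. R \<ge> 1 \<Longrightarrow> integral {0..1} (\<lambda>\<alpha>. weyl_weight R \<alpha> powr \<sigma>) \<le> C1 * real R powr (2 * \<sigma> - 2)"
    using weyl_weight_moment[OF \<sigma>] by blast
  obtain c where c: "c > 0" "\<And>n. n \<ge> 1 \<Longrightarrow> c * real_of_int n powr (D / 2 - 1) \<le> card {y :: int^'n. sqnorm y = n}"
    using card_sqnorm_ge[OF d] unfolding D_def by blast
  define C where "C = 6 powr (D * (1 - \<tau>) * (1 - w)) * (C1 * 2 powr (2 * \<sigma> - 2)) / c"
  have C0: "C > 0" using C1 c by (simp add: C_def)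
  have main: "(\<Sum>x\<in>X. g x * ((\<Sum>y\<in>{y\<in>Y. sqnorm (x - y) = \<nu> x}. f y) / real (card {y :: int^'n. sqnorm y = \<nu> x})))
       \<le> C * (2 ^ k) powr (D * ((1 - t) - s)) * (\<Sum>y\<in>Y. f y powr (1 / s)) powr s * (\<Sum>x\<in>X. g x powr (1 / t)) powr t"
    if fin: "finite X" "finite Y" and f0: "\<And>y. f y \<ge> 0" and g0: "\<And>x. g x \<ge> 0"
      and \<nu>: "\<And>x. x \<in> X \<Longrightarrow> 4 ^ k \<le> \<nu> x \<and> \<nu> x < 4 * 4 ^ k"
    for k :: nat and X Y :: "(int^'n) set" and f g \<nu>
  proof -
    define L where "L = (2::real) ^ k"
    have L1: "L \<ge> 1" by (simp add: L_def)
    \<comment> \<open>R^2 = 4 * 4^k, so the box contains every sphere that \<nu> can select.\<close>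
    define R :: nat where "R = 2 * 2 ^ k"
    have RL: "real R = 2 * L" by (simp add: R_def L_def)
    have R1: "R \<ge> 1" by (simp add: R_def)
    have "(2::int) ^ k * 2 ^ k = 4 ^ k" by (simp flip: power_mult_distrib)
    then have R2: "(int R)\<^sup>2 = 4 * 4 ^ k" by (simp add: R_def power2_eq_square)
    define N where "N x = real (card {y :: int^'n. sqnorm y = \<nu> x})" for x
    define c0 where "c0 = c * L powr (D - 2)"
    have c00: "c0 > 0" using c L1 by (simp add: c0_def)
    have Nc: "c0 \<le> N x" if x: "x \<in> X" for x
    proof -
      have "real_of_int (4 ^ k) \<le> real_of_int (\<nu> x)" using \<nu>[OF x] by linarith
      moreover have "L powr 2 = 4 ^ k" by (simp add: L_def power2_eq_square flip: power_mult_distrib)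
      ultimately have L2: "L powr 2 \<le> real_of_int (\<nu> x)" by simp
      have "1 \<le> (4::int) ^ k" by simp
      then have "\<nu> x \<ge> 1" using \<nu>[OF x] by linarith
      have "c0 = c * (L powr 2) powr (D / 2 - 1)" unfolding c0_def powr_powr by (simp add: algebra_simps)
      also have "\<dots> \<le> c * real_of_int (\<nu> x) powr (D / 2 - 1)"
        using c L2 D5 by (intro mult_left_mono powr_mono2) auto
      also have "\<dots> \<le> N x" unfolding N_def by (rule c(2)[OF \<open>\<nu> x \<ge> 1\<close>])
      finally show ?thesis .
    qed
    \<comment> \<open>The number of points on the sphere depends on x and cannot be pulled out of
      the sum. The weight c0 / N \<le> 1 makes the denominator constant and only decreases
      g.\<close>
    define g' where "g' x = (if x \<in> X then g x * (c0 / N x) else 0)" for x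
    have g': "0 \<le> g' x" "g' x \<le> g x" if "x \<in> X" for x
    proof -
      have "c0 / N x \<le> 1" "0 \<le> c0 / N x" using Nc[OF that] c00 by auto
      then show "0 \<le> g' x" "g' x \<le> g x" using g0[of x] that mult_left_mono[of "c0 / N x" 1 "g x"] mult_nonneg_nonneg[of "g x" "c0 / N x"] by (auto simp: g'_def)
    qed
    define S where "S = (\<Sum>y\<in>Y. f y powr (1 / s)) powr s"
    define G where "G = (\<Sum>x\<in>X. g x powr (1 / t)) powr t"
    define M where "M = real (card (lattice_box R :: (int^'n) set))"
    have M1: "M \<ge> 1" unfolding M_def card_lattice_box by simp
    define I where "I \<alpha> = (\<Sum>x\<in>X. \<Sum>y\<in>Y. complex_of_real (g' x) * (cis (- (2 * pi * \<alpha> * of_int (\<nu> x))) * sq_kernel R \<alpha> (x - y)) * complex_of_real (f y))" for \<alpha>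
    have bound: "cmod (I \<alpha>) \<le> M powr ((1 - \<tau>) * (1 - w)) * S * G * weyl_weight R \<alpha> powr \<sigma>" for \<alpha>
    proof -
      have W1: "weyl_weight R \<alpha> \<ge> 1" by (rule weyl_weight_ge_1)
      have "cmod (I \<alpha>) \<le> (M powr (1 - \<tau>)) powr (1 - w) * (weyl_weight R \<alpha> powr (D / 2)) powr w
          * (\<Sum>y\<in>Y. f y powr (1 / s)) powr s * (\<Sum>x\<in>X. g' x powr (1 / t)) powr t"
        unfolding I_def M_def D_def
        by (rule riesz_thorin_bilinear[where \<tau>=\<tau>, OF fin f0 g'(1) \<tau>(1) _ _ sw tw])
           (use w W1 M1 in \<open>auto simp: M_def intro!: sq_kernel_bilinear_l1[OF fin _ \<tau>] sq_kernel_bilinear_l2[OF fin]\<close>)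
      also have "\<dots> \<le> (M powr (1 - \<tau>)) powr (1 - w) * (weyl_weight R \<alpha> powr (D / 2)) powr w * S * G"
        unfolding S_def G_def using t0 g' by (intro mult_left_mono powr_mono2 sum_mono) (auto intro: sum_nonneg)
      also have "\<dots> = M powr ((1 - \<tau>) * (1 - w)) * S * G * weyl_weight R \<alpha> powr \<sigma>"
        by (simp add: powr_powr \<sigma>_def)
      finally show ?thesis .
    qed
    define E where "E = (\<Sum>x\<in>X. \<Sum>y\<in>Y. g' x * f y * (if sqnorm (x - y) = \<nu> x then 1 else 0))"
    have I_int: "(I has_integral (complex_of_real E)) {0..1}"
    proof -
      have one: "((\<lambda>\<alpha>. complex_of_real (g' x) * (cis (- (2 * pi * \<alpha> * of_int (\<nu> x))) * sq_kernel R \<alpha> (x - y)) * complex_of_real (f y))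
          has_integral (complex_of_real (g' x) * (if sqnorm (x - y) = \<nu> x then 1 else 0) * complex_of_real (f y))) {0..1}"
        if x: "x \<in> X" for x y
      proof (intro has_integral_mult_left has_integral_mult_right)
        show "((\<lambda>\<alpha>. cis (- (2 * pi * \<alpha> * of_int (\<nu> x))) * sq_kernel R \<alpha> (x - y)) has_integral (if sqnorm (x - y) = \<nu> x then 1 else 0)) {0..1}"
        proof (cases "x - y \<in> lattice_box R")
          case True
          have "cis (- (2 * pi * \<alpha> * of_int (\<nu> x))) * sq_kernel R \<alpha> (x - y) = cis (2 * pi * \<alpha> * of_int (sqnorm (x - y) - \<nu> x))" for \<alpha>
            using True by (simp add: sq_kernel_eq cis_mult algebra_simps)
          then show ?thesis using integral_cis_int[of "sqnorm (x - y) - \<nu> x"] by simp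
        next
          case False
          then have "sqnorm (x - y) \<noteq> \<nu> x" using sqnorm_in_lattice_box[of "x - y" R] \<nu>[OF x] R2 by auto
          then show ?thesis using False by (simp add: sq_kernel_eq)
        qed
      qed
      have "(I has_integral (\<Sum>x\<in>X. \<Sum>y\<in>Y. complex_of_real (g' x) * (if sqnorm (x - y) = \<nu> x then 1 else 0) * complex_of_real (f y))) {0..1}"
        unfolding I_def using fin by (intro has_integral_sum one) auto
      also have "(\<Sum>x\<in>X. \<Sum>y\<in>Y. complex_of_real (g' x) * (if sqnorm (x - y) = \<nu> x then 1 else 0) * complex_of_real (f y)) = complex_of_real E"
        unfolding E_def of_real_sum by (intro sum.cong refl) auto
      finally show ?thesis .
    qed
    have E_eq: "E = c0 * (\<Sum>x\<in>X. g x * ((\<Sum>y\<in>{y\<in>Y. sqnorm (x - y) = \<nu> x}. f y) / N x))"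
      unfolding E_def sum_distrib_left
    proof (rule sum.cong[OF refl])
      fix x assume x: "x \<in> X"
      have "(\<Sum>y\<in>Y. g' x * f y * (if sqnorm (x - y) = \<nu> x then 1 else 0)) = (\<Sum>y\<in>{y\<in>Y. sqnorm (x - y) = \<nu> x}. g' x * f y)"
        by (rule sum.mono_neutral_cong_right) (use fin in auto)
      also have "\<dots> = c0 * (g x * ((\<Sum>y\<in>{y\<in>Y. sqnorm (x - y) = \<nu> x}. f y) / N x))"
        unfolding sum_distrib_left[symmetric] using x by (simp add: g'_def)
      finally show "(\<Sum>y\<in>Y. g' x * f y * (if sqnorm (x - y) = \<nu> x then 1 else 0)) = c0 * (g x * ((\<Sum>y\<in>{y\<in>Y. sqnorm (x - y) = \<nu> x}. f y) / N x))" .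
    qed
    define B where "B = M powr ((1 - \<tau>) * (1 - w)) * S * G"
    have B0: "B \<ge> 0" by (simp add: B_def S_def G_def)
    have Wint: "(\<lambda>\<alpha>. weyl_weight R \<alpha> powr \<sigma>) integrable_on {0..1}"
      by (intro integrable_continuous_interval continuous_on_powr continuous_weyl_weight continuous_on_const)
         (use weyl_weight_ge_1 in \<open>smt (verit)\<close>)
    have "cmod (integral {0..1} I) \<le> integral {0..1} (\<lambda>\<alpha>. B * weyl_weight R \<alpha> powr \<sigma>)"
      using I_int Wint bound by (intro integral_norm_bound_integral) (auto simp: B_def intro: integrable_on_mult_right)
    also have "\<dots> = B * integral {0..1} (\<lambda>\<alpha>. weyl_weight R \<alpha> powr \<sigma>)" by simp
    also have "\<dots> \<le> B * (C1 * real R powr (2 * \<sigma> - 2))" by (intro mult_left_mono C1 R1 B0)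
    finally have "cmod (complex_of_real E) \<le> B * (C1 * real R powr (2 * \<sigma> - 2))" using I_int by (simp add: integral_unique)
    then have "E \<le> B * (C1 * real R powr (2 * \<sigma> - 2))" by simp
    also have "\<dots> \<le> (6 * L) powr (D * (1 - \<tau>) * (1 - w)) * S * G * (C1 * (2 * L) powr (2 * \<sigma> - 2))"
    proof -
      have "M = (2 * real R + 1) ^ CARD('n)" unfolding M_def card_lattice_box by (simp add: add.commute)
      also have "\<dots> \<le> (6 * L) ^ CARD('n)" using RL L1 by (intro power_mono) auto
      also have "\<dots> = (6 * L) powr D" using L1 by (simp add: D_def powr_realpow)
      finally have "M powr ((1 - \<tau>) * (1 - w)) \<le> ((6 * L) powr D) powr ((1 - \<tau>) * (1 - w))"
        using M1 \<tau> w by (intro powr_mono2) auto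
      then have "M powr ((1 - \<tau>) * (1 - w)) \<le> (6 * L) powr (D * (1 - \<tau>) * (1 - w))" by (simp add: powr_powr mult.assoc)
      then show ?thesis unfolding B_def RL using C1 by (intro mult_right_mono) (auto simp: S_def G_def)
    qed
    also have "\<dots> = 6 powr (D * (1 - \<tau>) * (1 - w)) * (C1 * 2 powr (2 * \<sigma> - 2)) * (L powr (D * (1 - \<tau>) * (1 - w)) * L powr (2 * \<sigma> - 2)) * S * G"
      by (simp only: powr_mult mult_ac)
    \<comment> \<open>Box volume and moment together leave L^(D - 2), which the sphere count
      \<open>c0\<close> cancels, times the claimed power.\<close>
    also have "L powr (D * (1 - \<tau>) * (1 - w)) * L powr (2 * \<sigma> - 2) = L powr (D - 2) * L powr (D * ((1 - t) - s))"
    proof -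
      have "D * (1 - \<tau>) * (1 - w) + (2 * \<sigma> - 2) = (D - 2) + D * ((1 - t) - s)"
        unfolding \<sigma>_def tw sw by (simp add: algebra_simps)
      then show ?thesis by (simp only: powr_add[symmetric])
    qed
    finally have "E \<le> c0 * (C * L powr (D * ((1 - t) - s)) * S * G)"
      using c by (simp add: C_def c0_def mult_ac)
    then have "(\<Sum>x\<in>X. g x * ((\<Sum>y\<in>{y\<in>Y. sqnorm (x - y) = \<nu> x}. f y) / N x)) \<le> C * L powr (D * ((1 - t) - s)) * S * G"
      unfolding E_eq using c00 by simp
    then show ?thesis by (simp add: N_def L_def S_def G_def)
  qed
  show ?thesis using that[OF C0] main unfolding D_def by blast
qed

section \<open>Dyadic maximal averages\<close>

text \<open>Indexed by the squared radius, and generic in the field so that it serves both f and its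
  absolute value.\<close>

definition lattice_avg :: "int \<Rightarrow> (int^'n \<Rightarrow> 'b::real_normed_field) \<Rightarrow> int^'n \<Rightarrow> 'b" where
  "lattice_avg n f x = (\<Sum>y | sqnorm y = n. f (x - y)) / of_nat (card {y :: int^'n. sqnorm y = n})"

lemma sphere_pts_eq:
  assumes "lam > 0" "lam\<^sup>2 = of_int n"
  shows "(sphere_pts lam :: (int^'n::finite) set) = {y. sqnorm y = n}"
proof -
  have "sqrt (real_of_int (sqnorm y)) = lam \<longleftrightarrow> sqnorm y = n" for y :: "int^'n"
  proof
    assume "sqrt (real_of_int (sqnorm y)) = lam"
    then have "(sqrt (real_of_int (sqnorm y)))\<^sup>2 = of_int n" using assms by simp
    moreover have "0 \<le> sqnorm y" by (simp add: sqnorm_def sum_nonneg)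
    ultimately show "sqnorm y = n" by simp
  next
    assume "sqnorm y = n"
    then show "sqrt (real_of_int (sqnorm y)) = lam" using assms by (metis less_imp_le real_sqrt_unique)
  qed
  then show ?thesis by (auto simp: sphere_pts_def)
qed

lemma dyadic_radii_eq:
  "{lam \<in> Lambda_tilde. 2 ^ k \<le> lam \<and> lam < 2 * 2 ^ k} = (\<lambda>n. sqrt (of_int n)) ` {4 ^ k..<4 * 4 ^ k}"
proof (intro equalityI subsetI)
  have sq: "((2::real) ^ k)\<^sup>2 = 4 ^ k" by (simp add: power2_eq_square flip: power_mult_distrib)
  fix lam :: real
  {
    assume "lam \<in> {lam \<in> Lambda_tilde. 2 ^ k \<le> lam \<and> lam < 2 * 2 ^ k}"
    then have l: "lam > 0" "lam\<^sup>2 \<in> \<int>" "2 ^ k \<le> lam" "lam < 2 * 2 ^ k" by (auto simp: Lambda_tilde_def)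
    then obtain n where n: "lam\<^sup>2 = of_int n" by (auto elim: Ints_cases)
    have "(2 ^ k)\<^sup>2 \<le> lam\<^sup>2" using l by (intro power_mono) auto
    then have "real_of_int (4 ^ k) \<le> of_int n" using n sq by simp
    moreover have "lam\<^sup>2 < (2 * 2 ^ k)\<^sup>2" using l by (intro power_strict_mono) auto
    then have "of_int n < real_of_int (4 * 4 ^ k)" using n sq by (simp add: power_mult_distrib)
    ultimately have "n \<in> {4 ^ k..<4 * 4 ^ k}" by (simp only: of_int_le_iff of_int_less_iff atLeastLessThan_iff simp_thms)
    moreover have "lam = sqrt (of_int n)" using n l by (metis less_imp_le real_sqrt_unique)
    ultimately show "lam \<in> (\<lambda>n. sqrt (of_int n)) ` {4 ^ k..<4 * 4 ^ k}" by blast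
  }
  {
    assume "lam \<in> (\<lambda>n. sqrt (of_int n)) ` {4 ^ k..<4 * 4 ^ k}"
    then obtain n where n: "4 ^ k \<le> n" "n < 4 * 4 ^ k" "lam = sqrt (of_int n)" by auto
    have n': "(4::real) ^ k \<le> of_int n" "of_int n < 4 * (4::real) ^ k"
      using of_int_le_iff[of "4 ^ k" n, where 'a=real] of_int_less_iff[of n "4 * 4 ^ k", where 'a=real] n by auto
    have "(1::real) \<le> 4 ^ k" by simp
    then have n1: "real_of_int n \<ge> 1" using n' by linarith
    have "2 ^ k \<le> lam" unfolding n using n' sq by (intro real_le_rsqrt) simp
    moreover have "lam < 2 * 2 ^ k" unfolding n using n' sq by (intro real_less_lsqrt) (auto simp: power_mult_distrib)
    ultimately show "lam \<in> {lam \<in> Lambda_tilde. 2 ^ k \<le> lam \<and> lam < 2 * 2 ^ k}"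
      using n n1 by (auto simp: Lambda_tilde_def)
  }
qed

lemma dyad_max_eq:
  fixes f :: "int^'n::finite \<Rightarrow> complex"
  shows "dyad_max (2 ^ k) f x = (SUP n\<in>{4 ^ k..<4 * 4 ^ k}. ennreal (cmod (lattice_avg n f x)))"
proof -
  have "ennreal (cmod (sph_avg (sqrt (of_int n)) f x)) = ennreal (cmod (lattice_avg n f x))" if "n \<in> {4 ^ k..<4 * 4 ^ k}" for n
  proof -
    have "(1::int) \<le> 4 ^ k" by simp
    then have "n \<ge> 1" using that by (meson atLeastLessThan_iff order_trans)
    then have "(sphere_pts (sqrt (of_int n)) :: (int^'n) set) = {y. sqnorm y = n}" by (intro sphere_pts_eq) auto
    then show ?thesis by (simp add: sph_avg_def lattice_avg_def)
  qed
  then show ?thesis unfolding dyad_max_def dyadic_radii_eq image_image by (intro SUP_cong) auto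
qed

lemma norm_lattice_avg_le: "norm (lattice_avg n f x) \<le> lattice_avg n (\<lambda>y. norm (f y)) x"
  unfolding lattice_avg_def by (auto simp: norm_divide intro!: divide_right_mono norm_sum)

text \<open>A dyadic shell has finitely many squared radii, so the supremum is a maximum; the
  maximiser as a function of x becomes \<nu>.\<close>

lemma dyad_max_attained:
  fixes f :: "int^'n::finite \<Rightarrow> complex"
  obtains n where "4 ^ k \<le> n" "n < 4 * 4 ^ k" "dyad_max (2 ^ k) f x = ennreal (cmod (lattice_avg n f x))"
proof -
  let ?A = "(\<lambda>n. ennreal (cmod (lattice_avg n f x))) ` {4 ^ k..<4 * 4 ^ k}"
  have ne: "?A \<noteq> {}" by simp
  have "Sup ?A = Max ?A" using ne by (intro Max_Sup[symmetric]) auto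
  moreover have "Max ?A \<in> ?A" using ne by (intro Max_in) auto
  ultimately have "Sup ?A \<in> ?A" by simp
  then obtain n where "n \<in> {4 ^ k..<4 * 4 ^ k}" "Sup ?A = ennreal (cmod (lattice_avg n f x))" by blast
  then show ?thesis using that[of n] unfolding dyad_max_eq by simp
qed

lemma lattice_avg_power_mean:
  fixes F :: "int^'n::finite \<Rightarrow> real"
  assumes a: "a \<ge> 1" and F: "\<And>y. F y \<ge> 0"
  shows "lattice_avg n F x \<le> lattice_avg n (\<lambda>y. F y powr a) x powr (1 / a)"
proof -
  define N where "N = real (card {y :: int^'n. sqnorm y = n})"
  show ?thesis
  proof (cases "N = 0")
    case True then show ?thesis by (simp add: lattice_avg_def N_def)
  next
    case False
    then have N: "N > 0" by (simp add: N_def)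
    have "(\<Sum>y | sqnorm y = n. F (x - y)) \<le> N powr (1 - 1 / a) * (\<Sum>y | sqnorm y = n. F (x - y) powr (1 / (1 / a))) powr (1 / a)"
      unfolding N_def using a F by (intro sum_le_card_powr finite_sqnorm) auto
    also have "\<dots> = N * ((\<Sum>y | sqnorm y = n. F (x - y) powr a) / N) powr (1 / a)"
      using N by (simp add: powr_diff powr_divide)
    finally show ?thesis using N by (simp add: lattice_avg_def N_def[symmetric] field_simps)
  qed
qed

text \<open>Jensen's inequality for averages moves an estimate at \<open>(a s, a (1 - t))\<close> to \<open>(s, 1 - t)\<close> for \<open>a \<ge> 1\<close>.\<close>
lemma finite_dyadic_estimate:
  fixes s t :: real
  assumes d: "CARD('n::finite) \<ge> 5"
    and s: "s < 1 - 2 / real CARD('n)" and t: "1 - t < s" "2 * s < (real CARD('n) - 2) * (1 - t)"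
  obtains C where "C > 0" "\<And>k (X :: (int^'n) set) Y F \<nu>.
     \<lbrakk>finite X; finite Y; \<And>y. F y \<ge> 0;
      \<And>x. x \<in> X \<Longrightarrow> 4 ^ k \<le> \<nu> x \<and> \<nu> x < 4 * 4 ^ k;
      \<And>x y. x \<in> X \<Longrightarrow> sqnorm y = \<nu> x \<Longrightarrow> x - y \<in> Y\<rbrakk> \<Longrightarrow>
     (\<Sum>x\<in>X. lattice_avg (\<nu> x) F x powr (1 / (1 - t))) powr (1 - t)
       \<le> C * (2 ^ k) powr (real CARD('n) * ((1 - t) - s)) * (\<Sum>y\<in>Y. F y powr (1 / s)) powr s"
proof -
  define D where "D = real CARD('n)"
  have D5: "D \<ge> 5" using d by (simp add: D_def)
  define u where "u = 1 - t"
  have us: "u < s" "2 * s < (D - 2) * u" "s < 1 - 2 / D" using s t by (auto simp: u_def D_def)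
  have u0: "u > 0"
  proof -
    have "2 * u < (D - 2) * u" using us by linarith
    then have "0 < (D - 4) * u" by (simp add: algebra_simps)
    then show ?thesis using D5 by (simp add: zero_less_mult_iff)
  qed
  have s0: "s > 0" using us u0 by linarith
  \<comment> \<open>The least a \<ge> 1 with a s + a u \<ge> 1, which is the condition t \<le> s of
    \<open>linearized_estimate\<close> at the scaled exponents. Together with u < s it forces a s >
    1/2, and 2 s < (D - 2) u keeps a s below 1 - 2 / D.\<close>
  define a where "a = max 1 (1 / (s + u))"
  have a1: "a \<ge> 1" by (simp add: a_def)
  have asu: "a * (s + u) \<ge> 1"
  proof -
    have "1 / (s + u) * (s + u) \<le> a * (s + u)" using s0 u0 by (intro mult_right_mono) (auto simp: a_def)
    then show ?thesis using s0 u0 by simp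
  qed
  have aus: "a * u < a * s" using us a1 by simp
  have as_lt: "a * s < 1 - 2 / D"
  proof (cases "s + u \<ge> 1")
    case True
    then have "1 / (s + u) \<le> 1" by simp
    then have "a = 1" by (simp add: a_def max_def)
    then show ?thesis using us by simp
  next
    case False
    then have "1 \<le> 1 / (s + u)" using s0 u0 by simp
    then have "a = 1 / (s + u)" by (simp add: a_def max_def)
    moreover have "s < (1 - 2 / D) * (s + u)" using us D5 by (simp add: field_simps)
    then have "s / (s + u) < 1 - 2 / D" using s0 u0 by (simp only: pos_divide_less_eq add_pos_pos)
    ultimately show ?thesis by simp
  qed
  have "a * s < 1" using as_lt D5 by (smt (verit) divide_nonneg_nonneg)
  define u' where "u' = a * u"
  have "a * u < 1" using aus \<open>a * s < 1\<close> by (rule less_trans)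
  then have u': "0 < u'" "u' < 1" using u0 a1 by (auto simp: u'_def)
  obtain C0 where C0: "C0 > 0" and est: "\<And>k (X :: (int^'n) set) Y f g \<nu>.
     \<lbrakk>finite X; finite Y; \<And>y. f y \<ge> 0; \<And>x. g x \<ge> 0;
      \<And>x. x \<in> X \<Longrightarrow> 4 ^ k \<le> \<nu> x \<and> \<nu> x < 4 * 4 ^ k\<rbrakk> \<Longrightarrow>
     (\<Sum>x\<in>X. g x * ((\<Sum>y\<in>{y\<in>Y. sqnorm (x - y) = \<nu> x}. f y) / real (card {y :: int^'n. sqnorm y = \<nu> x})))
       \<le> C0 * (2 ^ k) powr (D * ((1 - (1 - u')) - a * s))
           * (\<Sum>y\<in>Y. f y powr (1 / (a * s))) powr (a * s) * (\<Sum>x\<in>X. g x powr (1 / (1 - u'))) powr (1 - u')"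
    by (rule linearized_estimate[OF d, of "a * s" "1 - u'"])
       (use asu aus as_lt in \<open>auto simp: u'_def D_def algebra_simps\<close>)
  define C where "C = C0 powr (1 / a)"
  have main: "(\<Sum>x\<in>X. lattice_avg (\<nu> x) F x powr (1 / u)) powr u
       \<le> C * (2 ^ k) powr (D * (u - s)) * (\<Sum>y\<in>Y. F y powr (1 / s)) powr s"
    if fin: "finite X" "finite Y" and F: "\<And>y. F y \<ge> 0"
      and \<nu>: "\<And>x. x \<in> X \<Longrightarrow> 4 ^ k \<le> \<nu> x \<and> \<nu> x < 4 * 4 ^ k"
      and XY: "\<And>x y. x \<in> X \<Longrightarrow> sqnorm y = \<nu> x \<Longrightarrow> x - y \<in> Y"
    for k :: nat and X Y :: "(int^'n) set" and F \<nu>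
  proof -
    define h where "h y = F y powr a" for y
    define m where "m x = lattice_avg (\<nu> x) h x" for x
    have m0: "m x \<ge> 0" for x unfolding m_def lattice_avg_def by (auto simp: h_def intro!: divide_nonneg_nonneg sum_nonneg)
    have m_eq: "m x = (\<Sum>y\<in>{y\<in>Y. sqnorm (x - y) = \<nu> x}. h y) / real (card {y :: int^'n. sqnorm y = \<nu> x})" if x: "x \<in> X" for x
    proof -
      have "(\<Sum>y | sqnorm y = \<nu> x. h (x - y)) = (\<Sum>y\<in>{y\<in>Y. sqnorm (x - y) = \<nu> x}. h y)"
        by (rule sum.reindex_bij_witness[where i="\<lambda>y. x - y" and j="\<lambda>y. x - y"]) (use XY x in auto)
      then show ?thesis by (simp add: m_def lattice_avg_def)
    qed
    define S where "S = (\<Sum>x\<in>X. m x powr (1 / u'))"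
    define P where "P = (\<Sum>y\<in>Y. F y powr (1 / s))"
    have P_eq: "(\<Sum>y\<in>Y. h y powr (1 / (a * s))) = P" using a1 by (simp add: P_def h_def powr_powr)
    have S0: "S \<ge> 0" by (simp add: S_def sum_nonneg)
    have P0: "P \<ge> 0" by (simp add: P_def sum_nonneg)
    \<comment> \<open>The extremal dual weight: it makes the pairing equal to S and the norm of g a
      power of S. As S is a finite sum, that power can be cancelled, which undoes the
      duality.\<close>
    define g where "g x = m x powr (1 / u' - 1)" for x
    have "(\<Sum>x\<in>X. g x * ((\<Sum>y\<in>{y\<in>Y. sqnorm (x - y) = \<nu> x}. h y) / real (card {y :: int^'n. sqnorm y = \<nu> x}))) = S"
      unfolding S_def
    proof (rule sum.cong[OF refl])
      fix x assume x: "x \<in> X"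
      have "g x * m x = m x powr (1 / u')"
      proof (cases "m x = 0")
        case False
        then have "m x > 0" using m0[of x] by simp
        then have "m x powr (1 / u' - 1) * m x powr 1 = m x powr (1 / u')" by (simp only: powr_add[symmetric]) simp
        then show ?thesis using \<open>m x > 0\<close> by (simp add: g_def)
      qed simp
      then show "g x * ((\<Sum>y\<in>{y\<in>Y. sqnorm (x - y) = \<nu> x}. h y) / real (card {y :: int^'n. sqnorm y = \<nu> x})) = m x powr (1 / u')"
        using m_eq[OF x] by simp
    qed
    moreover have "(\<Sum>x\<in>X. g x powr (1 / (1 - u'))) = S"
    proof -
      have "(1 / u' - 1) * (1 / (1 - u')) = 1 / u'" using u' by (simp add: field_simps)
      then show ?thesis by (simp add: g_def S_def powr_powr)
    qed
    ultimately have le: "S \<le> C0 * (2 ^ k) powr (D * (u' - a * s)) * P powr (a * s) * S powr (1 - u')"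
      using est[OF fin, of h g k \<nu>] \<nu> P_eq by (simp add: h_def g_def)
    have "S powr u' \<le> C0 * (2 ^ k) powr (D * (u' - a * s)) * P powr (a * s)"
    proof (cases "S = 0")
      case True then show ?thesis using C0 by simp
    next
      case False
      then have "S > 0" using S0 by simp
      then have "S powr u' * S powr (1 - u') = S" by (simp flip: powr_add)
      then have "S powr u' * S powr (1 - u') \<le> C0 * (2 ^ k) powr (D * (u' - a * s)) * P powr (a * s) * S powr (1 - u')" using le by simp
      then show ?thesis using \<open>S > 0\<close> by simp
    qed
    then have "(S powr u') powr (1 / a) \<le> (C0 * (2 ^ k) powr (D * (u' - a * s)) * P powr (a * s)) powr (1 / a)"
      using a1 by (intro powr_mono2) auto
    also have "\<dots> = C * (2 ^ k) powr (D * (u - s)) * P powr s"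
    proof -
      have "D * (u' - a * s) * (1 / a) = D * (u - s)" "a * s * (1 / a) = s"
        using a1 by (auto simp: u'_def field_simps)
      then show ?thesis by (simp only: powr_mult powr_powr C_def)
    qed
    finally have fin1: "S powr u \<le> C * (2 ^ k) powr (D * (u - s)) * P powr s"
      using a1 by (simp add: powr_powr u'_def)
    have "(\<Sum>x\<in>X. lattice_avg (\<nu> x) F x powr (1 / u)) \<le> S"
      unfolding S_def
    proof (rule sum_mono)
      fix x assume "x \<in> X"
      have "0 \<le> lattice_avg (\<nu> x) F x" unfolding lattice_avg_def by (auto intro!: divide_nonneg_nonneg sum_nonneg F)
      then have "lattice_avg (\<nu> x) F x powr (1 / u) \<le> (m x powr (1 / a)) powr (1 / u)"
        using lattice_avg_power_mean[OF a1 F, where n="\<nu> x" and x=x] u0 unfolding m_def h_def by (intro powr_mono2) auto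
      then show "lattice_avg (\<nu> x) F x powr (1 / u) \<le> m x powr (1 / u')" by (simp add: powr_powr u'_def)
    qed
    then have "(\<Sum>x\<in>X. lattice_avg (\<nu> x) F x powr (1 / u)) powr u \<le> S powr u"
      using u0 by (intro powr_mono2) (auto intro: sum_nonneg)
    then show ?thesis using fin1 by (simp add: P_def)
  qed
  have "C > 0" using C0 by (simp add: C_def)
  then show ?thesis
  proof (rule that)
    fix k and X Y :: "(int^'n) set" and F :: "int^'n \<Rightarrow> real" and \<nu> :: "int^'n \<Rightarrow> int"
    assume "finite X" "finite Y" "\<And>y. F y \<ge> 0" "\<And>x. x \<in> X \<Longrightarrow> 4 ^ k \<le> \<nu> x \<and> \<nu> x < 4 * 4 ^ k"
      "\<And>x y. x \<in> X \<Longrightarrow> sqnorm y = \<nu> x \<Longrightarrow> x - y \<in> Y"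
    from main[OF this] show "(\<Sum>x\<in>X. lattice_avg (\<nu> x) F x powr (1 / (1 - t))) powr (1 - t)
       \<le> C * (2 ^ k) powr (real CARD('n) * ((1 - t) - s)) * (\<Sum>y\<in>Y. F y powr (1 / s)) powr s"
      unfolding D_def u_def .
  qed
qed

section \<open>Norms, sufficiency and necessity\<close>

lemma enn_pow_ennreal: "u \<ge> 0 \<Longrightarrow> enn_pow (ennreal u) p = ennreal (u powr p)"
  by (simp add: enn_pow_def)

lemma enn_pow_mono:
  assumes "x \<le> y" "p \<ge> 0"
  shows "enn_pow x p \<le> enn_pow y p"
proof (cases "y = top")
  case False
  then have "x \<noteq> top" using assms by (auto simp: top_unique)
  then show ?thesis using assms False
    by (auto simp: enn_pow_def less_top intro!: ennreal_leI powr_mono2 enn2real_mono)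
qed (simp add: enn_pow_def)

text \<open>On a countable type the integral is a series whose partial sums run over finite sets, so
  a bound uniform in finite sets passes to the whole lattice.\<close>

lemma nn_integral_count_space_le:
  fixes g :: "'a::countable \<Rightarrow> ennreal"
  assumes "\<And>X. finite X \<Longrightarrow> (\<Sum>x\<in>X. g x) \<le> B"
  shows "(\<integral>\<^sup>+ x. g x \<partial>count_space UNIV) \<le> B"
proof -
  let ?R = "range (to_nat :: 'a \<Rightarrow> nat)"
  have "bij_betw (from_nat :: nat \<Rightarrow> 'a) ?R UNIV"
    by (rule bij_betw_byWitness[where f'=to_nat]) auto
  then have "(\<integral>\<^sup>+ x. g x \<partial>count_space UNIV) = (\<integral>\<^sup>+ n. g (from_nat n) \<partial>count_space ?R)"
    by (rule nn_integral_bij_count_space[symmetric])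
  also have "\<dots> = (\<integral>\<^sup>+ n. g (from_nat n) * indicator ?R n \<partial>count_space UNIV)"
    by (rule nn_integral_count_space_indicator) simp
  also have "\<dots> = (\<Sum>n. g (from_nat n) * indicator ?R n)" by (rule nn_integral_count_space_nat)
  also have "\<dots> \<le> B"
  proof (rule suminf_le_const)
    fix n
    have "(\<Sum>i<n. g (from_nat i) * indicator ?R i) = (\<Sum>i\<in>{..<n} \<inter> ?R. g (from_nat i))"
      by (rule sum.mono_neutral_cong_right) (auto simp: indicator_def)
    also have "\<dots> = (\<Sum>x\<in>from_nat ` ({..<n} \<inter> ?R). g x)"
      by (subst sum.reindex) (auto simp: inj_on_def)
    also have "\<dots> \<le> B" by (intro assms) auto
    finally show "(\<Sum>i<n. g (from_nat i) * indicator ?R i) \<le> B" .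
  qed simp
  finally show ?thesis .
qed

lemma sum_le_nn_integral_count_space:
  assumes "finite X"
  shows "(\<Sum>x\<in>X. g x) \<le> (\<integral>\<^sup>+ x. g x \<partial>count_space UNIV)"
proof -
  have "(\<Sum>x\<in>X. g x) = (\<integral>\<^sup>+ x. g x \<partial>count_space X)" using assms by (simp add: nn_integral_count_space_finite)
  also have "\<dots> = (\<integral>\<^sup>+ x. g x * indicator X x \<partial>count_space UNIV)" by (rule nn_integral_count_space_indicator) simp
  also have "\<dots> \<le> (\<integral>\<^sup>+ x. g x \<partial>count_space UNIV)" by (intro nn_integral_mono) (auto simp: indicator_def)
  finally show ?thesis .
qed

lemma lp_norm_mono:
  assumes "\<And>x. g x \<le> h x" "s \<ge> 0"
  shows "lp_norm s g \<le> lp_norm s h"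
  unfolding lp_norm_def using assms by (auto intro!: SUP_mono' enn_pow_mono nn_integral_mono)

lemma lp_norm_le:
  fixes u :: "'a::countable \<Rightarrow> real"
  assumes s: "s > 0" and u: "\<And>x. u x \<ge> 0" and B: "B \<ge> 0"
    and le: "\<And>X. finite X \<Longrightarrow> (\<Sum>x\<in>X. u x powr (1 / s)) powr s \<le> B"
  shows "lp_norm s (\<lambda>x. ennreal (u x)) \<le> ennreal B"
proof -
  have "(\<integral>\<^sup>+ x. enn_pow (ennreal (u x)) (1 / s) \<partial>count_space UNIV) \<le> ennreal (B powr (1 / s))"
  proof (rule nn_integral_count_space_le)
    fix X :: "'a set" assume X: "finite X"
    have "(\<Sum>x\<in>X. u x powr (1 / s)) = ((\<Sum>x\<in>X. u x powr (1 / s)) powr s) powr (1 / s)"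
      using s by (simp add: powr_powr sum_nonneg)
    also have "\<dots> \<le> B powr (1 / s)" using s le[OF X] by (intro powr_mono2) auto
    finally show "(\<Sum>x\<in>X. enn_pow (ennreal (u x)) (1 / s)) \<le> ennreal (B powr (1 / s))"
      using u by (simp add: enn_pow_ennreal sum_ennreal ennreal_leI)
  qed
  then have "lp_norm s (\<lambda>x. ennreal (u x)) \<le> enn_pow (ennreal (B powr (1 / s))) s"
    unfolding lp_norm_def using s by (simp add: enn_pow_mono)
  also have "\<dots> = ennreal B" using s B by (simp add: enn_pow_ennreal powr_powr)
  finally show ?thesis .
qed

text \<open>Turns finiteness of the norm into one real bound for all finite sums, the form in which
  the estimate has been proved.\<close>

lemma lp_norm_finite_sums:
  assumes s: "s > 0" and u: "\<And>x. u x \<ge> 0" and fin: "lp_norm s (\<lambda>x. ennreal (u x)) < \<infinity>"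
  obtains P where "P \<ge> 0" "lp_norm s (\<lambda>x. ennreal (u x)) = ennreal (P powr s)"
    "\<And>X. finite X \<Longrightarrow> (\<Sum>x\<in>X. u x powr (1 / s)) \<le> P"
proof -
  define I where "I = (\<integral>\<^sup>+ x. enn_pow (ennreal (u x)) (1 / s) \<partial>count_space UNIV)"
  have lp: "lp_norm s (\<lambda>x. ennreal (u x)) = enn_pow I s" using s by (simp add: lp_norm_def I_def)
  have "I \<noteq> top" using fin unfolding lp by (auto simp: enn_pow_def)
  then obtain P where P: "P \<ge> 0" "I = ennreal P" by (cases I) auto
  show ?thesis
  proof (rule that[OF P(1)])
    show "lp_norm s (\<lambda>x. ennreal (u x)) = ennreal (P powr s)" unfolding lp P(2) by (rule enn_pow_ennreal[OF P(1)])
    fix X :: "'a set" assume X: "finite X"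
    have "ennreal (\<Sum>x\<in>X. u x powr (1 / s)) = (\<Sum>x\<in>X. enn_pow (ennreal (u x)) (1 / s))"
      using u by (simp add: enn_pow_ennreal sum_ennreal)
    also have "\<dots> \<le> ennreal P" unfolding P(2)[symmetric] I_def by (rule sum_le_nn_integral_count_space[OF X])
    finally show "(\<Sum>x\<in>X. u x powr (1 / s)) \<le> P" using P by simp
  qed
qed

text \<open>Hoelder on a finite set, read as a lower bound for the norm. Both test functions for
  necessity use it to bound the maximal function from below.\<close>

lemma sum_le_lp_norm:
  assumes s: "0 \<le> s" "s \<le> 1" and X: "finite X" and u: "\<And>x. u x \<ge> 0"
    and M: "real (card X) \<le> M"
  shows "ennreal (\<Sum>x\<in>X. u x) \<le> ennreal (M powr (1 - s)) * lp_norm s (\<lambda>x. ennreal (u x))"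
proof (cases "s = 0")
  case True
  have "ennreal (\<Sum>x\<in>X. u x) = (\<Sum>x\<in>X. ennreal (u x))" using u by (simp add: sum_ennreal)
  also have "\<dots> \<le> (\<Sum>x\<in>X. (SUP x. ennreal (u x)))" by (intro sum_mono SUP_upper) auto
  also have "\<dots> = of_nat (card X) * (SUP x. ennreal (u x))" by simp
  also have "\<dots> \<le> ennreal M * (SUP x. ennreal (u x))"
    using M by (intro mult_right_mono) (auto simp: ennreal_of_nat_eq_real_of_nat intro: ennreal_leI)
  finally show ?thesis using True M by (simp add: lp_norm_def)
next
  case False
  then have s0: "s > 0" using s by simp
  define T where "T = (\<Sum>x\<in>X. u x powr (1 / s))"
  have T0: "T \<ge> 0" by (simp add: T_def sum_nonneg)
  have "(\<Sum>x\<in>X. u x) \<le> M powr (1 - s) * T powr s"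
    unfolding T_def using s0 s X u M by (intro sum_le_card_powr) auto
  then have "ennreal (\<Sum>x\<in>X. u x) \<le> ennreal (M powr (1 - s)) * ennreal (T powr s)"
    by (simp add: ennreal_leI flip: ennreal_mult')
  also have "\<dots> \<le> ennreal (M powr (1 - s)) * lp_norm s (\<lambda>x. ennreal (u x))"
  proof (rule mult_left_mono)
    have "ennreal T = (\<Sum>x\<in>X. enn_pow (ennreal (u x)) (1 / s))"
      using u by (simp add: T_def enn_pow_ennreal sum_ennreal)
    also have "\<dots> \<le> (\<integral>\<^sup>+ x. enn_pow (ennreal (u x)) (1 / s) \<partial>count_space UNIV)"
      by (rule sum_le_nn_integral_count_space[OF X])
    finally have "enn_pow (ennreal T) s \<le> lp_norm s (\<lambda>x. ennreal (u x))"
      unfolding lp_norm_def using s0 by (simp add: enn_pow_mono)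
    then show "ennreal (T powr s) \<le> lp_norm s (\<lambda>x. ennreal (u x))" by (simp add: enn_pow_ennreal T0)
  qed simp
  finally show ?thesis .
qed

lemma lp_norm_indicator_le:
  fixes S :: "'a::countable set"
  assumes s: "0 \<le> s" and S: "finite S" "S \<noteq> {}"
  shows "lp_norm s (\<lambda>x. ennreal (cmod (if x \<in> S then 1 else 0))) \<le> ennreal (real (card S) powr s)"
proof (cases "s = 0")
  case True
  have "(SUP x. ennreal (cmod (if x \<in> S then 1 else 0))) \<le> 1" by (intro SUP_least) auto
  then show ?thesis using True S by (simp add: lp_norm_def)
next
  case False
  then have s0: "s > 0" using s by simp
  show ?thesis
  proof (rule lp_norm_le[OF s0])
    fix X :: "'a set" assume X: "finite X"
    have "(\<Sum>x\<in>X. cmod (if x \<in> S then 1 else 0) powr (1 / s)) = (\<Sum>x\<in>X \<inter> S. 1)"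
      by (rule sum.mono_neutral_cong_right) (use X in auto)
    also have "\<dots> \<le> real (card S)" using S by (simp add: card_mono)
    finally show "(\<Sum>x\<in>X. cmod (if x \<in> S then 1 else 0) powr (1 / s)) powr s \<le> real (card S) powr s"
      using s by (intro powr_mono2) (auto intro: sum_nonneg)
  qed auto
qed

lemma dyadic_powr_bounded_imp_nonpos:
  fixes e B :: real
  assumes "\<And>k::nat. (2 ^ k) powr e \<le> B"
  shows "e \<le> 0"
proof (rule ccontr)
  assume "\<not> e \<le> 0"
  then have "2 powr e > 1" using powr_mono2[of e 1 2] by (simp add: gr_one_powr)
  then obtain k where "B < (2 powr e) ^ k" using real_arch_pow by blast
  also have "(2 powr e) ^ k = (2 ^ k) powr e" by (simp add: powr_power powr_powr mult.commute flip: powr_realpow)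
  finally show False using assms[of k] by simp
qed

text \<open>One inequality for each edge of the triangle. A linear functional bounded at the
  vertices is bounded on the hull, and strictness comes from passing to the interior of the
  half-plane.\<close>

lemma region_R_bounds:
  assumes d: "d \<ge> 5" and st: "(s, t) \<in> region_R d"
  shows "s < 1 - 2 / d" "1 - t < s" "2 * s < (d - 2) * (1 - t)"
proof -
  have half: "a * s + b * t < c"
    if nz: "(a, b) \<noteq> (0, 0)" and pts: "b \<le> c" "a * ((d - 2) / d) + b * (2 / d) \<le> c" "a * ((d - 2) / d) + b * ((d - 2) / d) \<le> c"
    for a b c :: real
  proof -
    have "convex hull {(0, 1), ((d - 2) / d, 2 / d), ((d - 2) / d, (d - 2) / d)} \<subseteq> {x. (a, b) \<bullet> x \<le> c}"
      using pts by (intro hull_minimal convex_halfspace_le) (auto simp: inner_prod_def)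
    then have "interior (convex hull {(0, 1), ((d - 2) / d, 2 / d), ((d - 2) / d, (d - 2) / d)}) \<subseteq> interior {x. (a, b) \<bullet> x \<le> c}"
      by (rule interior_mono)
    also have "\<dots> = {x. (a, b) \<bullet> x < c}" using nz by (intro interior_halfspace_le) (auto simp: zero_prod_def)
    finally show ?thesis using st by (auto simp: region_R_def inner_prod_def)
  qed
  show "s < 1 - 2 / d" using half[of 1 0 "1 - 2 / d"] d by (simp add: field_simps)
  show "1 - t < s" using half[of "-1" "-1" "-1"] d by (simp add: field_simps)
  have "(d - 2) * (4 / d) \<le> (d - 2) * 1" using d by (intro mult_left_mono) auto
  moreover have "2 * ((d - 2) / d) + (d - 2) * (2 / d) = (d - 2) * (4 / d)"
    "2 * ((d - 2) / d) + (d - 2) * ((d - 2) / d) = d - 2" using d by (auto simp: field_simps)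
  ultimately have "2 * s + (d - 2) * t < d - 2" using d by (intro half) auto
  then show "2 * s < (d - 2) * (1 - t)" by (simp add: algebra_simps)
qed

section \<open>Sufficiency\<close>

lemma dyadic_maximal_estimate:
  assumes d: "CARD('n::finite) \<ge> 5" and st: "(s, t) \<in> region_R (real CARD('n))"
  shows "\<exists>A::real. \<forall>(f :: int ^ 'n \<Rightarrow> complex) (k::nat).
               lp_norm s (\<lambda>x. ennreal (cmod (f x))) < \<infinity> \<longrightarrow>
               lp_norm (1 - t) (dyad_max (2 ^ k) f)
                 \<le> ennreal (A * (2 ^ k) powr (real CARD('n) * ((1 - t) - s)))
                    * lp_norm s (\<lambda>x. ennreal (cmod (f x)))"
proof -
  define D where "D = real CARD('n)"
  have D5: "D \<ge> 5" using d by (simp add: D_def)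
  note b = region_R_bounds[OF D5 st[folded D_def]]
  define u where "u = 1 - t"
  have u0: "u > 0"
  proof -
    have "2 * u < (D - 2) * u" using b by (simp add: u_def)
    then have "0 < (D - 4) * u" by (simp add: algebra_simps)
    then show ?thesis using D5 by (simp add: zero_less_mult_iff)
  qed
  have s0: "s > 0" using u0 b by (simp add: u_def)
  obtain C where C: "C > 0" and est: "\<And>k (X :: (int^'n) set) Y F \<nu>.
     \<lbrakk>finite X; finite Y; \<And>y. F y \<ge> 0;
      \<And>x. x \<in> X \<Longrightarrow> 4 ^ k \<le> \<nu> x \<and> \<nu> x < 4 * 4 ^ k;
      \<And>x y. x \<in> X \<Longrightarrow> sqnorm y = \<nu> x \<Longrightarrow> x - y \<in> Y\<rbrakk> \<Longrightarrow>
     (\<Sum>x\<in>X. lattice_avg (\<nu> x) F x powr (1 / (1 - t))) powr (1 - t)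
       \<le> C * (2 ^ k) powr (real CARD('n) * ((1 - t) - s)) * (\<Sum>y\<in>Y. F y powr (1 / s)) powr s"
    by (rule finite_dyadic_estimate[OF d b[unfolded D_def]]) auto
  have "lp_norm u (dyad_max (2 ^ k) f) \<le> ennreal (C * (2 ^ k) powr (D * (u - s))) * lp_norm s (\<lambda>x. ennreal (cmod (f x)))"
    if fin: "lp_norm s (\<lambda>x. ennreal (cmod (f x))) < \<infinity>" for f :: "int^'n \<Rightarrow> complex" and k
  proof -
    define F where "F x = cmod (f x)" for x
    obtain P where P: "P \<ge> 0" "lp_norm s (\<lambda>x. ennreal (F x)) = ennreal (P powr s)"
      and PX: "\<And>X. finite X \<Longrightarrow> (\<Sum>x\<in>X. F x powr (1 / s)) \<le> P"
      using lp_norm_finite_sums[OF s0, of F] fin by (auto simp: F_def)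
    have "\<forall>x. \<exists>n. 4 ^ k \<le> n \<and> n < 4 * 4 ^ k \<and> dyad_max (2 ^ k) f x = ennreal (cmod (lattice_avg n f x))"
      using dyad_max_attained by metis
    then obtain \<nu> where \<nu>: "\<And>x. 4 ^ k \<le> \<nu> x \<and> \<nu> x < 4 * 4 ^ k"
      and dm: "\<And>x. dyad_max (2 ^ k) f x = ennreal (cmod (lattice_avg (\<nu> x) f x))" by metis
    have "lp_norm u (\<lambda>x. ennreal (cmod (lattice_avg (\<nu> x) f x))) \<le> ennreal (C * (2 ^ k) powr (D * (u - s)) * P powr s)"
    proof (rule lp_norm_le[OF u0])
      fix X :: "(int^'n) set" assume X: "finite X"
      \<comment> \<open>The finitely many points that the averages over \<open>X\<close> read, so
        cutting f down to them changes nothing.\<close>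
      define Y where "Y = (\<Union>x\<in>X. (\<lambda>y. x - y) ` {y. sqnorm y = \<nu> x})"
      have Y: "finite Y" using X finite_sqnorm by (auto simp: Y_def)
      have "(\<Sum>x\<in>X. cmod (lattice_avg (\<nu> x) f x) powr (1 / u)) powr u \<le> (\<Sum>x\<in>X. lattice_avg (\<nu> x) F x powr (1 / u)) powr u"
        using u0 norm_lattice_avg_le[of _ f] unfolding F_def
        by (intro powr_mono2 sum_mono) (auto intro: sum_nonneg)
      also have "\<dots> \<le> C * (2 ^ k) powr (D * (u - s)) * (\<Sum>y\<in>Y. F y powr (1 / s)) powr s"
        unfolding D_def u_def by (rule est[OF X Y]) (use \<nu> in \<open>auto simp: F_def Y_def\<close>)
      also have "\<dots> \<le> C * (2 ^ k) powr (D * (u - s)) * P powr s"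
        using C PX[OF Y] s0 by (intro mult_left_mono powr_mono2) (auto intro: sum_nonneg)
      finally show "(\<Sum>x\<in>X. cmod (lattice_avg (\<nu> x) f x) powr (1 / u)) powr u \<le> C * (2 ^ k) powr (D * (u - s)) * P powr s" .
    qed (use C in auto)
    also have "\<dots> = ennreal (C * (2 ^ k) powr (D * (u - s))) * lp_norm s (\<lambda>x. ennreal (cmod (f x)))"
      using P C by (simp add: F_def ennreal_mult)
    finally show ?thesis unfolding dm .
  qed
  then show ?thesis unfolding D_def u_def by blast
qed

section \<open>Counting on dyadic shells and necessity\<close>

lemma card_sqnorm_pos:
  assumes "CARD('n::finite) \<ge> 5" "n \<ge> 1"
  shows "card {y :: int^'n. sqnorm y = n} > 0"
proof -
  obtain c where "c > 0" "c * real_of_int n powr (real CARD('n) / 2 - 1) \<le> card {y :: int^'n. sqnorm y = n}"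
    using card_sqnorm_ge[OF assms(1)] assms(2) by metis
  moreover have "real_of_int n powr (real CARD('n) / 2 - 1) > 0" using assms by simp
  ultimately have "0 < real (card {y :: int^'n. sqnorm y = n})" by (meson less_le_trans mult_pos_pos)
  then show ?thesis by simp
qed

lemma card_dyadic_shell_le:
  "real (card {x :: int^'n::finite. 4 ^ k \<le> sqnorm x \<and> sqnorm x < 4 * 4 ^ k}) \<le> (5 * 2 ^ k) powr real CARD('n)"
  "finite {x :: int^'n::finite. 4 ^ k \<le> sqnorm x \<and> sqnorm x < 4 * 4 ^ k}"
proof -
  define R :: nat where "R = 2 * 2 ^ k"
  have "(2::int) ^ k * 2 ^ k = 4 ^ k" by (simp flip: power_mult_distrib)
  then have R2: "(int R)\<^sup>2 = 4 * 4 ^ k" by (simp add: R_def power2_eq_square)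
  have sub: "{x :: int^'n. 4 ^ k \<le> sqnorm x \<and> sqnorm x < 4 * 4 ^ k} \<subseteq> lattice_box R"
    by (auto intro!: sqnorm_in_lattice_box simp: R2)
  show "finite {x :: int^'n. 4 ^ k \<le> sqnorm x \<and> sqnorm x < 4 * 4 ^ k}" by (rule finite_subset[OF sub]) simp
  have "card {x :: int^'n. 4 ^ k \<le> sqnorm x \<and> sqnorm x < 4 * 4 ^ k} \<le> (2 * R + 1) ^ CARD('n)"
    using card_mono[OF _ sub] by (simp add: card_lattice_box)
  also have "\<dots> \<le> (5 * 2 ^ k) ^ CARD('n)" by (intro power_mono) (auto simp: R_def)
  finally have "real (card {x :: int^'n. 4 ^ k \<le> sqnorm x \<and> sqnorm x < 4 * 4 ^ k}) \<le> real ((5 * 2 ^ k) ^ CARD('n))"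
    by (simp only: of_nat_le_iff)
  also have "\<dots> = (5 * 2 ^ k) powr real CARD('n)" by (simp add: powr_realpow)
  finally show "real (card {x :: int^'n. 4 ^ k \<le> sqnorm x \<and> sqnorm x < 4 * 4 ^ k}) \<le> (5 * 2 ^ k) powr real CARD('n)" .
qed

lemma sum_dyadic_shell:
  fixes \<phi> :: "int \<Rightarrow> real"
  shows "(\<Sum>x\<in>{x :: int^'n::finite. 4 ^ k \<le> sqnorm x \<and> sqnorm x < 4 * 4 ^ k}. \<phi> (sqnorm x))
    = (\<Sum>n\<in>{4 ^ k..<4 * 4 ^ k}. real (card {y :: int^'n. sqnorm y = n}) * \<phi> n)"
proof -
  let ?S = "{x :: int^'n. 4 ^ k \<le> sqnorm x \<and> sqnorm x < 4 * 4 ^ k}"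
  have "(\<Sum>x\<in>?S. \<phi> (sqnorm x)) = (\<Sum>n\<in>{4 ^ k..<4 * 4 ^ k}. \<Sum>x\<in>{x\<in>?S. sqnorm x = n}. \<phi> (sqnorm x))"
    by (rule sum.group[symmetric]) (use card_dyadic_shell_le in auto)
  also have "\<dots> = (\<Sum>n\<in>{4 ^ k..<4 * 4 ^ k}. real (card {y :: int^'n. sqnorm y = n}) * \<phi> n)"
  proof (rule sum.cong[OF refl])
    fix n assume "n \<in> {4 ^ k..<4 * (4::int) ^ k}"
    then have "{x\<in>?S. sqnorm x = n} = {y. sqnorm y = n}" by auto
    then show "(\<Sum>x\<in>{x\<in>?S. sqnorm x = n}. \<phi> (sqnorm x)) = real (card {y :: int^'n. sqnorm y = n}) * \<phi> n" by simp
  qed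
  finally show ?thesis .
qed

lemma dyadic_estimate_necessary:
  assumes d: "CARD('n::finite) \<ge> 5" and s: "0 \<le> s" "s \<le> 1" and t: "0 \<le> t" "t \<le> 1"
    and est: "\<And>(f :: int ^ 'n \<Rightarrow> complex) (k::nat). lp_norm s (\<lambda>x. ennreal (cmod (f x))) < \<infinity> \<Longrightarrow>
               lp_norm (1 - t) (dyad_max (2 ^ k) f)
                 \<le> ennreal (A * (2 ^ k) powr (real CARD('n) * ((1 - t) - s)))
                    * lp_norm s (\<lambda>x. ennreal (cmod (f x)))"
  shows "s + 2 / real CARD('n) \<le> 1" "t + 2 * s / real CARD('n) \<le> 1"
proof -
  define D where "D = real CARD('n)"
  have D5: "D \<ge> 5" using d by (simp add: D_def)
  define u where "u = 1 - t"
  have u: "0 \<le> u" "u \<le> 1" using t by (auto simp: u_def)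
  \<comment> \<open>The given constant may be nonpositive; a positive one lets products move in and
    out of \<open>ennreal\<close>.\<close>
  define A' where "A' = max A 1"
  have A': "A' > 0" "A \<le> A'" by (auto simp: A'_def)
  define N where "N n = real (card {y :: int^'n. sqnorm y = n})" for n
  define Sh where "Sh k = {x :: int^'n. 4 ^ k \<le> sqnorm x \<and> sqnorm x < 4 * 4 ^ k}" for k
  have Npos: "N n > 0" if "n \<in> {4 ^ k..<4 * 4 ^ k}" for n k
  proof -
    have "(1::int) \<le> 4 ^ k" by simp
    then have "n \<ge> 1" using that by (meson atLeastLessThan_iff order_trans)
    then show ?thesis unfolding N_def using card_sqnorm_pos[OF d, of n] by simp
  qed
  have L2: "((2::real) ^ k) powr 2 = 4 ^ k" for k by (simp add: power2_eq_square flip: power_mult_distrib)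
  have est': "lp_norm u (dyad_max (2 ^ k) (\<lambda>x. if x \<in> S then 1 else 0)) \<le> ennreal (A' * (2 ^ k) powr (D * (u - s)) * real (card S) powr s)"
    if S: "finite S" "S \<noteq> {}" for S :: "(int^'n) set" and k
  proof -
    let ?f = "\<lambda>x. if x \<in> S then 1 else 0 :: complex"
    have le: "lp_norm s (\<lambda>x. ennreal (cmod (?f x))) \<le> ennreal (real (card S) powr s)"
      by (rule lp_norm_indicator_le[OF s(1) S])
    then have "lp_norm s (\<lambda>x. ennreal (cmod (?f x))) < \<infinity>" using le_less_trans by fastforce
    then have "lp_norm u (dyad_max (2 ^ k) ?f) \<le> ennreal (A * (2 ^ k) powr (D * (u - s))) * lp_norm s (\<lambda>x. ennreal (cmod (?f x)))"
      unfolding u_def D_def by (rule est)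
    also have "\<dots> \<le> ennreal (A' * (2 ^ k) powr (D * (u - s))) * ennreal (real (card S) powr s)"
      using A' by (intro mult_mono le ennreal_leI mult_right_mono) auto
    also have "\<dots> = ennreal (A' * (2 ^ k) powr (D * (u - s)) * real (card S) powr s)"
      using A' by (simp add: ennreal_mult)
    finally show ?thesis .
  qed
  have low: "ennreal (cmod (lattice_avg n f x)) \<le> dyad_max (2 ^ k) f x" if "n \<in> {4 ^ k..<4 * 4 ^ k}" for n f k and x :: "int^'n"
    unfolding dyad_max_eq using that by (intro SUP_upper)
  show "s + 2 / D \<le> 1"
  proof -
    have "(2 ^ k) powr (2 - D + D * s) \<le> 5 powr (D * (1 - u)) * A'" for k :: nat
    proof -
      define L where "L = (2::real) ^ k"
      have L1: "L > 0" by (simp add: L_def)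
      \<comment> \<open>The maximal function of the point mass is at least 1 / N at each point of a
        sphere with N points. Every sphere thus has total 1, and the shell has total 3 * 4^k
        whatever the sphere sizes. Hoelder on its at most (5 L)^D points gives L^2 \<le> C L^(D - D
        s).\<close>
      define v where "v x = (if x \<in> Sh k then 1 / N (sqnorm x) else 0)" for x :: "int^'n"
      have v0: "v x \<ge> 0" for x by (simp add: v_def N_def)
      have vd: "ennreal (v x) \<le> dyad_max (2 ^ k) (\<lambda>x. if x \<in> {0} then 1 else 0) x" for x :: "int^'n"
      proof (cases "x \<in> Sh k")
        case True
        then have n: "sqnorm x \<in> {4 ^ k..<4 * 4 ^ k}" by (simp add: Sh_def)
        have "(\<Sum>y | sqnorm y = sqnorm x. (if x - y \<in> {0} then 1 else 0 :: complex)) = (\<Sum>y\<in>{x}. 1)"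
          by (rule sum.mono_neutral_cong_right) (auto simp: finite_sqnorm)
        then have "cmod (lattice_avg (sqnorm x) (\<lambda>x. if x \<in> {0} then 1 else 0) x) = v x"
          using True by (simp add: lattice_avg_def v_def N_def norm_divide)
        then show ?thesis using low[OF n, of "\<lambda>x. if x \<in> {0} then 1 else 0" x] by simp
      qed (simp add: v_def)
      have "(\<Sum>x\<in>Sh k. v x) = (\<Sum>x\<in>Sh k. 1 / N (sqnorm x))" by (simp add: v_def)
      also have "\<dots> = (\<Sum>n\<in>{4 ^ k..<4 * 4 ^ k}. N n * (1 / N n))"
        unfolding Sh_def N_def by (rule sum_dyadic_shell)
      also have "\<dots> = (\<Sum>n\<in>{4 ^ k..<4 * (4::int) ^ k}. 1)"
      proof (rule sum.cong[OF refl])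
        fix n assume "n \<in> {4 ^ k..<4 * (4::int) ^ k}"
        then have "N n > 0" by (rule Npos)
        then show "N n * (1 / N n) = 1" by simp
      qed
      also have "\<dots> = 3 * 4 ^ k" by (simp add: nat_mult_distrib nat_power_eq)
      finally have "ennreal (3 * 4 ^ k) = ennreal (\<Sum>x\<in>Sh k. v x)" by simp
      also have "\<dots> \<le> ennreal (((5 * L) powr D) powr (1 - u)) * lp_norm u (\<lambda>x. ennreal (v x))"
        using card_dyadic_shell_le[where 'n='n and k=k] unfolding Sh_def L_def D_def
        by (intro sum_le_lp_norm u v0) auto
      also have "\<dots> \<le> ennreal (((5 * L) powr D) powr (1 - u)) * ennreal (A' * L powr (D * (u - s)) * real (card {0::int^'n}) powr s)"
        unfolding L_def by (intro mult_left_mono order_trans[OF lp_norm_mono est'] vd u) auto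
      also have "\<dots> = ennreal (((5 * L) powr D) powr (1 - u) * (A' * L powr (D * (u - s))))"
        using A' by (simp add: ennreal_mult)
      finally have "3 * 4 ^ k \<le> ((5 * L) powr D) powr (1 - u) * (A' * L powr (D * (u - s)))"
        using A' by (simp add: ennreal_le_iff)
      then have "4 ^ k \<le> ((5 * L) powr D) powr (1 - u) * (A' * L powr (D * (u - s)))"
        by (smt (verit) zero_le_power)
      then have "L powr 2 \<le> 5 powr (D * (1 - u)) * A' * (L powr (D * (1 - u)) * L powr (D * (u - s)))"
        using L2[of k] by (simp add: L_def[symmetric] powr_powr powr_mult mult_ac)
      also have "L powr (D * (1 - u)) * L powr (D * (u - s)) = L powr (D - D * s)"
        by (simp add: algebra_simps flip: powr_add)
      finally have "L powr 2 / L powr (D - D * s) \<le> 5 powr (D * (1 - u)) * A'" using L1 by (simp add: field_simps)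
      also have "L powr 2 / L powr (D - D * s) = L powr (2 - D + D * s)" by (simp add: algebra_simps flip: powr_diff)
      finally show ?thesis by (simp add: L_def)
    qed
    then have "2 - D + D * s \<le> 0" by (rule dyadic_powr_bounded_imp_nonpos)
    then show ?thesis using D5 by (simp add: field_simps)
  qed
  show "t + 2 * s / D \<le> 1"
  proof -
    have "(2 ^ k) powr (2 * s - D * u) \<le> A' * 5 powr (D * s)" for k :: nat
    proof -
      define L where "L = (2::real) ^ k"
      have L1: "L > 0" by (simp add: L_def)
      \<comment> \<open>Pigeonhole: the shell has at most (5 L)^D points on 3 * 4^k spheres, so some
        sphere has at most (5 L)^D / L^2. The average of its indicator at the origin is 1, which
        gives 1 \<le> C L^(D u - 2 s).\<close>
      obtain n where n: "n \<in> {4 ^ k..<4 * 4 ^ k}" and Nn: "N n \<le> (5 * L) powr D / L powr 2"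
      proof -
        have "\<exists>n\<in>{4 ^ k..<4 * 4 ^ k}. N n \<le> (5 * L) powr D / L powr 2"
        proof (rule ccontr)
          assume "\<not> ?thesis"
          then have "(5 * L) powr D / L powr 2 < N n" if "n \<in> {4 ^ k..<4 * 4 ^ k}" for n
            using that by (meson not_le)
          then have "(\<Sum>n\<in>{4 ^ k..<4 * (4::int) ^ k}. (5 * L) powr D / L powr 2) < (\<Sum>n\<in>{4 ^ k..<4 * 4 ^ k}. N n)"
            by (intro sum_strict_mono) auto
          also have "\<dots> = (\<Sum>x\<in>Sh k. 1)" using sum_dyadic_shell[where \<phi>="\<lambda>_. 1" and 'n='n and k=k] by (simp add: Sh_def N_def)
          also have "\<dots> \<le> (5 * L) powr D" using card_dyadic_shell_le(1)[where 'n='n and k=k] by (simp add: Sh_def L_def D_def)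
          finally have "3 * 4 ^ k * ((5 * L) powr D / L powr 2) < (5 * L) powr D"
            by (simp add: nat_mult_distrib nat_power_eq)
          then show False using L1 L2[of k] by (simp add: L_def[symmetric])
        qed
        then show ?thesis using that by blast
      qed
      define S where "S = {y :: int^'n. sqnorm y = n}"
      have S: "finite S" "S \<noteq> {}" using Npos[OF n] by (auto simp: S_def finite_sqnorm N_def card_gt_0_iff)
      let ?f = "\<lambda>x. if x \<in> S then 1 else 0 :: complex"
      define v where "v x = (if x = 0 then 1 else 0 :: real)" for x :: "int^'n"
      have neg: "sqnorm (- y) = sqnorm y" for y :: "int^'n" by (simp add: sqnorm_def)
      have "lattice_avg n ?f 0 = 1"
        using S by (simp add: lattice_avg_def S_def neg card_gt_0_iff)
      then have v: "ennreal (v x) \<le> dyad_max (2 ^ k) ?f x" for x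
        using low[OF n, of ?f 0] by (simp add: v_def)
      have "ennreal 1 = ennreal (\<Sum>x\<in>{0}. v x)" by (simp add: v_def)
      also have "\<dots> \<le> ennreal (1 powr (1 - u)) * lp_norm u (\<lambda>x. ennreal (v x))"
        by (intro sum_le_lp_norm u) (auto simp: v_def)
      also have "\<dots> \<le> lp_norm u (dyad_max (2 ^ k) ?f)" using v u by (simp add: lp_norm_mono)
      also have "\<dots> \<le> ennreal (A' * L powr (D * (u - s)) * real (card S) powr s)" unfolding L_def by (rule est'[OF S])
      finally have "1 \<le> A' * L powr (D * (u - s)) * real (card S) powr s" using A' by (simp add: ennreal_le_iff)
      also have "\<dots> \<le> A' * L powr (D * (u - s)) * ((5 * L) powr D / L powr 2) powr s"
        using Nn A' s by (intro mult_left_mono powr_mono2) (auto simp: S_def N_def)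
      also have "\<dots> = A' * 5 powr (D * s) * L powr (D * u - 2 * s)"
      proof -
        have 1: "((5 * L) powr D / L powr 2) powr s = 5 powr (D * s) * (L powr (D * s) / L powr (2 * s))"
          by (simp add: powr_mult powr_divide powr_powr)
        have 2: "L powr (D * (u - s)) * (L powr (D * s) / L powr (2 * s)) = L powr (D * u - 2 * s)"
          using L1 by (simp add: algebra_simps flip: powr_add powr_diff)
        show ?thesis unfolding 1 2[symmetric] by (simp only: mult_ac)
      qed
      finally have "1 \<le> A' * 5 powr (D * s) * L powr (D * u - 2 * s)" .
      then have "1 * L powr (2 * s - D * u) \<le> A' * 5 powr (D * s) * L powr (D * u - 2 * s) * L powr (2 * s - D * u)"
        by (rule mult_right_mono) simp
      also have "\<dots> = A' * 5 powr (D * s)" using L1 by (simp add: mult.assoc flip: powr_add)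
      finally show ?thesis by (simp add: L_def)
    qed
    then have "2 * s - D * u \<le> 0" by (rule dyadic_powr_bounded_imp_nonpos)
    then show ?thesis using D5 by (simp add: u_def field_simps)
  qed
qed

theorem mainTheorem1:
  fixes dummy :: "'n::finite itself"
  assumes "CARD('n) \<ge> 5"
  shows "(\<forall>s t. (s, t) \<in> region_R (real CARD('n)) \<longrightarrow>
            (\<exists>A::real. \<forall>(f :: int ^ 'n \<Rightarrow> complex) (k::nat).
               lp_norm s (\<lambda>x. ennreal (cmod (f x))) < \<infinity> \<longrightarrow>
               lp_norm (1 - t) (dyad_max (2 ^ k) f)
                 \<le> ennreal (A * (2 ^ k) powr (real CARD('n) * ((1 - t) - s)))
                    * lp_norm s (\<lambda>x. ennreal (cmod (f x)))))
       \<and> (\<forall>s t. 0 \<le> s \<and> s \<le> 1 \<and> 0 \<le> t \<and> t \<le> 1 \<longrightarrow>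
            (\<exists>A::real. \<forall>(f :: int ^ 'n \<Rightarrow> complex) (k::nat).
               lp_norm s (\<lambda>x. ennreal (cmod (f x))) < \<infinity> \<longrightarrow>
               lp_norm (1 - t) (dyad_max (2 ^ k) f)
                 \<le> ennreal (A * (2 ^ k) powr (real CARD('n) * ((1 - t) - s)))
                    * lp_norm s (\<lambda>x. ennreal (cmod (f x))))
            \<longrightarrow> max (s + 2 / real CARD('n)) (t + 2 * s / real CARD('n)) \<le> 1)"
proof (intro conjI allI impI)
  fix s t assume "(s, t) \<in> region_R (real CARD('n))"
  then show "\<exists>A::real. \<forall>(f :: int ^ 'n \<Rightarrow> complex) (k::nat).
               lp_norm s (\<lambda>x. ennreal (cmod (f x))) < \<infinity> \<longrightarrow>
               lp_norm (1 - t) (dyad_max (2 ^ k) f)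
                 \<le> ennreal (A * (2 ^ k) powr (real CARD('n) * ((1 - t) - s)))
                    * lp_norm s (\<lambda>x. ennreal (cmod (f x)))"
    by (rule dyadic_maximal_estimate[OF assms])
next
  fix s t :: real
  assume st: "0 \<le> s \<and> s \<le> 1 \<and> 0 \<le> t \<and> t \<le> 1"
    and "\<exists>A::real. \<forall>(f :: int ^ 'n \<Rightarrow> complex) (k::nat).
               lp_norm s (\<lambda>x. ennreal (cmod (f x))) < \<infinity> \<longrightarrow>
               lp_norm (1 - t) (dyad_max (2 ^ k) f)
                 \<le> ennreal (A * (2 ^ k) powr (real CARD('n) * ((1 - t) - s)))
                    * lp_norm s (\<lambda>x. ennreal (cmod (f x)))"
  then obtain A :: real where "\<And>(f :: int ^ 'n \<Rightarrow> complex) (k::nat).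
               lp_norm s (\<lambda>x. ennreal (cmod (f x))) < \<infinity> \<Longrightarrow>
               lp_norm (1 - t) (dyad_max (2 ^ k) f)
                 \<le> ennreal (A * (2 ^ k) powr (real CARD('n) * ((1 - t) - s)))
                    * lp_norm s (\<lambda>x. ennreal (cmod (f x)))" by blast
  from dyadic_estimate_necessary[OF assms _ _ _ _ this] st
  show "max (s + 2 / real CARD('n)) (t + 2 * s / real CARD('n)) \<le> 1" by simp
qed

end
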